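(* Let $\xi\in\mathscr L^2_{\mathcal F_T}(\Omega,\mathscr K(\mathbb R^d))$ and let $f:[0,T]\times\Omega\times\mathscr K(\mathbb R^d)\to\mathscr K(\mathbb R^d)$ satisfy: (i) for each fixed $A\in\mathscr K(\mathbb R^d)$, $f(\cdot,\cdot,A)$ is an $\mathbb F$-progressively measurable set-valued process; (ii) $\mathbb E\big[\int_0^T\|f(t,\{0\})\|^2dt\big]<\infty$; (iii) there exists $K>0$ such that $h(f(t,\omega,A),f(t,\omega,B))\le K\,h(A,B)$ for all $A,B\in\mathscr K(\mathbb R^d)$ and $(t,\omega)\in[0,T]\times\Omega$. Then the set-valued BSDE $$Y_t=\mathbb E\Big[\xi+\int_t^Tf(s,Y_s)\,ds\,\Big|\,\mathcal F_t\Big],\qquad t\in[0,T],$$ has a solution $Y\in\mathscr L^2_{\mathbb F}([0,T]\times\Omega,\mathscr K(\mathbb R^d))$, i.e. the equation holds $\mathbb P$-a.s. for each $t\in[0,T]$. Moreover, the solution is unique up to modifications: if $Y'\in\mathscr L^2_{\mathbb F}([0,T]\times\Omega,\mathscr K(\mathbb R^d))$ is another solution, then $Y_t=Y'_t$ $\mathbb P$-a.s. for every $t\in[0,T]$.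
   Context: Let $(\Omega,\mathcal F,\mathbb P)$ be a complete probability space carrying a standard $m$-dimensional Brownian motion $B=\{B_t\}_{t\in[0,T]}$, $T>0$, and let $\mathbb F=\{\mathcal F_t\}_{t\in[0,T]}$ be the natural filtration of $B$ augmented by all $\mathbb P$-null sets. $\mathscr C(\mathbb R^d)$ (resp. $\mathscr K(\mathbb R^d)$) is the set of nonempty closed (resp. nonempty compact convex) subsets of $\mathbb R^d$. $A+B=\{a+b:a\in A,b\in B\}$; $h$ is the Hausdorff distance; $\|A\|=h(A,\{0\})=\sup_{a\in A}|a|$. A map $F$ from a measurable space $(E,\mathcal E)$ into $\mathscr C(\mathbb R^d)$ is measurable if $\{e:F(e)\cap D\neq\emptyset\}\in\mathcal E$ for all closed $D\subset\mathbb R^d$; progressive measurability of set-valued processes is understood accordingly. For a sub-$\sigma$-field $\mathcal G\subset\mathcal F$, $\mathscr L^p_{\mathcal G}(\Omega,\mathscr K(\mathbb R^d))$ is the set of $\mathcal G$-measurable $X:\Omega\to\mathscr K(\mathbb R^d)$ with $\mathbb E\|X\|^p<\infty$. $\mathscr L^2_{\mathbb F}([0,T]\times\Omega,\mathscr K(\mathbb R^d))$ is the set of $\mathbb F$-progressively measurable $\mathscr K(\mathbb R^d)$-valued processes $\Phi$ with $\mathbb E\int_0^T\|\Phi_t\|^2dt<\infty$. $S^p_{\mathcal G}(X)$ is the set of all $f\in\mathbb L^p_{\mathcal G}(\Omega,\mathbb R^d)$ with $f\in X$ a.s. Conditional expectation: for $X$ integrably bounded, $\mathbb E[X|\mathcal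 G]$ is the a.s. unique $\mathcal G$-measurable closed-valued set-valued random variable with $S^1_{\mathcal G}(\mathbb E[X|\mathcal G])=\mathrm{cl}\{\mathbb E[g|\mathcal G]:g\in S^1_{\mathcal F}(X)\}$ (closure in $\mathbb L^1$). Set-valued time integral: for $\Phi\in\mathscr L^2_{\mathbb F}([0,T]\times\Omega,\mathscr K(\mathbb R^d))$ let $S^2_{\mathbb F}(\Phi)$ be the set of square-integrable $\mathbb F$-progressively measurable selectors of $\Phi$. Then $\int_t^T\Phi_s\,ds$ is the unique $\mathcal F_T$-measurable set-valued random variable with $S^2_{\mathcal F_T}\big(\int_t^T\Phi_sds\big)=\overline{\mathrm{dec}}_{\mathcal F_T}\big\{\int_t^T\phi_sds:\phi\in S^2_{\mathbb F}(\Phi)\big\}$. Here $\overline{\mathrm{dec}}_{\mathcal F_T}(V)$ is the smallest closed subset of $\mathbb L^2_{\mathcal F_T}(\Omega,\mathbb R^d)$ that contains $V$ and is decomposable (closed under $(f_1,f_2)\mapsto\mathbf 1_Df_1+\mathbf 1_{D^c}f_2$, $D\in\mathcal F_T$). *)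

theory Defs
  imports "HOL-Probability.Probability" "HOL-Library.Set_Algebras"
begin

definition closed_sets :: "('v::euclidean_space) set set" where
  "closed_sets = {A. A \<noteq> {} \<and> closed A}"

definition compact_convex_sets :: "('v::euclidean_space) set set" where
  "compact_convex_sets = {A. A \<noteq> {} \<and> compact A \<and> convex A}"

text \<open>Extended-valued, so that unbounded closed sets get distance \<open>\<infinity>\<close> from bounded
  ones; meaningful for nonempty arguments only, since \<^term>\<open>infdist x {} = 0\<close>.\<close>

definition hausdorff_dist :: "('v::euclidean_space) set \<Rightarrow> 'v set \<Rightarrow> ennreal" where
  "hausdorff_dist A B =
     max (SUP a\<in>A. ennreal (infdist a B)) (SUP b\<in>B. ennreal (infdist b A))"

definition set_norm :: "('v::euclidean_space) set \<Rightarrow> ennreal" where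
  "set_norm A = hausdorff_dist A {0}"

definition standard_brownian_motion ::
    "'w measure \<Rightarrow> real \<Rightarrow> (real \<Rightarrow> 'w \<Rightarrow> real ^ 'm) \<Rightarrow> bool" where
  "standard_brownian_motion M T B \<longleftrightarrow>
     (\<forall>t\<in>{0..T}. B t \<in> borel_measurable M) \<and>
     (AE \<omega> in M. B 0 \<omega> = 0) \<and>
     (AE \<omega> in M. continuous_on {0..T} (\<lambda>t. B t \<omega>)) \<and>
     (\<forall>s t. 0 \<le> s \<and> s < t \<and> t \<le> T \<longrightarrow>
        distributed M lborel (\<lambda>\<omega>. B t \<omega> - B s \<omega>)
          (\<lambda>x. ennreal (\<Prod>i\<in>UNIV. normal_density 0 (sqrt (t - s)) (x $ i)))) \<and>
     (\<forall>(n::nat) \<tau>. 0 \<le> \<tau> 0 \<and> (\<forall>i<n. \<tau> i < \<tau> (Suc i)) \<and> \<tau> n \<le> T \<longrightarrow>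
        prob_space.indep_vars M (\<lambda>_. borel) (\<lambda>i \<omega>. B (\<tau> (Suc i)) \<omega> - B (\<tau> i) \<omega>) {..<n})"

text \<open>Sub-\<open>\<sigma>\<close>-fields of \<open>M\<close> are represented by measures of which only \<^const>\<open>space\<close> and
  \<^const>\<open>sets\<close> matter; all integrals are taken with respect to \<open>M\<close>.\<close>

definition natural_filtration ::
    "'w measure \<Rightarrow> (real \<Rightarrow> 'w \<Rightarrow> real ^ 'm) \<Rightarrow> real \<Rightarrow> 'w measure" where
  "natural_filtration M B t =
     sigma (space M)
       ({B s -` A \<inter> space M | s A. s \<in> {0..t} \<and> A \<in> sets borel} \<union> null_sets M)"

definition set_measurable :: "'e measure \<Rightarrow> ('e \<Rightarrow> ('v::euclidean_space) set) \<Rightarrow> bool" where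
  "set_measurable N X \<longleftrightarrow>
     (\<forall>e\<in>space N. X e \<in> closed_sets) \<and>
     (\<forall>D. closed D \<longrightarrow> {e \<in> space N. X e \<inter> D \<noteq> {}} \<in> sets N)"

abbreviation prog_space :: "(real \<Rightarrow> 'w measure) \<Rightarrow> real \<Rightarrow> (real \<times> 'w) measure" where
  "prog_space F t \<equiv> restrict_space borel {0..t} \<Otimes>\<^sub>M F t"

definition set_progressive ::
    "(real \<Rightarrow> 'w measure) \<Rightarrow> real \<Rightarrow> (real \<Rightarrow> 'w \<Rightarrow> ('v::euclidean_space) set) \<Rightarrow> bool" where
  "set_progressive F T \<Phi> \<longleftrightarrow>
     (\<forall>t\<in>{0..T}. set_measurable (prog_space F t) (\<lambda>(s, \<omega>). \<Phi> s \<omega>))"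

definition progressive ::
    "(real \<Rightarrow> 'w measure) \<Rightarrow> real \<Rightarrow> (real \<Rightarrow> 'w \<Rightarrow> 'v::euclidean_space) \<Rightarrow> bool" where
  "progressive F T \<phi> \<longleftrightarrow>
     (\<forall>t\<in>{0..T}. (\<lambda>(s, \<omega>). \<phi> s \<omega>) \<in> borel_measurable (prog_space F t))"

definition set_Lp ::
    "nat \<Rightarrow> 'w measure \<Rightarrow> 'w measure \<Rightarrow> ('w \<Rightarrow> ('v::euclidean_space) set) set" where
  "set_Lp p M G =
     {X. set_measurable G X \<and> (\<forall>\<omega>\<in>space M. X \<omega> \<in> compact_convex_sets) \<and>
         (\<integral>\<^sup>+\<omega>. set_norm (X \<omega>) ^ p \<partial>M) < \<infinity>}"

definition set_process_L2 ::
    "'w measure \<Rightarrow> (real \<Rightarrow> 'w measure) \<Rightarrow> real \<Rightarrow> (real \<Rightarrow> 'w \<Rightarrow> ('v::euclidean_space) set) set" where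
  "set_process_L2 M F T =
     {\<Phi>. set_progressive F T \<Phi> \<and>
         (\<forall>t\<in>{0..T}. \<forall>\<omega>\<in>space M. \<Phi> t \<omega> \<in> compact_convex_sets) \<and>
         (\<integral>\<^sup>+\<omega>. (\<integral>\<^sup>+t\<in>{0..T}. set_norm (\<Phi> t \<omega>) ^ 2 \<partial>lborel) \<partial>M) < \<infinity>}"

text \<open>Elements of \<open>L\<^sup>p\<close> are represented by functions rather than equivalence classes. All
  sets of functions compared below are invariant under almost sure modification by
  \<open>G\<close>-measurable functions, so equality of these sets is equality in \<open>L\<^sup>p\<close>.\<close>

definition vec_Lp :: "nat \<Rightarrow> 'w measure \<Rightarrow> 'w measure \<Rightarrow> ('w \<Rightarrow> 'v::euclidean_space) set" where
  "vec_Lp p M G = {g. g \<in> borel_measurable G \<and> (\<integral>\<^sup>+\<omega>. ennreal (norm (g \<omega>)) ^ p \<partial>M) < \<infinity>}"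

definition Lp_closure ::
    "nat \<Rightarrow> 'w measure \<Rightarrow> 'w measure \<Rightarrow> ('w \<Rightarrow> 'v::euclidean_space) set \<Rightarrow> ('w \<Rightarrow> 'v) set" where
  "Lp_closure p M G V =
     {g \<in> vec_Lp p M G. \<forall>\<epsilon>>0. \<exists>v\<in>V. (\<integral>\<^sup>+\<omega>. ennreal (norm (g \<omega> - v \<omega>)) ^ p \<partial>M) < ennreal \<epsilon>}"

definition selectors ::
    "nat \<Rightarrow> 'w measure \<Rightarrow> 'w measure \<Rightarrow> ('w \<Rightarrow> ('v::euclidean_space) set) \<Rightarrow> ('w \<Rightarrow> 'v) set" where
  "selectors p M G X = {g \<in> vec_Lp p M G. AE \<omega> in M. g \<omega> \<in> X \<omega>}"

definition process_selectors ::
    "'w measure \<Rightarrow> (real \<Rightarrow> 'w measure) \<Rightarrow> real \<Rightarrow> (real \<Rightarrow> 'w \<Rightarrow> ('v::euclidean_space) set) \<Rightarrow>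
     (real \<Rightarrow> 'w \<Rightarrow> 'v) set" where
  "process_selectors M F T \<Phi> =
     {\<phi>. progressive F T \<phi> \<and>
         (\<integral>\<^sup>+\<omega>. (\<integral>\<^sup>+t\<in>{0..T}. ennreal (norm (\<phi> t \<omega>)) ^ 2 \<partial>lborel) \<partial>M) < \<infinity> \<and>
         (AE (t, \<omega>) in lborel \<Otimes>\<^sub>M M. t \<in> {0..T} \<longrightarrow> \<phi> t \<omega> \<in> \<Phi> t \<omega>)}"

definition vec_cond_exp ::
    "'w measure \<Rightarrow> 'w measure \<Rightarrow> ('w \<Rightarrow> real ^ 'd) \<Rightarrow> 'w \<Rightarrow> real ^ 'd" where
  "vec_cond_exp M G g = (\<lambda>\<omega>. \<chi> i. real_cond_exp M G (\<lambda>\<omega>'. g \<omega>' $ i) \<omega>)"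

definition integrably_bounded :: "'w measure \<Rightarrow> ('w \<Rightarrow> ('v::euclidean_space) set) \<Rightarrow> bool" where
  "integrably_bounded M X \<longleftrightarrow> set_measurable M X \<and> (\<integral>\<^sup>+\<omega>. set_norm (X \<omega>) \<partial>M) < \<infinity>"

text \<open>\<open>Z\<close> is a version of the conditional expectation of \<open>X\<close> given \<open>G\<close>. The conditional
  expectation is determined only almost surely, hence a relation.\<close>

definition is_set_cond_exp ::
    "'w measure \<Rightarrow> 'w measure \<Rightarrow> ('w \<Rightarrow> (real ^ 'd) set) \<Rightarrow> ('w \<Rightarrow> (real ^ 'd) set) \<Rightarrow> bool" where
  "is_set_cond_exp M G X Z \<longleftrightarrow>
     integrably_bounded M X \<and> set_measurable G Z \<and>
     selectors 1 M G Z = Lp_closure 1 M G (vec_cond_exp M G ` selectors 1 M M X)"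

definition decomposable :: "'w measure \<Rightarrow> ('w \<Rightarrow> 'v::euclidean_space) set \<Rightarrow> bool" where
  "decomposable G W \<longleftrightarrow>
     (\<forall>D\<in>sets G. \<forall>g1\<in>W. \<forall>g2\<in>W. (\<lambda>\<omega>. if \<omega> \<in> D then g1 \<omega> else g2 \<omega>) \<in> W)"

definition dec_closure ::
    "'w measure \<Rightarrow> 'w measure \<Rightarrow> ('w \<Rightarrow> 'v::euclidean_space) set \<Rightarrow> ('w \<Rightarrow> 'v) set" where
  "dec_closure M G V =
     \<Inter>{W. V \<subseteq> W \<and> W \<subseteq> vec_Lp 2 M G \<and> Lp_closure 2 M G W = W \<and> decomposable G W}"

text \<open>As for the conditional expectation, \<open>I\<close> is one version of the integral of \<open>\<Phi>\<close> over \<open>[t, T]\<close>.\<close>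

definition is_set_time_integral ::
    "'w measure \<Rightarrow> (real \<Rightarrow> 'w measure) \<Rightarrow> real \<Rightarrow> real \<Rightarrow> (real \<Rightarrow> 'w \<Rightarrow> ('v::euclidean_space) set) \<Rightarrow>
     ('w \<Rightarrow> 'v set) \<Rightarrow> bool" where
  "is_set_time_integral M F T t \<Phi> I \<longleftrightarrow>
     \<Phi> \<in> set_process_L2 M F T \<and> set_measurable (F T) I \<and>
     selectors 2 M (F T) I =
       dec_closure M (F T)
         ((\<lambda>\<phi> \<omega>. set_lebesgue_integral lborel {t..T} (\<lambda>s. \<phi> s \<omega>)) ` process_selectors M F T \<Phi>)"

definition set_bsde_solution ::
    "'w measure \<Rightarrow> (real \<Rightarrow> 'w measure) \<Rightarrow> real \<Rightarrow> ('w \<Rightarrow> (real ^ 'd) set) \<Rightarrow>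
     (real \<Rightarrow> 'w \<Rightarrow> (real ^ 'd) set \<Rightarrow> (real ^ 'd) set) \<Rightarrow>
     (real \<Rightarrow> 'w \<Rightarrow> (real ^ 'd) set) \<Rightarrow> bool" where
  "set_bsde_solution M F T \<xi> f Y \<longleftrightarrow>
     Y \<in> set_process_L2 M F T \<and>
     (\<forall>t\<in>{0..T}. \<exists>I Z.
        is_set_time_integral M F T t (\<lambda>s \<omega>. f s \<omega> (Y s \<omega>)) I \<and>
        is_set_cond_exp M (F t) (\<lambda>\<omega>. \<xi> \<omega> + I \<omega>) Z \<and>
        (AE \<omega> in M. Y t \<omega> = Z \<omega>))"

end

theory Submission
  imports Defs
begin

text \<open>A compact convex set is encoded by its support function. Passing to selectors and to essential
  closed hulls of decomposable sets shows that \<open>Y\<^sub>t\<close> is the conditional expectation of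
  \<open>\<xi> + \<integral>\<^sub>t\<^sup>T \<Phi>\<^sub>s ds\<close> iff its support function is, direction by direction, the scalar conditional
  expectation of \<open>supp \<xi> p + \<integral>\<^sub>t\<^sup>T supp \<Phi>\<^sub>s p ds\<close>. Hence the Hausdorff distance of two such processes
  is controlled by the conditional expectation of \<open>\<integral>\<^sub>t\<^sup>T hdist \<Phi>1\<^sub>s \<Phi>2\<^sub>s ds\<close>, and for \<open>\<Phi> = f(\<cdot>, Y)\<close>
  the map is a contraction in a weighted supremum of mean square distances, which gives
  existence and uniqueness by Picard iteration. The progressive version of \<open>Y\<close> comes from
  progressive modifications of the scalar martingales.\<close>

subsection \<open>Support functions of compact convex sets\<close>

text \<open>The integral and the conditional expectation are specified only by their sets of
  selectors. A version of either is a closed-valued map about which nothing is known pointwise, so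
  boundedness, convexity and the support function have to be recovered almost surely from
  minimality. The exceptional null sets depend on the direction; therefore all statements about
  support functions range over one countable dense set \<open>dirs\<close>, and random sets are
  rebuilt from their values there. Compact convex sets have no subtraction, but support functions
  do, so \<xi> cancels in the difference of two right-hand sides. The equation fixes Y at each t
  only up to a null set depending on t, whereas the next step integrates in time and needs joint
  measurability. Hence a progressive process is built from a martingale minus the integral up to t.
  Convergence in mean square at each t would leave the same gap for the limit of the iterates; the
  ratio of the iteration is therefore made so small that the iterates converge for almost every
  \<omega> at each t.\<close>

definition supp :: "'v::euclidean_space set \<Rightarrow> 'v \<Rightarrow> real" where
  "supp A p = (SUP a\<in>A. p \<bullet> a)"

text \<open>Countability lets one null set serve all directions, density lets the directions
  determine a compact convex set. The vectors of \<open>Basis\<close> and their negatives are added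
  so that finite bounds in the directions of \<open>dirs\<close> confine a set to a box.\<close>

definition dirs :: "'v::euclidean_space set" where
  "dirs = (SOME D. countable D \<and> closure D = UNIV) \<union> Basis \<union> uminus ` Basis"

lemma countable_dirs [simp]: "countable (dirs :: 'v::euclidean_space set)"
  and closure_dirs [simp]: "closure (dirs :: 'v set) = UNIV"
proof -
  obtain D :: "'v set" where "countable D" "\<And>X. open X \<Longrightarrow> X \<noteq> {} \<Longrightarrow> \<exists>d\<in>D. d \<in> X"
    using countable_dense_exists by metis
  moreover have "closure D = UNIV"
  proof -
    have "- closure D \<inter> D = {}" using closure_subset by blast
    then have "- closure D = {}" using calculation(2)[of "- closure D"] by (auto simp: open_Compl)
    then show ?thesis by blast
  qed
  ultimately have "\<exists>D::'v set. countable D \<and> closure D = UNIV" by blast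
  from someI_ex[OF this] show "countable (dirs :: 'v set)" "closure (dirs :: 'v set) = UNIV"
    unfolding dirs_def by (simp_all add: closure_Un countable_finite)
qed

lemma dirs_ne [simp]: "(dirs :: 'v::euclidean_space set) \<noteq> {}"
  using closure_dirs[where 'v = 'v] by (auto simp del: closure_dirs)

lemma Basis_dirs: "b \<in> Basis \<Longrightarrow> b \<in> dirs" "b \<in> Basis \<Longrightarrow> - b \<in> dirs"
  by (auto simp: dirs_def)

abbreviation unit_dirs :: "'v::euclidean_space set" where
  "unit_dirs \<equiv> dirs \<inter> cball 0 1"

lemma unit_dirs_ne [simp]: "(unit_dirs :: 'v::euclidean_space set) \<noteq> {}"
  using Basis_dirs(1) nonempty_Basis by fastforce

text \<open>A dense set stays dense in an open set but may miss most of a closed one, so the closed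
  ball is first written as the closure of the open ball.\<close>

lemma closure_unit_dirs: "cball 0 1 \<subseteq> closure (unit_dirs :: 'v::euclidean_space set)"
proof -
  have "cball 0 1 = closure (ball (0::'v) 1)" by simp
  also have "\<dots> = closure (ball 0 1 \<inter> dirs)"
    by (rule closure_open_Int_superset[symmetric]) auto
  also have "\<dots> \<subseteq> closure unit_dirs" by (rule closure_mono) auto
  finally show ?thesis .
qed

lemma ccsD: "A \<in> compact_convex_sets \<Longrightarrow> A \<noteq> {}" "A \<in> compact_convex_sets \<Longrightarrow> compact A"
  "A \<in> compact_convex_sets \<Longrightarrow> convex A" "A \<in> compact_convex_sets \<Longrightarrow> closed A"
  by (auto simp: compact_convex_sets_def compact_imp_closed)

lemma zero_ccs [simp]: "{0} \<in> compact_convex_sets"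
  by (simp add: compact_convex_sets_def)

lemma ccs_closed_sets: "A \<in> compact_convex_sets \<Longrightarrow> A \<in> closed_sets"
  by (auto simp: ccsD closed_sets_def)

lemma bdd_above_inner: "compact (A::'v::euclidean_space set) \<Longrightarrow> bdd_above ((\<bullet>) p ` A)"
  by (intro bounded_imp_bdd_above compact_imp_bounded compact_continuous_image continuous_intros)

lemma supp_ge: "compact A \<Longrightarrow> a \<in> A \<Longrightarrow> p \<bullet> a \<le> supp A p"
  unfolding supp_def by (intro cSUP_upper bdd_above_inner)

lemma supp_le: "A \<noteq> {} \<Longrightarrow> (\<And>a. a \<in> A \<Longrightarrow> p \<bullet> a \<le> c) \<Longrightarrow> supp A p \<le> c"
  unfolding supp_def by (rule cSUP_least)

lemma supp_attains:
  assumes "compact A" "A \<noteq> {}"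
  obtains a where "a \<in> A" "p \<bullet> a = supp A p"
proof -
  have "continuous_on A ((\<bullet>) p)" by (intro continuous_intros)
  from continuous_attains_sup[OF assms this] obtain a where "a \<in> A" "\<forall>y\<in>A. p \<bullet> y \<le> p \<bullet> a" by auto
  with assms have "p \<bullet> a = supp A p" by (intro antisym supp_ge supp_le) auto
  with \<open>a \<in> A\<close> show ?thesis by (rule that)
qed

lemma supp_zero [simp]: "supp {0} p = 0"
  by (simp add: supp_def)

text \<open>The maximiser for p is a competitor for q. With r bounding the set, this is one half of
  the r-Lipschitz continuity of the support function.\<close>

lemma supp_diff_le:
  assumes "compact A" "A \<noteq> {}" "A \<subseteq> cball 0 r"
  shows "supp A p - supp A q \<le> norm (p - q) * r"
proof -
  obtain a where a: "a \<in> A" "p \<bullet> a = supp A p" using assms supp_attains by metis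
  have "supp A p - supp A q \<le> p \<bullet> a - q \<bullet> a" using a supp_ge[OF assms(1) a(1), of q] by simp
  also have "\<dots> = (p - q) \<bullet> a" by (simp add: inner_diff_left)
  also have "\<dots> \<le> norm (p - q) * norm a" by (rule norm_cauchy_schwarz)
  also have "\<dots> \<le> norm (p - q) * r" using a assms by (intro mult_left_mono) auto
  finally show ?thesis .
qed

lemma continuous_on_supp:
  assumes "compact A" "A \<noteq> {}"
  shows "continuous_on UNIV (supp A)"
proof -
  obtain r where r: "r > 0" "A \<subseteq> cball 0 r"
    using bounded_subset_ballD[OF compact_imp_bounded[OF assms(1)], of 0] ball_subset_cball[of 0]
    by (metis subset_trans)
  have "r-lipschitz_on UNIV (supp A)"
  proof (intro lipschitz_onI)
    show "dist (supp A p) (supp A q) \<le> r * dist p q" for p q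
      using supp_diff_le[OF assms r(2), of p q] supp_diff_le[OF assms r(2), of q p]
      by (simp add: dist_norm norm_minus_commute mult.commute abs_le_iff)
  qed (use r in simp)
  then show ?thesis by (rule lipschitz_on_continuous_on)
qed

lemma bdd_above_gap:
  assumes "A \<in> compact_convex_sets"
  shows "bdd_above ((\<lambda>p. p \<bullet> q - supp A p) ` (cball 0 1))"
proof (rule bounded_imp_bdd_above, rule compact_imp_bounded, rule compact_continuous_image)
  show "continuous_on (cball 0 1) (\<lambda>p. p \<bullet> q - supp A p)"
    using continuous_on_supp[of A] ccsD[OF assms] by (intro continuous_intros) (auto intro: continuous_on_subset)
qed simp

text \<open>Weak duality: the nearest point of A is a competitor for the support function, and
  Cauchy-Schwarz bounds the rest.\<close>

lemma gap_le_infdist: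
  assumes "compact A" "A \<noteq> {}" "norm p \<le> 1"
  shows "p \<bullet> q - supp A p \<le> infdist q A"
proof -
  obtain b where b: "b \<in> A" "infdist q A = dist q b"
    using infdist_attains_inf[OF compact_imp_closed[OF assms(1)] assms(2)] by metis
  have "p \<bullet> q - supp A p \<le> p \<bullet> q - p \<bullet> b" using supp_ge[OF assms(1) b(1)] by simp
  also have "\<dots> = p \<bullet> (q - b)" by (simp add: inner_diff_right)
  also have "\<dots> \<le> norm p * norm (q - b)" by (rule norm_cauchy_schwarz)
  also have "\<dots> \<le> dist q b" using assms(3) by (simp add: dist_norm mult_left_le_one_le)
  finally show ?thesis using b by simp
qed

text \<open>By separation, the distance to \<open>A\<close> is recovered from the support function. The supremum is
  attained in the direction from the nearest point to \<open>q\<close>.\<close>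
lemma infdist_supp:
  assumes A: "A \<in> compact_convex_sets"
  shows "infdist q A = (SUP p\<in>unit_dirs. p \<bullet> q - supp A p)"
proof (rule antisym)
  let ?u = "\<lambda>p. p \<bullet> q - supp A p"
  let ?c = "SUP p\<in>unit_dirs. ?u p"
  note A' = ccsD[OF A]
  have bdd: "bdd_above (?u ` unit_dirs)"
    using bdd_above_gap[OF A, of q] by (rule bdd_above_mono) auto
  \<comment> \<open>The maximising direction found below need not belong to \<open>dirs\<close>;
    continuity of the gap in p carries the bound by the countable supremum over to the whole unit
    ball.\<close>
  have "closed {p. ?u p \<le> ?c}"
    using continuous_on_supp[OF A'(2,1)] by (intro closed_Collect_le continuous_intros)
  moreover have "unit_dirs \<subseteq> {p. ?u p \<le> ?c}"
    using cSUP_upper[OF _ bdd] by auto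
  ultimately have "cball 0 1 \<subseteq> {p. ?u p \<le> ?c}"
    using closure_unit_dirs closure_minimal by blast
  then have le: "?u p \<le> ?c" if "norm p \<le> 1" for p using that by auto
  define a where "a = closest_point A q"
  have a: "a \<in> A" unfolding a_def using A' by (intro closest_point_in_set) auto
  \<comment> \<open>The value 0 covers q in A, where the gap 0 is optimal.\<close>
  define p where "p = (if q = a then 0 else (q - a) /\<^sub>R norm (q - a))"
  have p: "norm p \<le> 1" by (simp add: p_def)
  have "supp A p \<le> p \<bullet> a"
  proof (rule supp_le[OF A'(1)])
    fix x assume "x \<in> A"
    then have "(q - a) \<bullet> (x - a) \<le> 0" unfolding a_def using A' by (intro closest_point_dot)
    then have "p \<bullet> (x - a) \<le> 0"
      by (auto simp: p_def divide_simps mult_le_0_iff)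
    then show "p \<bullet> x \<le> p \<bullet> a" by (simp add: inner_diff_right)
  qed
  moreover have "p \<bullet> q - p \<bullet> a = norm (q - a)"
  proof -
    have "p \<bullet> q - p \<bullet> a = p \<bullet> (q - a)" by (simp add: inner_diff_right)
    then show ?thesis by (auto simp: p_def dot_square_norm power2_eq_square)
  qed
  ultimately have "norm (q - a) \<le> ?u p" by simp
  also have "\<dots> \<le> ?c" using le p .
  finally show "infdist q A \<le> ?c" using infdist_le[OF a, of q] by (simp add: dist_norm)
  show "?c \<le> infdist q A"
    using A' by (intro cSUP_least gap_le_infdist) auto
qed

text \<open>Both sets have the same distance function, and a nonempty closed set is the zero set of
  its distance function.\<close>

lemma ccs_eqI:
  assumes "A \<in> compact_convex_sets" "B \<in> compact_convex_sets" "\<And>p. p \<in> dirs \<Longrightarrow> supp A p = supp B p"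
  shows "A = B"
proof -
  have "infdist q A = infdist q B" for q
    unfolding infdist_supp[OF assms(1)] infdist_supp[OF assms(2)] using assms(3) by (intro SUP_cong) auto
  then have "q \<in> A \<longleftrightarrow> q \<in> B" for q
    using in_closed_iff_infdist_zero[OF ccsD(4,1), OF assms(1,1)]
      in_closed_iff_infdist_zero[OF ccsD(4,1), OF assms(2,2)] by simp
  then show ?thesis by blast
qed

section \<open>The Hausdorff distance as a supremum of differences of support functions
  (Hoermander's formula)\<close>

definition hdist :: "'v::euclidean_space set \<Rightarrow> 'v set \<Rightarrow> real" where
  "hdist A B = (SUP p\<in>unit_dirs. \<bar>supp A p - supp B p\<bar>)"

lemma supp_norm_le:
  assumes "compact A" "A \<noteq> {}" "A \<subseteq> cball 0 r"
  shows "\<bar>supp A p\<bar> \<le> norm p * r"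
proof -
  have "supp A 0 = 0" using assms(2) by (simp add: supp_def)
  then show ?thesis using supp_diff_le[OF assms, of p 0] supp_diff_le[OF assms, of 0 p] by simp
qed

lemma hdist_bdd:
  assumes A: "A \<in> compact_convex_sets" and B: "B \<in> compact_convex_sets"
  shows "bdd_above ((\<lambda>p. \<bar>supp A p - supp B p\<bar>) ` unit_dirs)"
proof -
  have "bounded (A \<union> B)" using ccsD(2)[OF A] ccsD(2)[OF B] by (simp add: compact_imp_bounded)
  then obtain r where r: "r > 0" "A \<union> B \<subseteq> cball 0 r"
    using bounded_subset_ballD[of "A \<union> B" 0] ball_subset_cball[of 0] by (metis subset_trans)
  show ?thesis
  proof (rule bdd_aboveI2)
    fix p :: 'a assume p: "p \<in> unit_dirs"
    have *: "norm p * r \<le> r" using mult_right_mono[of "norm p" 1 r] p r by simp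
    have "\<bar>supp A p\<bar> \<le> norm p * r" "\<bar>supp B p\<bar> \<le> norm p * r"
      using ccsD[OF A] ccsD[OF B] r by (simp_all add: supp_norm_le)
    with * show "\<bar>supp A p - supp B p\<bar> \<le> 2 * r" by linarith
  qed
qed

lemma hdist_upper_unit:
  assumes "A \<in> compact_convex_sets" "B \<in> compact_convex_sets" "p \<in> unit_dirs"
  shows "\<bar>supp A p - supp B p\<bar> \<le> hdist A B"
  unfolding hdist_def using cSUP_upper[OF assms(3) hdist_bdd[OF assms(1,2)]] by simp

lemma hdist_least: "(\<And>p. p \<in> unit_dirs \<Longrightarrow> \<bar>supp A p - supp B p\<bar> \<le> c) \<Longrightarrow> hdist A B \<le> c"
  unfolding hdist_def by (rule cSUP_least) simp_all

text \<open>The supremum defining \<open>hdist\<close> sees only directions of \<open>dirs\<close>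
  in the unit ball. Continuity extends the bound to the whole ball, positive homogeneity to every
  p.\<close>

lemma hdist_upper:
  assumes A: "A \<in> compact_convex_sets" and B: "B \<in> compact_convex_sets"
  shows "\<bar>supp A p - supp B p\<bar> \<le> norm p * hdist A B"
proof -
  note A' = ccsD[OF A] and B' = ccsD[OF B]
  have "closed {p. \<bar>supp A p - supp B p\<bar> \<le> hdist A B}"
    using continuous_on_supp[OF A'(2,1)] continuous_on_supp[OF B'(2,1)]
    by (intro closed_Collect_le continuous_intros)
  moreover have "unit_dirs \<subseteq> {p. \<bar>supp A p - supp B p\<bar> \<le> hdist A B}"
    using hdist_upper_unit[OF A B] by auto
  ultimately have "cball 0 1 \<subseteq> {p. \<bar>supp A p - supp B p\<bar> \<le> hdist A B}"
    using closure_unit_dirs closure_minimal by blast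
  then have le: "\<bar>supp A p - supp B p\<bar> \<le> hdist A B" if "norm p \<le> 1" for p using that by auto
  have scale: "supp C (c *\<^sub>R p) = c * supp C p" if C: "C \<in> compact_convex_sets" and c: "c > 0" for C c and p :: 'a
  proof (rule antisym)
    note C' = ccsD[OF C]
    show "supp C (c *\<^sub>R p) \<le> c * supp C p"
      using C' c by (intro supp_le) (auto intro: supp_ge)
    obtain a where "a \<in> C" "p \<bullet> a = supp C p" using supp_attains C' by metis
    then show "c * supp C p \<le> supp C (c *\<^sub>R p)" using supp_ge[OF C'(2), of a "c *\<^sub>R p"] by simp
  qed
  show ?thesis
  proof (cases "p = 0")
    case True then show ?thesis using A'(1) B'(1) by (simp add: supp_def)
  next
    case False
    let ?n = "norm p"
    have n: "?n > 0" using False by simp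
    have "?n *\<^sub>R sgn p = p" using False by (simp add: sgn_div_norm)
    then have "supp A p = ?n * supp A (sgn p)" "supp B p = ?n * supp B (sgn p)"
      using scale[OF A n, of "sgn p"] scale[OF B n, of "sgn p"] by simp_all
    then have "\<bar>supp A p - supp B p\<bar> = ?n * \<bar>supp A (sgn p) - supp B (sgn p)\<bar>"
      by (simp add: right_diff_distrib[symmetric] abs_mult)
    also have "\<dots> \<le> ?n * hdist A B" using le[of "sgn p"] by (intro mult_left_mono) (auto simp: norm_sgn)
    finally show ?thesis .
  qed
qed

lemma hdist_nonneg: "A \<in> compact_convex_sets \<Longrightarrow> B \<in> compact_convex_sets \<Longrightarrow> 0 \<le> hdist A B"
  using hdist_upper_unit[of A B "SOME p. p \<in> unit_dirs"] some_in_eq[of unit_dirs] unit_dirs_ne by fastforce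

lemma hdist_commute: "hdist A B = hdist B A"
  unfolding hdist_def by (simp add: abs_minus_commute)

lemma hdist_triangle:
  assumes "A \<in> compact_convex_sets" "B \<in> compact_convex_sets" "C \<in> compact_convex_sets"
  shows "hdist A C \<le> hdist A B + hdist B C"
proof (rule hdist_least)
  fix p :: 'a assume "p \<in> unit_dirs"
  from hdist_upper_unit[OF assms(1,2) this] hdist_upper_unit[OF assms(2,3) this]
  show "\<bar>supp A p - supp C p\<bar> \<le> hdist A B + hdist B C" by linarith
qed

lemma hdist_self [simp]: "hdist A A = 0"
  by (simp add: hdist_def)

lemma hdist_0_imp_eq:
  assumes "A \<in> compact_convex_sets" "B \<in> compact_convex_sets" "hdist A B = 0"
  shows "A = B"
  using hdist_upper[OF assms(1,2)] assms(3) by (intro ccs_eqI assms) auto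

text \<open>Distances are suprema of gaps, and exchanging A for B changes each gap with a direction
  in the unit ball by at most \<open>hdist A B\<close>.\<close>

lemma infdist_le_hdist:
  assumes A: "A \<in> compact_convex_sets" and B: "B \<in> compact_convex_sets"
  shows "infdist q A \<le> infdist q B + hdist A B"
proof -
  have "infdist q A \<le> (SUP p\<in>unit_dirs. p \<bullet> q - supp A p)" using infdist_supp[OF A] by simp
  also have "\<dots> \<le> infdist q B + hdist A B"
  proof (rule cSUP_least)
    fix p :: 'a assume p: "p \<in> unit_dirs"
    then have "p \<bullet> q - supp B p \<le> infdist q B" using ccsD[OF B] by (intro gap_le_infdist) auto
    then show "p \<bullet> q - supp A p \<le> infdist q B + hdist A B" using hdist_upper_unit[OF A B p] by linarith
  qed simp
  finally show ?thesis .
qed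

text \<open>One inequality is the Lipschitz dependence of the distance function on the set. For the
  other, the point of A at which p is maximal has the gap \<open>supp A p - supp B p\<close> to B,
  and a gap never exceeds the distance.\<close>

lemma hausdorff_dist_eq:
  assumes A: "A \<in> compact_convex_sets" and B: "B \<in> compact_convex_sets"
  shows "hausdorff_dist A B = ennreal (hdist A B)"
proof (rule antisym)
  have *: "ennreal (infdist a B) \<le> ennreal (hdist A B)"
    if "a \<in> A" "A \<in> compact_convex_sets" "B \<in> compact_convex_sets" for a and A B :: "'a set"
    using infdist_le_hdist[OF that(3,2), of a] that(1) by (auto intro!: ennreal_leI simp: hdist_commute)
  show "hausdorff_dist A B \<le> ennreal (hdist A B)"
    unfolding hausdorff_dist_def using *[OF _ A B] *[OF _ B A] by (auto intro!: SUP_least simp: hdist_commute)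
  \<comment> \<open>Finiteness, from the inequality just shown, turns the extended distance into a
    real r.\<close>
  then have "hausdorff_dist A B \<noteq> \<top>" by (auto simp: top_unique)
  then obtain r where r: "hausdorff_dist A B = ennreal r" "0 \<le> r"
    by (cases "hausdorff_dist A B") auto
  have **: "supp A p - supp B p \<le> r"
    if AB: "A \<in> compact_convex_sets" "B \<in> compact_convex_sets" "(SUP a\<in>A. ennreal (infdist a B)) \<le> ennreal r"
      "p \<in> unit_dirs" for p and A B :: "'a set"
  proof -
    obtain a where a: "a \<in> A" "p \<bullet> a = supp A p" using supp_attains ccsD[OF AB(1)] by metis
    have "p \<bullet> a - supp B p \<le> infdist a B" using ccsD[OF AB(2)] that(4) by (intro gap_le_infdist) auto
    moreover have "ennreal (infdist a B) \<le> ennreal r" using AB(3) a(1) by (meson SUP_upper order_trans)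
    ultimately show ?thesis using a r(2) by simp
  qed
  have "(SUP a\<in>A. ennreal (infdist a B)) \<le> ennreal r" "(SUP b\<in>B. ennreal (infdist b A)) \<le> ennreal r"
    using r(1) unfolding hausdorff_dist_def by (metis max.cobounded1, metis max.cobounded2)
  then have "hdist A B \<le> r" using **[OF A B] **[OF B A] by (intro hdist_least) (auto simp: abs_le_iff)
  then show "ennreal (hdist A B) \<le> hausdorff_dist A B" unfolding r(1) by (rule ennreal_leI)
qed

abbreviation nrm :: "'v::euclidean_space set \<Rightarrow> real" where
  "nrm A \<equiv> hdist A {0}"

lemma set_norm_eq: "A \<in> compact_convex_sets \<Longrightarrow> set_norm A = ennreal (nrm A)"
  by (simp add: set_norm_def hausdorff_dist_eq)

lemma norm_le_nrm:
  assumes "A \<in> compact_convex_sets" "a \<in> A"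
  shows "norm a \<le> nrm A"
proof -
  have "infdist a {0} \<le> infdist a A + hdist {0} A" using infdist_le_hdist[OF zero_ccs assms(1)] .
  then show ?thesis using assms(2) by (simp add: hdist_commute)
qed

lemma nrm_nonneg: "A \<in> compact_convex_sets \<Longrightarrow> 0 \<le> nrm A"
  by (simp add: hdist_nonneg)

lemma abs_supp_le: "A \<in> compact_convex_sets \<Longrightarrow> \<bar>supp A p\<bar> \<le> norm p * nrm A"
  using hdist_upper[of A "{0}" p] by simp

section \<open>Sets reconstructed from their values in the directions of \<open>dirs\<close>\<close>

definition supp_set :: "('v::euclidean_space \<Rightarrow> real) \<Rightarrow> 'v set" where
  "supp_set y = {z. \<forall>p\<in>dirs. p \<bullet> z \<le> y p}"

text \<open>Bounds in the directions b and -b for b in \<open>Basis\<close> put the set into a box,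
  whatever y is.\<close>

lemma supp_set_compact: "compact (supp_set (y :: 'v::euclidean_space \<Rightarrow> real))"
proof -
  define l where "l b = - y (- b)" for b
  have "supp_set y \<subseteq> cbox (\<Sum>b\<in>Basis. l b *\<^sub>R b) (\<Sum>b\<in>Basis. y b *\<^sub>R b)"
  proof
    fix z assume "z \<in> supp_set y"
    then have "z \<bullet> b \<le> y b" "l b \<le> z \<bullet> b" if "b \<in> Basis" for b
      using Basis_dirs[OF that] unfolding supp_set_def l_def by (fastforce simp: inner_commute)+
    then show "z \<in> cbox (\<Sum>b\<in>Basis. l b *\<^sub>R b) (\<Sum>b\<in>Basis. y b *\<^sub>R b)"
      by (simp add: mem_box)
  qed
  then have "bounded (supp_set y)" using bounded_cbox bounded_subset by blast
  moreover have "supp_set y = (\<Inter>p\<in>dirs. {z. p \<bullet> z \<le> y p})" by (auto simp: supp_set_def)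
  then have "closed (supp_set y)" by (auto intro!: closed_Collect_le continuous_intros)
  ultimately show ?thesis by (simp add: compact_eq_bounded_closed)
qed

lemma supp_set_convex: "convex (supp_set y)"
proof -
  have "supp_set y = (\<Inter>p\<in>dirs. {z. p \<bullet> z \<le> y p})" by (auto simp: supp_set_def)
  then show ?thesis by (auto intro!: convex_INT convex_halfspace_le)
qed

text \<open>Convergent values are bounded in each direction, so all \<open>A n\<close> lie in one
  compact set \<open>supp_set c\<close>. Maximisers of p in \<open>A n\<close> have a cluster point,
  which satisfies the limiting inequalities and attains \<open>y p\<close>; this also gives
  nonemptiness. Pointwise convergence on \<open>dirs\<close> suffices.\<close>

lemma supp_set_limit:
  fixes A :: "nat \<Rightarrow> 'v::euclidean_space set"
  assumes A: "\<And>n. A n \<in> compact_convex_sets"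
    and lim: "\<And>p. p \<in> dirs \<Longrightarrow> (\<lambda>n. supp (A n) p) \<longlonglongrightarrow> y p"
  shows "supp_set y \<in> compact_convex_sets" "\<And>p. p \<in> dirs \<Longrightarrow> supp (supp_set y) p = y p"
proof -
  have "\<exists>c. \<forall>n. supp (A n) p \<le> c" if "p \<in> dirs" for p
  proof -
    from Bseq_bdd_above[OF convergent_imp_Bseq[OF convergentI[OF lim[OF that]]]]
    show ?thesis unfolding bdd_above_def by auto
  qed
  then obtain c where c: "\<And>p n. p \<in> dirs \<Longrightarrow> supp (A n) p \<le> c p" by metis
  have sub: "A n \<subseteq> supp_set c" for n
  proof
    fix z assume "z \<in> A n"
    then have "p \<bullet> z \<le> c p" if "p \<in> dirs" for p
      using order_trans[OF supp_ge[OF ccsD(2)[OF A]] c[OF that]] by simp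
    then show "z \<in> supp_set c" by (simp add: supp_set_def)
  qed
  have *: "\<exists>z\<in>supp_set y. p \<bullet> z = y p" if p: "p \<in> dirs" for p
  proof -
    have "\<exists>z\<in>A n. p \<bullet> z = supp (A n) p" for n using supp_attains ccsD[OF A[of n]] by metis
    then obtain z where z: "\<And>n. z n \<in> A n" "\<And>n. p \<bullet> z n = supp (A n) p" by metis
    have "\<forall>n. z n \<in> supp_set c" using z(1) sub by blast
    then obtain l r where l: "strict_mono r" "(z \<circ> r) \<longlonglongrightarrow> l"
      using supp_set_compact[of c] unfolding compact_def by metis
    have "q \<bullet> l \<le> y q" if q: "q \<in> dirs" for q
    proof (rule LIMSEQ_le)
      show "(\<lambda>n. q \<bullet> (z \<circ> r) n) \<longlonglongrightarrow> q \<bullet> l" by (intro tendsto_intros l)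
      show "(\<lambda>n. supp (A (r n)) q) \<longlonglongrightarrow> y q"
        using LIMSEQ_subseq_LIMSEQ[OF lim[OF q] l(1)] by (simp add: o_def)
      show "\<exists>N. \<forall>n\<ge>N. q \<bullet> (z \<circ> r) n \<le> supp (A (r n)) q" using supp_ge[OF ccsD(2)[OF A] z(1)] by auto
    qed
    then have "l \<in> supp_set y" by (auto simp: supp_set_def)
    moreover have "p \<bullet> l = y p"
    proof (rule LIMSEQ_unique)
      show "(\<lambda>n. p \<bullet> (z \<circ> r) n) \<longlonglongrightarrow> p \<bullet> l" by (intro tendsto_intros l)
      show "(\<lambda>n. p \<bullet> (z \<circ> r) n) \<longlonglongrightarrow> y p"
        using LIMSEQ_subseq_LIMSEQ[OF lim[OF p] l(1)] z(2) by (simp add: o_def)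
    qed
    ultimately show ?thesis by blast
  qed
  moreover obtain b :: 'v where "b \<in> Basis" using nonempty_Basis by blast
  ultimately have ne: "supp_set y \<noteq> {}" using Basis_dirs(1) by blast
  then show "supp_set y \<in> compact_convex_sets"
    by (simp add: compact_convex_sets_def supp_set_compact supp_set_convex)
  fix p :: 'v assume p: "p \<in> dirs"
  show "supp (supp_set y) p = y p"
  proof (rule antisym)
    show "supp (supp_set y) p \<le> y p" using ne p by (intro supp_le) (auto simp: supp_set_def)
    obtain z where "z \<in> supp_set y" "p \<bullet> z = y p" using *[OF p] by blast
    then show "y p \<le> supp (supp_set y) p" using supp_ge[OF supp_set_compact, of z y p] by simp
  qed
qed

text \<open>The countable family consists of the polytopes spanned by finitely many points of
  \<open>dirs\<close>. A finite cover of A by balls of radius e/2 with centres in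
  \<open>dirs\<close> yields such a polytope within e/2 of A.\<close>

lemma countable_hdist_dense:
  obtains S :: "nat \<Rightarrow> 'v::euclidean_space set" where "\<And>j. S j \<in> compact_convex_sets"
    "\<And>A e. A \<in> compact_convex_sets \<Longrightarrow> 0 < e \<Longrightarrow> \<exists>j. hdist A (S j) < e"
proof -
  define C :: "'v set set" where "C = (\<lambda>F. convex hull F) ` {F. finite F \<and> F \<subseteq> dirs \<and> F \<noteq> {}}"
  have "countable {F::'v set. finite F \<and> F \<subseteq> dirs}" by (rule countable_Collect_finite_subset) simp
  then have "countable {F::'v set. finite F \<and> F \<subseteq> dirs \<and> F \<noteq> {}}"
    by (rule countable_subset[rotated]) auto
  then have "countable C" unfolding C_def by (rule countable_image)
  have C: "C \<subseteq> compact_convex_sets"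
    unfolding C_def compact_convex_sets_def by (auto intro!: finite_imp_compact_convex_hull)
  have dense: "\<exists>B\<in>C. hdist A B < e" if A: "A \<in> compact_convex_sets" and e: "0 < e" for A :: "'v set" and e
  proof -
    note A' = ccsD[OF A]
    have cov: "A \<subseteq> (\<Union>q\<in>dirs. ball q (e/2))"
    proof
      fix a :: 'v have "a \<in> closure dirs" by simp
      then obtain q where "q \<in> dirs" "dist q a < e/2" unfolding closure_approachable using e by (meson half_gt_zero)
      then show "a \<in> (\<Union>q\<in>dirs. ball q (e/2))" by auto
    qed
    obtain F where F: "F \<subseteq> dirs" "finite F" "A \<subseteq> (\<Union>q\<in>F. ball q (e/2))"
      by (rule compactE_image[OF A'(2) _ cov]) simp_all
    \<comment> \<open>Centres of balls that miss A are dropped, since they could push the hull away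
      from A.\<close>
    define G where "G = {q\<in>F. ball q (e/2) \<inter> A \<noteq> {}}"
    have "A \<subseteq> (\<Union>q\<in>G. ball q (e/2))"
    proof
      fix x assume "x \<in> A"
      with F(3) obtain q where "q \<in> F" "x \<in> ball q (e/2)" by blast
      with \<open>x \<in> A\<close> show "x \<in> (\<Union>q\<in>G. ball q (e/2))" unfolding G_def by blast
    qed
    then have G: "finite G" "G \<subseteq> dirs" "A \<subseteq> (\<Union>q\<in>G. ball q (e/2))" using F unfolding G_def by auto
    with A'(1) have "G \<noteq> {}" by auto
    with G have B: "convex hull G \<in> C" unfolding C_def by auto
    let ?B = "convex hull G"
    have B': "?B \<in> compact_convex_sets" using B C by auto
    have "hdist A ?B \<le> e/2"
    proof (rule hdist_least)
      fix p :: 'v assume p: "p \<in> unit_dirs"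
      have cs: "\<bar>p \<bullet> x - p \<bullet> y\<bar> \<le> dist x y" for x y
      proof -
        have "\<bar>p \<bullet> (x - y)\<bar> \<le> norm p * norm (x - y)" by (rule Cauchy_Schwarz_ineq2)
        also have "\<dots> \<le> 1 * norm (x - y)" using p by (intro mult_right_mono) auto
        finally show ?thesis by (simp add: inner_diff_right dist_norm)
      qed
      have "supp A p \<le> supp ?B p + e/2"
      proof (rule supp_le[OF A'(1)])
        fix a assume "a \<in> A"
        then obtain q where q: "q \<in> G" "dist q a < e/2" using G by auto
        then have "p \<bullet> q \<le> supp ?B p" using ccsD[OF B'] by (intro supp_ge) (auto simp: hull_inc)
        then show "p \<bullet> a \<le> supp ?B p + e/2" using cs[of q a] q by linarith
      qed
      moreover have "supp ?B p \<le> supp A p + e/2"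
      proof (rule supp_le[OF ccsD(1)[OF B']])
        have "?B \<subseteq> {b. p \<bullet> b \<le> supp A p + e/2}"
        proof (rule hull_minimal)
          show "convex {b. p \<bullet> b \<le> supp A p + e/2}" by (rule convex_halfspace_le)
          show "G \<subseteq> {b. p \<bullet> b \<le> supp A p + e/2}"
          proof
            fix q assume "q \<in> G"
            then obtain a where a: "a \<in> A" "dist q a < e/2" unfolding G_def by auto
            have "p \<bullet> a \<le> supp A p" using a A' by (intro supp_ge)
            then show "q \<in> {b. p \<bullet> b \<le> supp A p + e/2}" using cs[of q a] a by simp
          qed
        qed
        then show "\<And>b. b \<in> ?B \<Longrightarrow> p \<bullet> b \<le> supp A p + e/2" by blast
      qed
      ultimately show "\<bar>supp A p - supp ?B p\<bar> \<le> e/2" by linarith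
    qed
    then show ?thesis using B e by (intro bexI[of _ ?B]) auto
  qed
  then have "C \<noteq> {}" using zero_ccs zero_less_one by blast
  show ?thesis
  proof (rule that[of "from_nat_into C"])
    show "from_nat_into C j \<in> compact_convex_sets" for j using from_nat_into[OF \<open>C \<noteq> {}\<close>] C by blast
    show "\<exists>j. hdist A (from_nat_into C j) < e" if "A \<in> compact_convex_sets" "0 < e" for A e
      using dense[OF that] from_nat_into_surj[OF \<open>countable C\<close>] by metis
  qed
qed

subsection \<open>Measurable set-valued maps\<close>

lemma set_measurableD:
  assumes "set_measurable N X" "e \<in> space N"
  shows "closed (X e)" "X e \<noteq> {}"
  using assms by (auto simp: set_measurable_def closed_sets_def)

lemma set_measurable_hit: "set_measurable N X \<Longrightarrow> closed D \<Longrightarrow> {e \<in> space N. X e \<inter> D \<noteq> {}} \<in> sets N"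
  by (simp add: set_measurable_def)

lemma set_measurable_compose:
  fixes X :: "'e \<Rightarrow> 'v::euclidean_space set"
  assumes g: "g \<in> measurable N' N" and X: "set_measurable N X"
  shows "set_measurable N' (\<lambda>e. X (g e))"
  unfolding set_measurable_def
proof (intro conjI ballI allI impI)
  show "X (g e) \<in> closed_sets" if "e \<in> space N'" for e
    using X measurable_space[OF g that] by (simp add: set_measurable_def)
  fix D :: "'v set" assume "closed D"
  from measurable_sets[OF g set_measurable_hit[OF X this]]
  have "g -` {e \<in> space N. X e \<inter> D \<noteq> {}} \<inter> space N' \<in> sets N'" .
  also have "g -` {e \<in> space N. X e \<inter> D \<noteq> {}} \<inter> space N' = {e \<in> space N'. X (g e) \<inter> D \<noteq> {}}"
    using measurable_space[OF g] by auto
  finally show "{e \<in> space N'. X (g e) \<inter> D \<noteq> {}} \<in> sets N'" .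
qed

lemma set_measurable_cong:
  "(\<And>e. e \<in> space N \<Longrightarrow> X e = X' e) \<Longrightarrow> set_measurable N X \<longleftrightarrow> set_measurable N X'"
  unfolding set_measurable_def by (intro conj_cong ball_cong all_cong) (auto cong: conj_cong)

text \<open>The distance of q to a closed set is attained, so a sublevel set of the distance is the
  event that the closed ball about q is hit.\<close>

lemma set_measurable_infdist:
  assumes X: "set_measurable N X"
  shows "(\<lambda>e. infdist q (X e)) \<in> borel_measurable N"
proof (rule borel_measurableI_le)
  fix r
  have "{e \<in> space N. infdist q (X e) \<le> r} = {e \<in> space N. X e \<inter> cball q r \<noteq> {}}"
  proof (intro Collect_cong conj_cong refl)
    fix e assume e: "e \<in> space N"
    show "infdist q (X e) \<le> r \<longleftrightarrow> X e \<inter> cball q r \<noteq> {}"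
    proof
      assume "infdist q (X e) \<le> r"
      moreover obtain b where "b \<in> X e" "infdist q (X e) = dist q b"
        using infdist_attains_inf set_measurableD[OF X e] by metis
      ultimately show "X e \<inter> cball q r \<noteq> {}" by auto
    next
      assume "X e \<inter> cball q r \<noteq> {}"
      then obtain b where "b \<in> X e" "dist q b \<le> r" by auto
      then show "infdist q (X e) \<le> r" by (rule infdist_le2)
    qed
  qed
  then show "{e \<in> space N. infdist q (X e) \<le> r} \<in> sets N"
    using set_measurable_hit[OF X] by simp
qed

text \<open>Hitting a compact set becomes a countable condition on distances: the distance to X
  attains its minimum on C, and that minimum is 0 once it is at most 2/(n+1) for every n.\<close>

lemma closed_hits_compact_iff:
  fixes X C :: "'v::euclidean_space set"
  assumes X: "closed X" "X \<noteq> {}" and C: "compact C" "C \<noteq> {}"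
  shows "X \<inter> C \<noteq> {} \<longleftrightarrow> (\<forall>n::nat. \<exists>q\<in>dirs. infdist q X < 1 / Suc n \<and> infdist q C < 1 / Suc n)"
proof
  assume "X \<inter> C \<noteq> {}"
  then obtain x where x: "x \<in> X" "x \<in> C" by auto
  show "\<forall>n::nat. \<exists>q\<in>dirs. infdist q X < 1 / Suc n \<and> infdist q C < 1 / Suc n"
  proof
    fix n :: nat
    have "x \<in> closure dirs" by simp
    then obtain q where "q \<in> dirs" "dist q x < 1 / Suc n"
      unfolding closure_approachable by (metis divide_pos_pos of_nat_0_less_iff zero_less_Suc zero_less_one)
    then show "\<exists>q\<in>dirs. infdist q X < 1 / Suc n \<and> infdist q C < 1 / Suc n"
      using infdist_le[OF x(1), of q] infdist_le[OF x(2), of q] by (intro bexI[of _ q]) auto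
  qed
next
  assume *: "\<forall>n::nat. \<exists>q\<in>dirs. infdist q X < 1 / Suc n \<and> infdist q C < 1 / Suc n"
  then obtain q where q: "\<And>n. infdist (q n) X < 1 / Suc n" "\<And>n. infdist (q n) C < 1 / Suc n" by metis
  have "\<exists>c\<in>C. infdist c X < 2 / Suc n" for n
  proof -
    obtain c where c: "c \<in> C" "infdist (q n) C = dist (q n) c"
      using infdist_attains_inf[OF compact_imp_closed[OF C(1)] C(2)] by metis
    have "infdist c X \<le> infdist (q n) X + dist c (q n)" by (rule infdist_triangle)
    then show ?thesis using c q[of n] by (intro bexI[of _ c]) (auto simp: dist_commute)
  qed
  moreover have "continuous_on C (\<lambda>c. infdist c X)" by (intro continuous_intros)
  then obtain c where c: "c \<in> C" "\<forall>c'\<in>C. infdist c X \<le> infdist c' X"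
    using continuous_attains_inf[OF C] by blast
  ultimately have le: "infdist c X \<le> 2 / Suc n" for n by (meson less_imp_le order_trans)
  have "(\<lambda>n. 2 / real (Suc n)) \<longlonglongrightarrow> 0"
    using tendsto_mult_right_zero[OF LIMSEQ_inverse_real_of_nat, of 2] by (simp add: divide_inverse)
  then have "infdist c X \<le> 0" by (rule LIMSEQ_le_const) (use le in auto)
  then have "infdist c X = 0" using infdist_nonneg[of c X] by simp
  then show "X \<inter> C \<noteq> {}" using c in_closed_iff_infdist_zero[OF X] by blast
qed

text \<open>A closed D is a countable union of compact pieces, and hitting a compact piece is
  expressed by countably many distance functions.\<close>

lemma set_measurableI_infdist:
  fixes X :: "'e \<Rightarrow> 'v::euclidean_space set"
  assumes X: "\<And>e. e \<in> space N \<Longrightarrow> closed (X e)" "\<And>e. e \<in> space N \<Longrightarrow> X e \<noteq> {}"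
    and meas: "\<And>q. (\<lambda>e. infdist q (X e)) \<in> borel_measurable N"
  shows "set_measurable N X"
  unfolding set_measurable_def
proof (intro conjI ballI allI impI)
  show "X e \<in> closed_sets" if "e \<in> space N" for e using X that by (simp add: closed_sets_def)
  fix D :: "'v set" assume D: "closed D"
  define C where "C m = D \<inter> cball 0 (real m)" for m :: nat
  have C: "compact (C m)" for m unfolding C_def using D by (rule closed_Int_compact) simp
  \<comment> \<open>Empty pieces are left out of the union: the criterion for hitting a compact set
    is stated for nonempty ones, as \<open>infdist q {} = 0\<close>.\<close>
  have "{e \<in> space N. X e \<inter> D \<noteq> {}} = (\<Union>m\<in>{m. C m \<noteq> {}}. {e \<in> space N. X e \<inter> C m \<noteq> {}})"
  proof (intro equalityI subsetI)
    fix e assume "e \<in> {e \<in> space N. X e \<inter> D \<noteq> {}}"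
    then obtain x where x: "e \<in> space N" "x \<in> X e" "x \<in> D" by auto
    obtain m :: nat where "norm x \<le> m" using real_arch_simple by blast
    with x show "e \<in> (\<Union>m\<in>{m. C m \<noteq> {}}. {e \<in> space N. X e \<inter> C m \<noteq> {}})"
      by (auto simp: C_def intro!: bexI[of _ x] exI[of _ m])
  qed (auto simp: C_def)
  also have "\<dots> = (\<Union>m\<in>{m. C m \<noteq> {}}. {e \<in> space N. \<forall>n::nat. \<exists>q\<in>dirs. infdist q (X e) < 1 / Suc n \<and> infdist q (C m) < 1 / Suc n})"
    using closed_hits_compact_iff[OF X C] by (intro SUP_cong Collect_cong conj_cong refl) auto
  also have "\<dots> \<in> sets N"
  proof (rule sets.countable_UN'')
    fix m
    have "{e \<in> space N. \<exists>q\<in>dirs. infdist q (X e) < 1 / Suc n \<and> infdist q (C m) < 1 / Suc n} \<in> sets N" for n :: nat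
    proof -
      have "{e \<in> space N. \<exists>q\<in>dirs. infdist q (X e) < 1 / Suc n \<and> infdist q (C m) < 1 / Suc n}
        = (\<Union>q\<in>{q\<in>dirs. infdist q (C m) < 1 / Suc n}. {e \<in> space N. infdist q (X e) < 1 / Suc n})" by auto
      also have "\<dots> \<in> sets N"
      proof (rule sets.countable_UN'')
        show "countable {q\<in>dirs. infdist q (C m) < 1 / Suc n}"
          by (rule countable_subset[OF _ countable_dirs]) auto
        show "{e \<in> space N. infdist q (X e) < 1 / Suc n} \<in> sets N" for q
          using meas[of q] by measurable
      qed
      finally show ?thesis .
    qed
    then show "{e \<in> space N. \<forall>n::nat. \<exists>q\<in>dirs. infdist q (X e) < 1 / Suc n \<and> infdist q (C m) < 1 / Suc n} \<in> sets N"
      by (rule sets.sets_Collect_countable_All)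
  qed auto
  finally show "{e \<in> space N. X e \<inter> D \<noteq> {}} \<in> sets N" .
qed

text \<open>The supremum is attained, so \<open>supp (X e) p\<close> is at least r exactly when
  \<open>X e\<close> hits the closed half-space of level r.\<close>

lemma supp_measurable:
  assumes X: "set_measurable N X" and c: "\<And>e. e \<in> space N \<Longrightarrow> compact (X e)"
  shows "(\<lambda>e. supp (X e) p) \<in> borel_measurable N"
proof (rule borel_measurableI_ge)
  fix r
  have "{e \<in> space N. r \<le> supp (X e) p} = {e \<in> space N. X e \<inter> {x. p \<bullet> x \<ge> r} \<noteq> {}}"
  proof (intro Collect_cong conj_cong refl)
    fix e assume e: "e \<in> space N"
    obtain a where "a \<in> X e" "p \<bullet> a = supp (X e) p"
      using supp_attains[OF c[OF e] set_measurableD(2)[OF X e]] by metis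
    then show "r \<le> supp (X e) p \<longleftrightarrow> X e \<inter> {x. p \<bullet> x \<ge> r} \<noteq> {}"
      using supp_ge[OF c[OF e], of _ p] by (auto intro: order_trans)
  qed
  moreover have "closed {x. p \<bullet> x \<ge> r}" by (simp add: closed_halfspace_ge)
  ultimately show "{e \<in> space N. r \<le> supp (X e) p} \<in> sets N" using set_measurable_hit[OF X] by simp
qed

text \<open>The distance functions are countable suprema of gaps, so the scalar functions in the
  directions of \<open>dirs\<close> carry all the measurability.\<close>

lemma set_measurableI_supp:
  assumes X: "\<And>e. e \<in> space N \<Longrightarrow> X e \<in> compact_convex_sets"
    and meas: "\<And>p. p \<in> dirs \<Longrightarrow> (\<lambda>e. supp (X e) p) \<in> borel_measurable N"
  shows "set_measurable N X"
proof (rule set_measurableI_infdist)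
  show "(\<lambda>e. infdist q (X e)) \<in> borel_measurable N" for q
  proof -
    have "(\<lambda>e. SUP p\<in>unit_dirs. p \<bullet> q - supp (X e) p) \<in> borel_measurable N"
    proof (rule borel_measurable_cSUP)
      show "(\<lambda>e. p \<bullet> q - supp (X e) p) \<in> borel_measurable N" if "p \<in> unit_dirs" for p
        using meas that by auto
      show "bdd_above ((\<lambda>p. p \<bullet> q - supp (X e) p) ` unit_dirs)" if "e \<in> space N" for e
        using bdd_above_gap[OF X[OF that], of q] by (rule bdd_above_mono) auto
    qed (simp add: countable_Int1)
    also have "?this \<longleftrightarrow> ?thesis"
      using infdist_supp[OF X] by (intro measurable_cong) simp
    finally show ?thesis .
  qed
qed (use ccsD(1,4)[OF X] in simp_all)

lemma hdist_measurable:
  assumes X: "set_measurable N X" "\<And>e. e \<in> space N \<Longrightarrow> X e \<in> compact_convex_sets"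
    and Y: "set_measurable N Y" "\<And>e. e \<in> space N \<Longrightarrow> Y e \<in> compact_convex_sets"
  shows "(\<lambda>e. hdist (X e) (Y e)) \<in> borel_measurable N"
  unfolding hdist_def
proof (rule borel_measurable_cSUP)
  show "(\<lambda>e. \<bar>supp (X e) p - supp (Y e) p\<bar>) \<in> borel_measurable N" for p
    using supp_measurable[OF X(1), of p] supp_measurable[OF Y(1), of p] ccsD(2)[OF X(2)] ccsD(2)[OF Y(2)]
    by measurable
qed (use hdist_bdd[OF X(2) Y(2)] in \<open>simp_all add: countable_Int1\<close>)

lemma set_measurable_const: "A \<in> closed_sets \<Longrightarrow> set_measurable N (\<lambda>_. A)"
  by (intro set_measurableI_infdist) (auto simp: closed_sets_def)

text \<open>The value \<open>{0}\<close> is only a default where \<open>y e\<close> is not a support function.\<close>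
definition set_of_supp :: "('v::euclidean_space \<Rightarrow> real) \<Rightarrow> 'v set" where
  "set_of_supp y = (if \<exists>A\<in>compact_convex_sets. \<forall>p\<in>dirs. supp A p = y p then supp_set y else {0})"

lemma set_of_supp_eq:
  assumes A: "A \<in> compact_convex_sets" and y: "\<And>p. p \<in> dirs \<Longrightarrow> supp A p = y p"
  shows "set_of_supp y = A"
proof -
  have "set_of_supp y = supp_set y" using assms unfolding set_of_supp_def by auto
  moreover have "supp_set y \<in> compact_convex_sets" "p \<in> dirs \<Longrightarrow> supp (supp_set y) p = y p" for p
    using supp_set_limit[of "\<lambda>_. A" y] A y by auto
  ultimately show ?thesis using ccs_eqI[of "supp_set y" A] A y by simp
qed

lemma set_of_supp_ccs: "set_of_supp y \<in> compact_convex_sets"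
proof (cases "\<exists>A\<in>compact_convex_sets. \<forall>p\<in>dirs. supp A p = y p")
  case True
  then obtain A where A: "A \<in> compact_convex_sets" "\<forall>p\<in>dirs. supp A p = y p" by blast
  then have "set_of_supp y = A" by (intro set_of_supp_eq) auto
  with A show ?thesis by simp
qed (auto simp: set_of_supp_def)

text \<open>The point is that the case distinction in \<open>set_of_supp\<close> is a measurable
  event. A function on \<open>dirs\<close> comes from a compact convex set iff, for every n, some
  member of the countable dense family differs from it by less than 1/(n+1) in the first n+1
  directions; \<open>supp_set_limit\<close> takes care of the limits of such members.\<close>

lemma set_of_supp_measurable:
  assumes meas: "\<And>p. p \<in> dirs \<Longrightarrow> (\<lambda>e. y e p) \<in> borel_measurable N"
  shows "set_measurable N (\<lambda>e. set_of_supp (y e :: 'v::euclidean_space \<Rightarrow> real))"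
proof (rule set_measurableI_supp)
  fix p :: 'v assume p: "p \<in> dirs"
  obtain S :: "nat \<Rightarrow> 'v set" where S: "\<And>j. S j \<in> compact_convex_sets"
    "\<And>A e. A \<in> compact_convex_sets \<Longrightarrow> 0 < e \<Longrightarrow> \<exists>j. hdist A (S j) < e"
    by (rule countable_hdist_dense) blast
  define d :: "nat \<Rightarrow> 'v" where "d = from_nat_into dirs"
  have d: "d i \<in> dirs" for i unfolding d_def using p by (intro from_nat_into) auto
  have d_surj: "\<exists>i. d i = p" if "p \<in> dirs" for p unfolding d_def
    by (rule from_nat_into_surj[OF countable_dirs that])
  define G where "G y \<longleftrightarrow> (\<forall>n::nat. \<exists>j. \<forall>i\<le>n. \<bar>supp (S j) (d i) - y (d i)\<bar> < 1 / Suc n)" for y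
  have G: "G y \<longleftrightarrow> (\<exists>A\<in>compact_convex_sets. \<forall>p\<in>dirs. supp A p = y p)" for y
  proof
    assume "G y"
    then obtain j where j: "\<And>n i. i \<le> n \<Longrightarrow> \<bar>supp (S (j n)) (d i) - y (d i)\<bar> < 1 / Suc n"
      unfolding G_def by metis
    have "(\<lambda>n. supp (S (j n)) p) \<longlonglongrightarrow> y p" if p: "p \<in> dirs" for p
    proof -
      obtain i where i: "d i = p" using d_surj[OF p] by blast
      have "(\<lambda>n. supp (S (j n)) p - y p) \<longlonglongrightarrow> 0"
      proof (rule Lim_null_comparison)
        show "\<forall>\<^sub>F n in sequentially. norm (supp (S (j n)) p - y p) \<le> inverse (real (Suc n))"
          unfolding eventually_sequentially using j[of i] unfolding i
          by (intro exI[of _ i]) (auto simp: inverse_eq_divide less_imp_le)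
      qed (rule LIMSEQ_inverse_real_of_nat)
      then show ?thesis by (simp add: LIM_zero_iff)
    qed
    from supp_set_limit[of "\<lambda>n. S (j n)", OF S(1) this]
    show "\<exists>A\<in>compact_convex_sets. \<forall>p\<in>dirs. supp A p = y p"
      by (intro bexI[of _ "supp_set y"] ballI) simp_all
  next
    assume "\<exists>A\<in>compact_convex_sets. \<forall>p\<in>dirs. supp A p = y p"
    then obtain A where A: "A \<in> compact_convex_sets" "\<forall>p\<in>dirs. supp A p = y p" by blast
    show "G y" unfolding G_def
    proof
      fix n
      \<comment> \<open>b dominates the norms of the directions with index at most n, so a distance
        below 1/(n+1)/b gives an error below 1/(n+1) in each of them. The summand 1 keeps b
        positive.\<close>
      define b where "b = 1 + (\<Sum>i\<le>n. norm (d i))"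
      have b: "b > 0" unfolding b_def by (intro add_pos_nonneg sum_nonneg) auto
      obtain j where j: "hdist A (S j) < 1 / Suc n / b" using S(2)[OF A(1), of "1 / Suc n / b"] b by auto
      have "\<bar>supp (S j) (d i) - y (d i)\<bar> < 1 / Suc n" if i: "i \<le> n" for i
      proof -
        have "norm (d i) \<le> (\<Sum>i\<le>n. norm (d i))" using i by (intro member_le_sum) auto
        then have "norm (d i) \<le> b" unfolding b_def by simp
        have "\<bar>supp (S j) (d i) - y (d i)\<bar> \<le> norm (d i) * hdist A (S j)"
          using hdist_upper[OF A(1) S(1), of "d i"] bspec[OF A(2) d] by (simp add: abs_minus_commute)
        also have "\<dots> \<le> b * hdist A (S j)" using \<open>norm (d i) \<le> b\<close> hdist_nonneg[OF A(1) S(1)] by (rule mult_right_mono)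
        also have "\<dots> < b * (1 / Suc n / b)" using j b by (rule mult_strict_left_mono)
        also have "\<dots> = 1 / Suc n" using b by simp
        finally show ?thesis .
      qed
      then show "\<exists>j. \<forall>i\<le>n. \<bar>supp (S j) (d i) - y (d i)\<bar> < 1 / Suc n" by blast
    qed
  qed
  have "supp (set_of_supp (y e)) p = (if G (y e) then y e p else 0)" for e
  proof (cases "G (y e)")
    case True
    then obtain A where A: "A \<in> compact_convex_sets" "\<forall>p\<in>dirs. supp A p = y e p"
      using G[of "y e"] by blast
    then have "set_of_supp (y e) = A" by (intro set_of_supp_eq) auto
    then show ?thesis using True A p by simp
  next
    case False
    then have "set_of_supp (y e) = {0}" using G[of "y e"] by (simp only: set_of_supp_def if_False)
    with False show ?thesis by simp
  qed
  moreover have [measurable]: "(\<lambda>e. y e (d i)) \<in> borel_measurable N" for i using meas d by blast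
  have "Measurable.pred N (\<lambda>e. G (y e))" unfolding G_def by measurable
  then have "(\<lambda>e. if G (y e) then y e p else 0) \<in> borel_measurable N"
    using meas[OF p] by measurable
  ultimately show "(\<lambda>e. supp (set_of_supp (y e)) p) \<in> borel_measurable N" by simp
qed (rule set_of_supp_ccs)

text \<open>The Kuratowski-Ryll-Nardzewski construction: a dense sequence is searched for points
  coming ever closer to X while staying near the previous choice. Taking least indices keeps each
  stage measurable, and the limit lies in X because X is closed.\<close>

lemma measurable_selection:
  fixes X :: "'e \<Rightarrow> 'v::euclidean_space set"
  assumes X: "set_measurable N X"
  obtains g where "g \<in> borel_measurable N" "\<And>e. e \<in> space N \<Longrightarrow> g e \<in> X e"
proof -
  obtain q :: "nat \<Rightarrow> 'v" where q: "closure (range q) = UNIV"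
  proof -
    have "range (from_nat_into (dirs::'v set)) = dirs"
      by (intro range_from_nat_into dirs_ne countable_dirs)
    then show ?thesis using that[of "from_nat_into dirs"] closure_dirs by metis
  qed
  have near: "\<exists>i. dist (q i) x < e" if "e > 0" for x e
    using that closure_approachable[of x "range q"] q by auto
  \<comment> \<open>From a point at distance less than (1/2)^n from X, some member of the sequence
    at distance less than (1/2)^(n+1) from X is reached within (1/2)^n + (1/2)^(n+1). This is below
    the allowed 2 * (1/2)^n, which is summable.\<close>
  define idx where "idx = rec_nat (\<lambda>e. LEAST i. infdist (q i) (X e) < 1)
    (\<lambda>n f e. LEAST i. infdist (q i) (X e) < (1/2)^Suc n \<and> dist (q i) (q (f e)) < 2 * (1/2)^n)"
  have idx_0: "idx 0 = (\<lambda>e. LEAST i. infdist (q i) (X e) < 1)"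
    and idx_Suc: "idx (Suc n) = (\<lambda>e. LEAST i. infdist (q i) (X e) < (1/2)^Suc n \<and> dist (q i) (q (idx n e)) < 2 * (1/2)^n)" for n
    by (simp_all add: idx_def)
  have [measurable]: "(\<lambda>e. infdist (q i) (X e)) \<in> borel_measurable N" for i
    by (rule set_measurable_infdist[OF X])
  have meas [measurable]: "idx n \<in> measurable N (count_space UNIV)" for n
  proof (induction n)
    case 0 show ?case unfolding idx_0 by measurable
  next
    case (Suc n)
    note Suc[measurable]
    have "(\<lambda>e. dist (q i) (q (idx n e))) \<in> borel_measurable N" for i
      by (rule measurable_compose[OF Suc]) simp
    note this[measurable]
    show ?case unfolding idx_Suc by measurable
  qed
  have near_X: "\<exists>i. infdist (q i) (X e) < d \<and> dist (q i) y < infdist y (X e) + d"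
    if e: "e \<in> space N" and d: "0 < d" for e y d
  proof -
    obtain x where x: "x \<in> X e" "infdist y (X e) = dist y x"
      using infdist_attains_inf set_measurableD[OF X e] by metis
    obtain i where i: "dist (q i) x < d" using near d by blast
    have "infdist (q i) (X e) < d" using infdist_le[OF x(1), of "q i"] i by simp
    moreover have "dist (q i) y \<le> dist (q i) x + dist y x" by (metis dist_triangle dist_commute)
    ultimately show ?thesis using i x by (intro exI[of _ i]) auto
  qed
  \<comment> \<open>The least index of a stage is meaningful only if a candidate exists, and its
    existence uses the closeness to X reached at the previous stage; hence an induction.\<close>
  have in1: "infdist (q (idx n e)) (X e) < (1/2)^n" if e: "e \<in> space N" for n e
  proof -
    have 1: "infdist (q (idx n e)) (X e) < (1/2)^n" for n
    proof (cases n)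
      case 0
      have "\<exists>i. infdist (q i) (X e) < 1" using near_X[OF e, of 1 0] by auto
      from LeastI_ex[OF this] show ?thesis unfolding 0 idx_0 by simp
    next
      case (Suc n)
      show ?thesis
      proof (unfold Suc, induction n)
        case 0
        have "infdist (q (idx 0 e)) (X e) < 1"
        proof -
          have "\<exists>i. infdist (q i) (X e) < 1" using near_X[OF e, of 1 0] by auto
          from LeastI_ex[OF this] show ?thesis unfolding idx_0 .
        qed
        moreover obtain i where "infdist (q i) (X e) < 1/2" "dist (q i) (q (idx 0 e)) < infdist (q (idx 0 e)) (X e) + 1/2"
          using near_X[OF e, of "1/2"] by auto
        ultimately have "\<exists>i. infdist (q i) (X e) < (1/2)^Suc 0 \<and> dist (q i) (q (idx 0 e)) < 2 * (1/2)^0"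
          by (intro exI[of _ i]) auto
        from LeastI_ex[OF this] show ?case unfolding idx_Suc by simp
      next
        case (Suc n)
        obtain i where i: "infdist (q i) (X e) < (1/2)^Suc (Suc n)"
          "dist (q i) (q (idx (Suc n) e)) < infdist (q (idx (Suc n) e)) (X e) + (1/2)^Suc (Suc n)"
          using near_X[OF e, of "(1/2)^Suc (Suc n)"] by auto
        have "0 < (1/2::real)^n" by simp
        with i(2) Suc have "dist (q i) (q (idx (Suc n) e)) < 2 * (1/2)^Suc n"
          unfolding power_Suc by linarith
        with i(1) have "\<exists>i. infdist (q i) (X e) < (1/2)^Suc (Suc n) \<and> dist (q i) (q (idx (Suc n) e)) < 2 * (1/2)^Suc n"
          by blast
        from LeastI_ex[OF this] show ?case unfolding idx_Suc[of "Suc n"] by simp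
      qed
    qed
    show ?thesis by (rule 1)
  qed
  have in2: "dist (q (idx (Suc n) e)) (q (idx n e)) < 2 * (1/2)^n" if e: "e \<in> space N" for n e
  proof -
    obtain i where i: "infdist (q i) (X e) < (1/2)^Suc n"
      "dist (q i) (q (idx n e)) < infdist (q (idx n e)) (X e) + (1/2)^Suc n"
      using near_X[OF e, of "(1/2)^Suc n"] by auto
    have "0 < (1/2::real)^n" by simp
    with i(2) in1[OF e, of n] have "dist (q i) (q (idx n e)) < 2 * (1/2)^n"
      unfolding power_Suc by linarith
    with i(1) have "\<exists>i. infdist (q i) (X e) < (1/2)^Suc n \<and> dist (q i) (q (idx n e)) < 2 * (1/2)^n"
      by blast
    from LeastI_ex[OF this] show "dist (q (idx (Suc n) e)) (q (idx n e)) < 2 * (1/2)^n"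
      unfolding idx_Suc by simp
  qed
  have conv: "convergent (\<lambda>n. q (idx n e))" if e: "e \<in> space N" for e
  proof -
    have "summable (\<lambda>n. 2 * (1/2::real)^n)" by (intro summable_mult summable_geometric) simp
    then have "summable (\<lambda>n. q (idx (Suc n) e) - q (idx n e))"
      by (rule summable_comparison_test'[where N = 0]) (use in2[OF e] in \<open>auto simp: dist_norm less_imp_le\<close>)
    then have "convergent (\<lambda>n. q (idx n e) - q (idx 0 e))"
      unfolding summable_iff_convergent sum_lessThan_telescope[of "\<lambda>n. q (idx n e)"] .
    then show ?thesis unfolding convergent_diff_const_right_iff .
  qed
  define g where "g e = lim (\<lambda>n. q (idx n e))" for e
  have lim: "(\<lambda>n. q (idx n e)) \<longlonglongrightarrow> g e" if "e \<in> space N" for e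
    using conv[OF that] unfolding g_def convergent_LIMSEQ_iff .
  show ?thesis
  proof (rule that)
    have "(\<lambda>e. q (idx n e)) \<in> borel_measurable N" for n
      by (rule measurable_compose[OF meas]) simp
    from borel_measurable_LIMSEQ_metric[OF this lim] show "g \<in> borel_measurable N" .
    fix e assume e: "e \<in> space N"
    have "(\<lambda>n. infdist (q (idx n e)) (X e)) \<longlonglongrightarrow> infdist (g e) (X e)"
      by (intro tendsto_intros lim e)
    moreover have "(\<lambda>n. infdist (q (idx n e)) (X e)) \<longlonglongrightarrow> 0"
    proof (rule Lim_null_comparison)
      show "(\<lambda>n. (1/2::real)^n) \<longlonglongrightarrow> 0" by (rule LIMSEQ_power_zero) simp
      show "\<forall>\<^sub>F n in sequentially. norm (infdist (q (idx n e)) (X e)) \<le> (1/2)^n"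
        using in1[OF e] by (intro always_eventually) (auto simp: infdist_nonneg less_imp_le)
    qed
    ultimately have "infdist (g e) (X e) = 0" by (rule LIMSEQ_unique)
    then show "g e \<in> X e" using in_closed_iff_infdist_zero[OF set_measurableD[OF X e]] by simp
  qed
qed

text \<open>For each q in \<open>dirs\<close> and each n a selection is taken from X cut down to the
  ball of radius 1/(n+1) about q, or from all of X where that ball misses it. A point of X close to
  q is then approximated by the selection belonging to q and n.\<close>

lemma castaing:
  fixes X :: "'e \<Rightarrow> 'v::euclidean_space set"
  assumes X: "set_measurable N X"
  obtains w :: "nat \<Rightarrow> 'e \<Rightarrow> 'v" where "\<And>k. w k \<in> borel_measurable N"
    "\<And>k e. e \<in> space N \<Longrightarrow> w k e \<in> X e" "\<And>e. e \<in> space N \<Longrightarrow> X e = closure (range (\<lambda>k. w k e))"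
proof -
  define Y where "Y q n e = (if X e \<inter> cball q (1 / Suc n) \<noteq> {} then X e \<inter> cball q (1 / Suc n) else X e)"
    for q :: 'v and n :: nat and e
  have Y: "set_measurable N (Y q n)" for q n
    unfolding set_measurable_def
  proof (intro conjI ballI allI impI)
    fix e assume "e \<in> space N"
    then show "Y q n e \<in> closed_sets"
      using set_measurableD[OF X] by (auto simp: Y_def closed_sets_def)
  next
    fix D :: "'v set" assume D: "closed D"
    let ?H = "\<lambda>D. {e \<in> space N. X e \<inter> D \<noteq> {}}"
    let ?C = "cball q (1 / Suc n)"
    \<comment> \<open>The modified map hits D either inside the ball, or anywhere provided X misses
      the ball.\<close>
    have "{e \<in> space N. Y q n e \<inter> D \<noteq> {}} = ?H (?C \<inter> D) \<union> (?H D - ?H ?C)"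
      unfolding Y_def by auto
    then show "{e \<in> space N. Y q n e \<inter> D \<noteq> {}} \<in> sets N"
      using D by (auto intro!: sets.Un sets.Diff set_measurable_hit[OF X] closed_Int)
  qed
  have "\<exists>g. g \<in> borel_measurable N \<and> (\<forall>e\<in>space N. g e \<in> Y q n e)" for q n
    by (rule measurable_selection[OF Y[of q n]]) blast
  then obtain g where g: "\<And>q n. g q n \<in> borel_measurable N" "\<And>q n e. e \<in> space N \<Longrightarrow> g q n e \<in> Y q n e" by metis
  define w where "w k = (case prod_decode k of (i, n) \<Rightarrow> g (from_nat_into dirs i) n)" for k
  have YX: "Y q n e \<subseteq> X e" for q n e by (auto simp: Y_def)
  show ?thesis
  proof (rule that)
    show "w k \<in> borel_measurable N" for k unfolding w_def by (simp add: g split: prod.split)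
    show in_X: "w k e \<in> X e" if "e \<in> space N" for k e
      unfolding w_def using g(2)[OF that] YX by (fastforce split: prod.split)
    fix e assume e: "e \<in> space N"
    show "X e = closure (range (\<lambda>k. w k e))"
    proof
      show "closure (range (\<lambda>k. w k e)) \<subseteq> X e"
        using in_X[OF e] set_measurableD[OF X e] by (intro closure_minimal) auto
      show "X e \<subseteq> closure (range (\<lambda>k. w k e))"
      proof
        fix x assume x: "x \<in> X e"
        have "\<exists>k. dist (w k e) x < d" if d: "0 < d" for d
        proof -
          obtain n :: nat where n: "1 / Suc n < d / 2"
            using reals_Archimedean[of "d/2"] d by (auto simp: inverse_eq_divide)
          have "x \<in> closure dirs" by simp
          then obtain q where q: "q \<in> dirs" "dist q x < 1 / Suc n"
            unfolding closure_approachable by (metis divide_pos_pos of_nat_0_less_iff zero_less_Suc zero_less_one)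
          obtain i where i: "from_nat_into dirs i = q" using from_nat_into_surj[OF countable_dirs q(1)] by blast
          have "X e \<inter> cball q (1 / Suc n) \<noteq> {}" using x q(2) by auto
          then have "g q n e \<in> cball q (1 / Suc n)" using g(2)[OF e, of q n] by (auto simp: Y_def)
          then have "dist (g q n e) x < d"
            using dist_triangle[of "g q n e" x q] q(2) n by (simp add: dist_commute)
          moreover have "w (prod_encode (i, n)) e = g q n e" by (simp add: w_def i)
          ultimately show ?thesis by metis
        qed
        then show "x \<in> closure (range (\<lambda>k. w k e))" by (auto simp: closure_approachable)
      qed
    qed
  qed
qed

lemma infdist_closure_range:
  fixes w :: "nat \<Rightarrow> 'v::euclidean_space"
  shows "infdist q (closure (range w)) = (INF k. dist q (w k))"
  unfolding infdist_eq_setdist setdist_closure_2 by (simp add: infdist_eq_setdist[symmetric] infdist_def image_image)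

lemma set_measurable_closure_range:
  fixes w :: "nat \<Rightarrow> 'e \<Rightarrow> 'v::euclidean_space"
  assumes w [measurable]: "\<And>k. w k \<in> borel_measurable N"
  shows "set_measurable N (\<lambda>e. closure (range (\<lambda>k. w k e)))"
proof (rule set_measurableI_infdist)
  show "(\<lambda>e. infdist q (closure (range (\<lambda>k. w k e)))) \<in> borel_measurable N" for q
    unfolding infdist_closure_range by (rule borel_measurable_cINF) (auto intro!: bdd_belowI[of _ 0])
qed auto

text \<open>Sums of members of two Castaing representations are dense in the sum. Compactness of one
  summand keeps the sum closed; the other is only closed, like a version of the time integral, which
  is known to be bounded only almost surely.\<close>

lemma set_measurable_plus:
  fixes X Y :: "'e \<Rightarrow> 'v::euclidean_space set"
  assumes X: "set_measurable N X" and c: "\<And>e. e \<in> space N \<Longrightarrow> compact (X e)" and Y: "set_measurable N Y"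
  shows "set_measurable N (\<lambda>e. X e + Y e)"
proof -
  obtain v :: "nat \<Rightarrow> 'e \<Rightarrow> 'v" where v: "\<And>k. v k \<in> borel_measurable N" "\<And>k e. e \<in> space N \<Longrightarrow> v k e \<in> X e"
    "\<And>e. e \<in> space N \<Longrightarrow> X e = closure (range (\<lambda>k. v k e))" by (rule castaing[OF X]) blast
  obtain w :: "nat \<Rightarrow> 'e \<Rightarrow> 'v" where w: "\<And>k. w k \<in> borel_measurable N" "\<And>k e. e \<in> space N \<Longrightarrow> w k e \<in> Y e"
    "\<And>e. e \<in> space N \<Longrightarrow> Y e = closure (range (\<lambda>k. w k e))" by (rule castaing[OF Y]) blast
  define u where "u k e = (case prod_decode k of (i, j) \<Rightarrow> v i e + w j e)" for k e
  note [measurable] = v(1) w(1)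
  have "u k \<in> borel_measurable N" for k unfolding u_def by (cases "prod_decode k") simp
  then have "set_measurable N (\<lambda>e. closure (range (\<lambda>k. u k e)))" by (rule set_measurable_closure_range)
  also have "?this \<longleftrightarrow> ?thesis"
  proof (rule set_measurable_cong)
    fix e assume e: "e \<in> space N"
    have "range (\<lambda>k. u k e) = range (\<lambda>k. v k e) + range (\<lambda>k. w k e)"
    proof (intro equalityI subsetI)
      fix x assume "x \<in> range (\<lambda>k. u k e)"
      then obtain k where "x = u k e" by auto
      then show "x \<in> range (\<lambda>k. v k e) + range (\<lambda>k. w k e)"
        by (cases "prod_decode k") (auto simp: u_def intro!: set_plus_intro)
    next
      fix x assume "x \<in> range (\<lambda>k. v k e) + range (\<lambda>k. w k e)"
      then obtain i j where "x = v i e + w j e" by (auto elim!: set_plus_elim)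
      then have "x = u (prod_encode (i, j)) e" by (simp add: u_def)
      then show "x \<in> range (\<lambda>k. u k e)" by blast
    qed
    moreover have "closure (range (\<lambda>k. v k e) + range (\<lambda>k. w k e)) = X e + Y e"
    proof
      have "X e + Y e = (\<Union>x\<in>X e. \<Union>y\<in>Y e. {x + y})" by (auto simp: set_plus_def)
      then have "closed (X e + Y e)"
        using compact_closed_sums[OF c[OF e] set_measurableD(1)[OF Y e]] by simp
      moreover have "range (\<lambda>k. v k e) + range (\<lambda>k. w k e) \<subseteq> X e + Y e"
        using v(2)[OF e] w(2)[OF e] by (intro set_plus_mono2) auto
      ultimately show "closure (range (\<lambda>k. v k e) + range (\<lambda>k. w k e)) \<subseteq> X e + Y e"
        by (rule closure_minimal[rotated])
      show "X e + Y e \<subseteq> closure (range (\<lambda>k. v k e) + range (\<lambda>k. w k e))"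
        unfolding v(3)[OF e] w(3)[OF e] by (rule closure_sum)
    qed
    ultimately show "closure (range (\<lambda>k. u k e)) = X e + Y e" by simp
  qed
  finally show ?thesis .
qed

text \<open>The first member of a Castaing representation that is optimal up to eps. Near-optimality
  avoids selecting exact maximisers and suffices because the tolerance is sent to 0 in the
  end.\<close>

lemma eps_support_selection:
  fixes X :: "'e \<Rightarrow> 'v::euclidean_space set"
  assumes X: "set_measurable N X" and c: "\<And>e. e \<in> space N \<Longrightarrow> compact (X e)" and eps: "0 < eps"
  obtains g where "g \<in> borel_measurable N" "\<And>e. e \<in> space N \<Longrightarrow> g e \<in> X e"
    "\<And>e. e \<in> space N \<Longrightarrow> supp (X e) p - eps \<le> p \<bullet> g e"
proof -
  obtain w :: "nat \<Rightarrow> 'e \<Rightarrow> 'v" where w: "\<And>k. w k \<in> borel_measurable N" "\<And>k e. e \<in> space N \<Longrightarrow> w k e \<in> X e"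
    "\<And>e. e \<in> space N \<Longrightarrow> X e = closure (range (\<lambda>k. w k e))" by (rule castaing[OF X]) blast
  note [measurable] = w(1) supp_measurable[OF X c, of p]
  define i where "i e = (LEAST k. supp (X e) p - eps \<le> p \<bullet> w k e)" for e
  have ex: "\<exists>k. supp (X e) p - eps \<le> p \<bullet> w k e" if e: "e \<in> space N" for e
  proof (rule ccontr)
    assume "\<nexists>k. supp (X e) p - eps \<le> p \<bullet> w k e"
    then have "range (\<lambda>k. w k e) \<subseteq> {x. p \<bullet> x \<le> supp (X e) p - eps}" by (auto simp: not_le less_imp_le)
    then have "X e \<subseteq> {x. p \<bullet> x \<le> supp (X e) p - eps}"
      unfolding w(3)[OF e] by (intro closure_minimal) (auto simp: closed_halfspace_le)
    then have "supp (X e) p \<le> supp (X e) p - eps"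
      using set_measurableD(2)[OF X e] by (intro supp_le) auto
    then show False using eps by simp
  qed
  have i: "i \<in> measurable N (count_space UNIV)" unfolding i_def by measurable
  show ?thesis
  proof (rule that[of "\<lambda>e. w (i e) e"])
    show "(\<lambda>e. w (i e) e) \<in> borel_measurable N" by (rule measurable_compose_countable[OF w(1) i])
    show "w (i e) e \<in> X e" if "e \<in> space N" for e using w(2)[OF that] .
    show "supp (X e) p - eps \<le> p \<bullet> w (i e) e" if "e \<in> space N" for e
      unfolding i_def by (rule LeastI_ex[OF ex[OF that]])
  qed
qed

text \<open>\<open>Y e\<close> is replaced by the first member of a countable dense family within
  1/(n+1) of it. For a fixed member measurability is assumed, and the Lipschitz bound makes the
  support functions converge.\<close>

lemma set_measurable_caratheodory:
  fixes f :: "'e \<Rightarrow> 'v::euclidean_space set \<Rightarrow> 'u::euclidean_space set"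
  assumes f: "\<And>A. A \<in> compact_convex_sets \<Longrightarrow> set_measurable N (\<lambda>e. f e A)"
    and f_ccs: "\<And>e A. e \<in> space N \<Longrightarrow> A \<in> compact_convex_sets \<Longrightarrow> f e A \<in> compact_convex_sets"
    and lip: "\<And>e A B. e \<in> space N \<Longrightarrow> A \<in> compact_convex_sets \<Longrightarrow> B \<in> compact_convex_sets \<Longrightarrow>
      hdist (f e A) (f e B) \<le> K * hdist A B"
    and Y: "set_measurable N Y" "\<And>e. e \<in> space N \<Longrightarrow> Y e \<in> compact_convex_sets"
  shows "set_measurable N (\<lambda>e. f e (Y e))"
proof (rule set_measurableI_supp)
  fix p :: 'u assume "p \<in> dirs"
  obtain S :: "nat \<Rightarrow> 'v set" where S: "\<And>j. S j \<in> compact_convex_sets"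
    "\<And>A e. A \<in> compact_convex_sets \<Longrightarrow> 0 < e \<Longrightarrow> \<exists>j. hdist A (S j) < e"
    by (rule countable_hdist_dense) blast
  have [measurable]: "(\<lambda>e. hdist (Y e) (S j)) \<in> borel_measurable N" for j
    by (rule hdist_measurable[OF Y set_measurable_const[OF ccs_closed_sets[OF S(1)]] S(1)])
  define j where "j n e = (LEAST j. hdist (Y e) (S j) < inverse (Suc n))" for n :: nat and e
  have j: "hdist (Y e) (S (j n e)) < inverse (Suc n)" if "e \<in> space N" for n e
  proof -
    have "\<exists>j. hdist (Y e) (S j) < inverse (Suc n)" by (rule S(2)[OF Y(2)[OF that]]) simp
    from LeastI_ex[OF this] show ?thesis unfolding j_def .
  qed
  have j_meas: "j n \<in> measurable N (count_space UNIV)" for n unfolding j_def by measurable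
  show "(\<lambda>e. supp (f e (Y e)) p) \<in> borel_measurable N"
  proof (rule borel_measurable_LIMSEQ_metric)
    fix n
    have "(\<lambda>e. supp (f e (S i)) p) \<in> borel_measurable N" for i
      by (rule supp_measurable[OF f[OF S(1)] ccsD(2)[OF f_ccs[OF _ S(1)]]])
    then show "(\<lambda>e. supp (f e (S (j n e))) p) \<in> borel_measurable N"
      by (rule measurable_compose_countable[OF _ j_meas])
  next
    fix e assume e: "e \<in> space N"
    have "(\<lambda>n. supp (f e (S (j n e))) p - supp (f e (Y e)) p) \<longlonglongrightarrow> 0"
    proof (rule Lim_null_comparison)
      show "(\<lambda>n. norm p * (\<bar>K\<bar> * inverse (Suc n))) \<longlonglongrightarrow> 0"
        by (rule tendsto_mult_right_zero[OF tendsto_mult_right_zero[OF LIMSEQ_inverse_real_of_nat]])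
      show "\<forall>\<^sub>F n in sequentially. norm (supp (f e (S (j n e))) p - supp (f e (Y e)) p) \<le> norm p * (\<bar>K\<bar> * inverse (Suc n))"
      proof (intro always_eventually allI)
        fix n
        let ?A = "S (j n e)"
        note Ye = Y(2)[OF e]
        have "hdist (f e ?A) (f e (Y e)) \<le> K * hdist ?A (Y e)" by (rule lip[OF e S(1) Ye])
        also have "\<dots> \<le> \<bar>K\<bar> * hdist ?A (Y e)" by (rule mult_right_mono[OF abs_ge_self hdist_nonneg[OF S(1) Ye]])
        also have "\<dots> \<le> \<bar>K\<bar> * inverse (Suc n)"
          using j[OF e, of n] by (intro mult_left_mono) (simp_all add: hdist_commute)
        finally have "norm p * hdist (f e ?A) (f e (Y e)) \<le> norm p * (\<bar>K\<bar> * inverse (Suc n))"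
          by (rule mult_left_mono) simp
        with hdist_upper[OF f_ccs[OF e S(1)] f_ccs[OF e Ye], of "j n e" p]
        show "norm (supp (f e ?A) p - supp (f e (Y e)) p) \<le> norm p * (\<bar>K\<bar> * inverse (Suc n))"
          by simp
      qed
    qed
    then show "(\<lambda>n. supp (f e (S (j n e))) p) \<longlonglongrightarrow> supp (f e (Y e)) p" by (simp add: LIM_zero_iff)
  qed
qed (use f_ccs[OF _ Y(2)] in simp)

subsection \<open>Decomposable sets of integrable functions\<close>

text \<open>If a parameter u on the segment were missed, take the last parameter before u and the
  first one after u whose points lie in S. The point halfway between them lies in S again,
  contradicting the choice.\<close>

lemma convex_midpoint_closed:
  fixes S :: "'v::euclidean_space set"
  assumes S: "closed S" and mid: "\<And>x y. x \<in> S \<Longrightarrow> y \<in> S \<Longrightarrow> midpoint x y \<in> S"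
  shows "convex S"
  unfolding convex_alt
proof (intro ballI allI impI)
  fix x y u assume x: "x \<in> S" and y: "y \<in> S" and u: "0 \<le> u \<and> u \<le> (1::real)"
  define c where "c u = (1 - u) *\<^sub>R x + u *\<^sub>R y" for u
  define P where "P = {0..1} \<inter> c -` S"
  have "continuous_on {0..1} c" unfolding c_def by (intro continuous_intros)
  then have "closed P" unfolding P_def using S by (intro continuous_closed_preimage) auto
  have P: "0 \<in> P" "1 \<in> P" using x y by (auto simp: P_def c_def)
  have "u \<in> P"
  proof (rule ccontr)
    assume nP: "u \<notin> P"
    have "compact (P \<inter> {0..u})" "compact (P \<inter> {u..1})"
      using \<open>closed P\<close> by (auto intro: closed_Int_compact)
    moreover have "P \<inter> {0..u} \<noteq> {}" "P \<inter> {u..1} \<noteq> {}" using P u by auto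
    ultimately have "\<exists>a\<in>P \<inter> {0..u}. \<forall>t\<in>P \<inter> {0..u}. t \<le> a" "\<exists>b\<in>P \<inter> {u..1}. \<forall>t\<in>P \<inter> {u..1}. b \<le> t"
      using compact_attains_sup[of "P \<inter> {0..u}"] compact_attains_inf[of "P \<inter> {u..1}"] by simp_all
    then obtain a b where a: "a \<in> P \<inter> {0..u}" "\<forall>t\<in>P \<inter> {0..u}. t \<le> a"
      and b: "b \<in> P \<inter> {u..1}" "\<forall>t\<in>P \<inter> {u..1}. b \<le> t" by blast
    have ab: "a < u" "u < b" using a(1) b(1) nP by (auto simp: less_le)
    have "c ((a + b) / 2) = midpoint (c a) (c b)"
    proof -
      have "c ((a + b) / 2) = (1/2) *\<^sub>R ((2 - (a + b)) *\<^sub>R x + (a + b) *\<^sub>R y)"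
        unfolding c_def scaleR_add_right scaleR_scaleR by (simp add: field_simps)
      moreover have "(2 - (a + b)) *\<^sub>R x + (a + b) *\<^sub>R y = c a + c b"
        unfolding c_def by (simp add: algebra_simps scaleR_2)
      ultimately show ?thesis by (simp add: midpoint_def)
    qed
    then have "(a + b) / 2 \<in> P"
      using a(1) b(1) mid[of "c a" "c b"] by (auto simp: P_def)
    then show False
      using bspec[OF a(2), of "(a + b) / 2"] bspec[OF b(2), of "(a + b) / 2"] ab a(1) b(1)
      by (cases "(a + b) / 2 \<le> u") auto
  qed
  then show "(1 - u) *\<^sub>R x + u *\<^sub>R y \<in> S" by (simp add: P_def c_def)
qed

lemma ennreal_add_power_le: "(x + y) ^ p \<le> 2 ^ p * (x ^ p + y ^ p)" for x y :: ennreal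
proof -
  have "(x + y) ^ p \<le> (2 * max x y) ^ p"
    by (intro power_mono) (auto simp: mult_2 intro: add_mono)
  also have "\<dots> = 2 ^ p * (max x y) ^ p" by (rule power_mult_distrib)
  also have "\<dots> \<le> 2 ^ p * (x ^ p + y ^ p)" by (intro mult_left_mono) (auto simp: max_def)
  finally show ?thesis .
qed

lemma ennreal_norm_add_power_le:
  "ennreal (norm (a + b)) ^ p \<le> 2 ^ p * (ennreal (norm a) ^ p + ennreal (norm b) ^ p)"
proof -
  have "ennreal (norm (a + b)) ^ p \<le> (ennreal (norm a) + ennreal (norm b)) ^ p"
    by (intro power_mono) (auto simp: ennreal_plus[symmetric] norm_triangle_ineq simp del: ennreal_plus)
  also have "\<dots> \<le> 2 ^ p * (ennreal (norm a) ^ p + ennreal (norm b) ^ p)" by (rule ennreal_add_power_le)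
  finally show ?thesis .
qed

section \<open>Closures in L^p and sets of selectors\<close>

lemma vec_LpD: "g \<in> vec_Lp p M G \<Longrightarrow> g \<in> borel_measurable G"
  "g \<in> vec_Lp p M G \<Longrightarrow> (\<integral>\<^sup>+\<omega>. ennreal (norm (g \<omega>)) ^ p \<partial>M) < \<infinity>"
  by (auto simp: vec_Lp_def)

lemma vec_Lp_measurable: "subalgebra M G \<Longrightarrow> g \<in> vec_Lp p M G \<Longrightarrow> g \<in> borel_measurable M"
  using measurable_from_subalg vec_LpD(1) by blast

lemma Lp_closure_mono: "V \<subseteq> V' \<Longrightarrow> Lp_closure p M G V \<subseteq> Lp_closure p M G V'"
  unfolding Lp_closure_def by blast

abbreviation Lp_dist :: "nat \<Rightarrow> 'w measure \<Rightarrow> ('w \<Rightarrow> 'v::euclidean_space) \<Rightarrow> ('w \<Rightarrow> 'v) \<Rightarrow> ennreal" where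
  "Lp_dist p M g v \<equiv> \<integral>\<^sup>+\<omega>. ennreal (norm (g \<omega> - v \<omega>)) ^ p \<partial>M"

lemma Lp_closureI:
  assumes "g \<in> vec_Lp p M G"
    "\<And>e. 0 < e \<Longrightarrow> \<exists>v\<in>V. Lp_dist p M g v \<le> ennreal e"
  shows "g \<in> Lp_closure p M G V"
proof -
  have "\<exists>v\<in>V. Lp_dist p M g v < ennreal e" if "0 < e" for e
  proof -
    have "0 < e/2" using that by simp
    from assms(2)[OF this] obtain v where "v \<in> V" "Lp_dist p M g v \<le> ennreal (e/2)"
      by blast
    moreover have "ennreal (e/2) < ennreal e" using that by (intro ennreal_lessI) auto
    ultimately show ?thesis by (meson le_less_trans)
  qed
  with assms(1) show ?thesis unfolding Lp_closure_def by simp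
qed

lemma Lp_closureD:
  assumes "g \<in> Lp_closure p M G V"
  shows "g \<in> vec_Lp p M G" "0 < e \<Longrightarrow> \<exists>v\<in>V. Lp_dist p M g v < ennreal e"
  using assms by (auto simp: Lp_closure_def)

lemma Lp_closure_subset_vec_Lp: "Lp_closure p M G V \<subseteq> vec_Lp p M G"
  by (auto simp: Lp_closure_def)

lemma Lp_closure_superset:
  assumes "V \<subseteq> vec_Lp p M G" "0 < p"
  shows "V \<subseteq> Lp_closure p M G V"
proof
  fix v assume "v \<in> V"
  then show "v \<in> Lp_closure p M G V" using assms by (intro Lp_closureI) (auto intro!: bexI[of _ v] simp: zero_power)
qed

text \<open>\<open>Lp_dist\<close> is a p-th power without the root, so the triangle inequality
  holds up to the factor 2^p.\<close>

lemma Lp_triangle: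
  fixes f g h :: "'w \<Rightarrow> 'v::euclidean_space"
  assumes [measurable]: "f \<in> borel_measurable M" "g \<in> borel_measurable M" "h \<in> borel_measurable M"
  shows "Lp_dist p M f h \<le>
    2 ^ p * (Lp_dist p M f g + Lp_dist p M g h)"
proof -
  have "Lp_dist p M f h \<le>
    (\<integral>\<^sup>+\<omega>. 2 ^ p * (ennreal (norm (f \<omega> - g \<omega>)) ^ p + ennreal (norm (g \<omega> - h \<omega>)) ^ p) \<partial>M)"
  proof (rule nn_integral_mono)
    fix \<omega>
    have "f \<omega> - h \<omega> = (f \<omega> - g \<omega>) + (g \<omega> - h \<omega>)" by simp
    then show "ennreal (norm (f \<omega> - h \<omega>)) ^ p \<le> 2 ^ p * (ennreal (norm (f \<omega> - g \<omega>)) ^ p + ennreal (norm (g \<omega> - h \<omega>)) ^ p)"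
      using ennreal_norm_add_power_le by metis
  qed
  also have "\<dots> = 2 ^ p * (Lp_dist p M f g + Lp_dist p M g h)"
    by (subst nn_integral_cmult; (subst nn_integral_add)?) simp_all
  finally show ?thesis .
qed

lemma Lp_closure_closed:
  fixes V :: "('w \<Rightarrow> 'v::euclidean_space) set"
  assumes G: "subalgebra M G" and V: "\<And>v. v \<in> V \<Longrightarrow> v \<in> borel_measurable M"
  shows "Lp_closure p M G (Lp_closure p M G V) \<subseteq> Lp_closure p M G V"
proof
  fix g assume g: "g \<in> Lp_closure p M G (Lp_closure p M G V)"
  show "g \<in> Lp_closure p M G V"
  proof (rule Lp_closureI)
    show gL: "g \<in> vec_Lp p M G" using Lp_closureD(1)[OF g] .
    fix e :: real assume e: "0 < e"
    \<comment> \<open>Halved for the two approximations and divided by the factor 2^p lost in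
      \<open>Lp_triangle\<close>.\<close>
    define d where "d = e / 2 ^ p / 2"
    have d: "0 < d" using e by (simp add: d_def)
    obtain u where u: "u \<in> Lp_closure p M G V" "Lp_dist p M g u < ennreal d"
      using Lp_closureD(2)[OF g d] by blast
    obtain v where v: "v \<in> V" "Lp_dist p M u v < ennreal d"
      using Lp_closureD(2)[OF u(1) d] by blast
    have "Lp_dist p M g v \<le> 2 ^ p * (Lp_dist p M g u +
      Lp_dist p M u v)"
      by (intro Lp_triangle vec_Lp_measurable[OF G gL] vec_Lp_measurable[OF G Lp_closureD(1)[OF u(1)]] V v(1))
    also have "\<dots> \<le> 2 ^ p * (ennreal d + ennreal d)" using u(2) v(2) by (intro mult_left_mono add_mono) auto
    also have "\<dots> = ennreal (2 ^ p * (d + d))"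
    proof -
      have "ennreal (2 ^ p * (d + d)) = ennreal (2 ^ p) * ennreal (d + d)" using d by (intro ennreal_mult) auto
      moreover have "ennreal (d + d) = ennreal d + ennreal d" using d by (intro ennreal_plus) auto
      moreover have "ennreal (2 ^ p) = 2 ^ p" by (metis ennreal_numeral ennreal_power zero_le_numeral)
      ultimately show ?thesis by metis
    qed
    also have "2 ^ p * (d + d) = e" by (simp add: d_def)
    finally show "\<exists>v\<in>V. Lp_dist p M g v \<le> ennreal e" using v(1) by blast
  qed
qed

text \<open>The p-th powers of the errors have an integrable sum, hence an almost surely finite one,
  so that their terms tend to 0.\<close>

lemma Lp_summable_AE_LIMSEQ:
  fixes g :: "'w \<Rightarrow> 'v::euclidean_space"
  assumes [measurable]: "g \<in> borel_measurable M" "\<And>n. v n \<in> borel_measurable M"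
    and le: "\<And>n. Lp_dist p M g (v n) \<le> ennreal ((1/2) ^ n)" and p: "0 < p"
  shows "AE \<omega> in M. (\<lambda>n. v n \<omega>) \<longlonglongrightarrow> g \<omega>"
proof -
  have "(\<integral>\<^sup>+\<omega>. (\<Sum>n. ennreal (norm (g \<omega> - v n \<omega>)) ^ p) \<partial>M) = (\<Sum>n. \<integral>\<^sup>+\<omega>. ennreal (norm (g \<omega> - v n \<omega>)) ^ p \<partial>M)"
    by (rule nn_integral_suminf) measurable
  also have "\<dots> \<le> (\<Sum>n. ennreal ((1/2) ^ n))" by (intro suminf_le le) auto
  also have "\<dots> = ennreal (\<Sum>n. (1/2) ^ n)" by (intro suminf_ennreal2) auto
  also have "\<dots> < \<infinity>" by simp
  finally have "AE \<omega> in M. (\<Sum>n. ennreal (norm (g \<omega> - v n \<omega>)) ^ p) \<noteq> \<infinity>"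
    by (intro nn_integral_PInf_AE) auto
  then show ?thesis
  proof eventually_elim
    case (elim \<omega>)
    then have "(\<Sum>n. ennreal (norm (g \<omega> - v n \<omega>) ^ p)) \<noteq> top" by (simp add: ennreal_power)
    then have "summable (\<lambda>n. norm (g \<omega> - v n \<omega>) ^ p)" by (intro summable_suminf_not_top) auto
    then have "(\<lambda>n. norm (g \<omega> - v n \<omega>) ^ p) \<longlonglongrightarrow> 0" by (rule summable_LIMSEQ_zero)
    then have "(\<lambda>n. root p (norm (g \<omega> - v n \<omega>) ^ p)) \<longlonglongrightarrow> root p 0" by (rule tendsto_real_root)
    then have "(\<lambda>n. norm (g \<omega> - v n \<omega>)) \<longlonglongrightarrow> 0" using p by (simp add: real_root_power_cancel)
    then have "(\<lambda>n. g \<omega> - v n \<omega>) \<longlonglongrightarrow> 0" by (simp add: tendsto_norm_zero_iff)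
    then have "(\<lambda>n. g \<omega> - (g \<omega> - v n \<omega>)) \<longlonglongrightarrow> g \<omega> - 0" by (intro tendsto_intros)
    then show ?case by simp
  qed
qed

lemma selectorsD: "g \<in> selectors p M G X \<Longrightarrow> g \<in> vec_Lp p M G"
  "g \<in> selectors p M G X \<Longrightarrow> AE \<omega> in M. g \<omega> \<in> X \<omega>"
  by (auto simp: selectors_def)

text \<open>An approximation at rate (1/2)^n converges almost surely, and closedness of each
  \<open>C \<omega>\<close> does the rest. C may be any closed-valued map, measurable or not, which
  the hull arguments exploit.\<close>

lemma selectors_closed:
  fixes C :: "'w \<Rightarrow> 'v::euclidean_space set"
  assumes G: "subalgebra M G" and C: "\<And>\<omega>. \<omega> \<in> space M \<Longrightarrow> closed (C \<omega>)" and p: "0 < p"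
  shows "Lp_closure p M G (selectors p M G C) \<subseteq> selectors p M G C"
proof
  fix g assume g: "g \<in> Lp_closure p M G (selectors p M G C)"
  have gL: "g \<in> vec_Lp p M G" using Lp_closureD(1)[OF g] .
  have "\<exists>v\<in>selectors p M G C. Lp_dist p M g v < ennreal ((1/2) ^ n)" for n
    by (rule Lp_closureD(2)[OF g]) simp
  then obtain v where v: "\<And>n. v n \<in> selectors p M G C"
    "\<And>n. Lp_dist p M g (v n) < ennreal ((1/2) ^ n)" by metis
  have "AE \<omega> in M. (\<lambda>n. v n \<omega>) \<longlonglongrightarrow> g \<omega>"
    using vec_Lp_measurable[OF G gL] vec_Lp_measurable[OF G selectorsD(1)[OF v(1)]] less_imp_le[OF v(2)] p
    by (rule Lp_summable_AE_LIMSEQ)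
  moreover have "AE \<omega> in M. \<forall>n. v n \<omega> \<in> C \<omega>" unfolding AE_all_countable using selectorsD(2)[OF v(1)] by blast
  ultimately have "AE \<omega> in M. g \<omega> \<in> C \<omega>" using AE_space
  proof eventually_elim
    case (elim \<omega>)
    then show ?case using closed_sequentially[OF C[OF elim(3)], of "\<lambda>n. v n \<omega>" "g \<omega>"] by simp
  qed
  then show "g \<in> selectors p M G C" using gL by (simp add: selectors_def)
qed

lemma vec_Lp_If:
  fixes g1 g2 :: "'w \<Rightarrow> 'v::euclidean_space"
  assumes G: "subalgebra M G" and D: "D \<in> sets G" and g: "g1 \<in> vec_Lp p M G" "g2 \<in> vec_Lp p M G"
  shows "(\<lambda>\<omega>. if \<omega> \<in> D then g1 \<omega> else g2 \<omega>) \<in> vec_Lp p M G"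
proof -
  note [measurable] = vec_Lp_measurable[OF G g(1)] vec_Lp_measurable[OF G g(2)]
  have "(\<integral>\<^sup>+\<omega>. ennreal (norm (if \<omega> \<in> D then g1 \<omega> else g2 \<omega>)) ^ p \<partial>M) \<le>
    (\<integral>\<^sup>+\<omega>. ennreal (norm (g1 \<omega>)) ^ p + ennreal (norm (g2 \<omega>)) ^ p \<partial>M)"
    by (intro nn_integral_mono) (auto simp: add_increasing add_increasing2)
  also have "\<dots> = (\<integral>\<^sup>+\<omega>. ennreal (norm (g1 \<omega>)) ^ p \<partial>M) + (\<integral>\<^sup>+\<omega>. ennreal (norm (g2 \<omega>)) ^ p \<partial>M)"
    by (rule nn_integral_add) measurable
  also have "\<dots> < \<infinity>" using vec_LpD(2)[OF g(1)] vec_LpD(2)[OF g(2)] by simp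
  finally show ?thesis
    using measurable_If_set[OF vec_LpD(1)[OF g(1)] vec_LpD(1)[OF g(2)], of D] D unfolding vec_Lp_def by simp
qed

lemma selectors_decomposable:
  assumes "subalgebra M G"
  shows "decomposable G (selectors p M G C)"
  unfolding decomposable_def
proof (intro ballI)
  fix D g1 g2 assume D: "D \<in> sets G" and g: "g1 \<in> selectors p M G C" "g2 \<in> selectors p M G C"
  have "AE \<omega> in M. (if \<omega> \<in> D then g1 \<omega> else g2 \<omega>) \<in> C \<omega>"
    using selectorsD(2)[OF g(1)] selectorsD(2)[OF g(2)] by eventually_elim auto
  with vec_Lp_If[OF assms D selectorsD(1)[OF g(1)] selectorsD(1)[OF g(2)]]
  show "(\<lambda>\<omega>. if \<omega> \<in> D then g1 \<omega> else g2 \<omega>) \<in> selectors p M G C" by (simp add: selectors_def)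
qed

text \<open>It suffices to test the members of a Castaing representation; these need not be integrable and
  are replaced by a fixed selector where their norm exceeds \<open>n\<close>.\<close>
lemma selectors_AE_subset:
  fixes X :: "'w \<Rightarrow> 'v::euclidean_space set"
  assumes M: "finite_measure M" and G: "subalgebra M G" and X: "set_measurable G X"
    and ne: "selectors p M G X \<noteq> {}" and C: "\<And>\<omega>. \<omega> \<in> space M \<Longrightarrow> closed (C \<omega>)"
    and sel: "\<And>w. w \<in> selectors p M G X \<Longrightarrow> AE \<omega> in M. w \<omega> \<in> C \<omega>"
  shows "AE \<omega> in M. X \<omega> \<subseteq> C \<omega>"
proof -
  interpret finite_measure M by (rule M)
  have sp: "space G = space M" using G by (simp add: subalgebra_def)
  obtain w0 where w0: "w0 \<in> selectors p M G X" using ne by blast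
  obtain w :: "nat \<Rightarrow> 'w \<Rightarrow> 'v" where w: "\<And>k. w k \<in> borel_measurable G" "\<And>k \<omega>. \<omega> \<in> space G \<Longrightarrow> w k \<omega> \<in> X \<omega>"
    "\<And>\<omega>. \<omega> \<in> space G \<Longrightarrow> X \<omega> = closure (range (\<lambda>k. w k \<omega>))" by (rule castaing[OF X]) blast
  note [measurable] = w(1)
  define D where "D k n = {\<omega> \<in> space G. norm (w k \<omega>) \<le> real n}" for k n
  have D: "D k n \<in> sets G" for k n unfolding D_def by measurable
  define v where "v k n \<omega> = (if \<omega> \<in> D k n then w k \<omega> else w0 \<omega>)" for k n \<omega>
  have "v k n \<in> selectors p M G X" for k n
  proof -
    have "(\<lambda>\<omega>. if \<omega> \<in> D k n then w k \<omega> else 0) \<in> vec_Lp p M G"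
    proof -
      have "(\<lambda>\<omega>. if \<omega> \<in> D k n then w k \<omega> else 0) \<in> borel_measurable G"
        using measurable_If_set[OF w(1)[of k] borel_measurable_const[of 0], of "D k n"] D by simp
      moreover have "(\<integral>\<^sup>+\<omega>. ennreal (norm (if \<omega> \<in> D k n then w k \<omega> else 0)) ^ p \<partial>M) \<le> (\<integral>\<^sup>+\<omega>. ennreal (real n) ^ p \<partial>M)"
        by (intro nn_integral_mono power_mono) (auto simp: D_def intro: ennreal_leI)
      moreover have "(\<integral>\<^sup>+\<omega>. ennreal (real n) ^ p \<partial>M) < \<infinity>"
        by (simp add: ennreal_mult_eq_top_iff ennreal_power less_top[symmetric])
      ultimately show ?thesis unfolding vec_Lp_def by (auto dest: le_less_trans)
    qed
    from vec_Lp_If[OF G D this selectorsD(1)[OF w0]]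
    have "(\<lambda>\<omega>. if \<omega> \<in> D k n then if \<omega> \<in> D k n then w k \<omega> else 0 else w0 \<omega>) \<in> vec_Lp p M G" .
    also have "(\<lambda>\<omega>. if \<omega> \<in> D k n then if \<omega> \<in> D k n then w k \<omega> else 0 else w0 \<omega>) = v k n"
      by (auto simp: v_def)
    finally have "v k n \<in> vec_Lp p M G" .
    moreover have "AE \<omega> in M. v k n \<omega> \<in> X \<omega>"
      using selectorsD(2)[OF w0] by eventually_elim (auto simp: v_def D_def w(2))
    ultimately show ?thesis by (simp add: selectors_def)
  qed
  then have "AE \<omega> in M. \<forall>k n. v k n \<omega> \<in> C \<omega>"
    using sel by (simp add: AE_all_countable)
  then show ?thesis using AE_space
  proof eventually_elim
    case (elim \<omega>)
    then have sG: "\<omega> \<in> space G" by (simp add: sp)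
    have "w k \<omega> \<in> C \<omega>" for k
    proof -
      obtain n :: nat where "norm (w k \<omega>) \<le> n" using real_arch_simple by blast
      then have "v k n \<omega> = w k \<omega>" using sG by (simp add: v_def D_def)
      then show ?thesis using elim(1) by metis
    qed
    then show ?case unfolding w(3)[OF sG] using elim(2) by (intro closure_minimal C) auto
  qed
qed

text \<open>The existence part of the Hiai--Umegaki theorem. For each \<open>q\<close> a countable subset of \<open>W\<close>
  attains the essential infimum of the distances to \<open>q\<close>; the representing map is the pointwise closure
  of the union of these subsets over a dense set of points \<open>q\<close>.\<close>
lemma decomposable_eq_selectors:
  fixes W :: "('w \<Rightarrow> 'v::euclidean_space) set"
  assumes M: "prob_space M" and G: "subalgebra M G" and p: "0 < p" and ne: "W \<noteq> {}" and W: "W \<subseteq> vec_Lp p M G"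
    and cl: "Lp_closure p M G W \<subseteq> W" and dec: "decomposable G W"
  obtains X where "set_measurable G X" "selectors p M G X = W"
proof -
  interpret prob_space M by (rule M)
  have sp: "space G = space M" using G by (simp add: subalgebra_def)
  have W_meas: "w \<in> borel_measurable M" if "w \<in> W" for w using vec_Lp_measurable[OF G] W that by blast
  \<comment> \<open>Truncation at 1 makes the integrals of all these distances finite, so that they
    may be subtracted.\<close>
  define d where "d q w \<omega> = ennreal (min 1 (dist q (w \<omega>)))" for q :: 'v and w :: "'w \<Rightarrow> 'v" and \<omega>
  have d_meas: "d q w \<in> borel_measurable M" if "w \<in> W" for q w
    using W_meas[OF that] unfolding d_def by measurable
  define \<S> where "\<S> = {S. countable S \<and> S \<noteq> {} \<and> S \<subseteq> W}"
  define \<Phi> where "\<Phi> q S = (\<integral>\<^sup>+\<omega>. (INF w\<in>S. d q w \<omega>) \<partial>M)" for q S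
  have "\<exists>S\<in>\<S>. \<forall>S'\<in>\<S>. \<Phi> q S \<le> \<Phi> q S'" for q
  proof -
    obtain w where "w \<in> W" using ne by blast
    then have "{w} \<in> \<S>" by (auto simp: \<S>_def)
    then have "\<Phi> q ` \<S> \<noteq> {}" by blast
    \<comment> \<open>A union of countably many countable families is countable, so a minimising
      sequence of families yields a minimiser.\<close>
    from ennreal_Inf_countable_INF[OF this] obtain f :: "nat \<Rightarrow> ennreal"
      where f: "range f \<subseteq> \<Phi> q ` \<S>" "Inf (\<Phi> q ` \<S>) = (INF i. f i)" by blast
    have "\<exists>S\<in>\<S>. f i = \<Phi> q S" for i using f(1) by blast
    then obtain S where S: "\<And>i. S i \<in> \<S>" "\<And>i. f i = \<Phi> q (S i)" by metis
    have "(\<Union>i. S i) \<in> \<S>" using S(1) by (auto simp: \<S>_def)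
    moreover have "\<Phi> q (\<Union>i. S i) \<le> \<Phi> q S'" if "S' \<in> \<S>" for S'
    proof -
      have "\<Phi> q (\<Union>i. S i) \<le> f i" for i
        unfolding S(2) \<Phi>_def by (intro nn_integral_mono INF_superset_mono) auto
      then have "\<Phi> q (\<Union>i. S i) \<le> Inf (\<Phi> q ` \<S>)" unfolding f(2) by (rule INF_greatest)
      also have "\<dots> \<le> \<Phi> q S'" using that by (rule INF_lower)
      finally show ?thesis .
    qed
    ultimately show ?thesis by blast
  qed
  then obtain S where S: "\<And>q. S q \<in> \<S>" "\<And>q S'. S' \<in> \<S> \<Longrightarrow> \<Phi> q (S q) \<le> \<Phi> q S'" by metis
  have S': "countable (S q)" "S q \<noteq> {}" "S q \<subseteq> W" for q using S(1)[of q] by (auto simp: \<S>_def)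
  have inf: "AE \<omega> in M. (INF v\<in>S q. d q v \<omega>) \<le> d q w \<omega>" if w: "w \<in> W" for q w
  proof -
    let ?g = "\<lambda>\<omega>. INF v\<in>S q. d q v \<omega>" and ?h = "\<lambda>\<omega>. INF v\<in>insert w (S q). d q v \<omega>"
    have gm [measurable]: "?g \<in> borel_measurable M"
      using S'[of q] by (intro borel_measurable_INF d_meas) auto
    have hm [measurable]: "?h \<in> borel_measurable M"
      using S'[of q] w by (intro borel_measurable_INF d_meas) auto
    have hg: "?h \<omega> \<le> ?g \<omega>" for \<omega> by (intro INF_superset_mono) auto
    have "?h \<omega> \<le> 1" for \<omega>
    proof -
      have "?h \<omega> \<le> d q w \<omega>" by (rule INF_lower) simp
      also have "\<dots> \<le> ennreal 1" unfolding d_def by (intro ennreal_leI) simp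
      finally show ?thesis by simp
    qed
    then have "(\<integral>\<^sup>+\<omega>. ?h \<omega> \<partial>M) \<le> (\<integral>\<^sup>+\<omega>. 1 \<partial>M)" by (intro nn_integral_mono)
    then have fin: "(\<integral>\<^sup>+\<omega>. ?h \<omega> \<partial>M) < \<infinity>" by (auto simp: emeasure_space_1 intro: le_less_trans)
    \<comment> \<open>Enlarging the optimal family by w cannot lower the integral, so the infimum
      was already below the distance to w almost surely.\<close>
    have "insert w (S q) \<in> \<S>" using S'[of q] w by (auto simp: \<S>_def)
    from S(2)[OF this, of q] have le: "(\<integral>\<^sup>+\<omega>. ?g \<omega> \<partial>M) \<le> (\<integral>\<^sup>+\<omega>. ?h \<omega> \<partial>M)" unfolding \<Phi>_def .
    have "(\<integral>\<^sup>+\<omega>. ?g \<omega> - ?h \<omega> \<partial>M) = (\<integral>\<^sup>+\<omega>. ?g \<omega> \<partial>M) - (\<integral>\<^sup>+\<omega>. ?h \<omega> \<partial>M)"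
      using fin hg by (intro nn_integral_diff gm hm) (simp_all only: infinity_ennreal_def less_top AE_I2)
    also have "\<dots> = 0" using le le_less_trans[OF le fin] by (simp add: diff_eq_0_iff_ennreal)
    finally have "AE \<omega> in M. ?g \<omega> - ?h \<omega> = 0"
      using nn_integral_0_iff_AE[OF borel_measurable_minus_ennreal[OF gm hm]] by blast
    then show ?thesis
    proof eventually_elim
      case (elim \<omega>)
      then have "?g \<omega> \<le> ?h \<omega>" by (simp only: diff_eq_0_iff_ennreal)
      also have "\<dots> \<le> d q w \<omega>" by (rule INF_lower) simp
      finally show ?case .
    qed
  qed
  define A where "A = (\<Union>q\<in>dirs. S q)"
  have A: "countable A" "A \<subseteq> W" "A \<noteq> {}" unfolding A_def using S' by auto
  define w where "w = from_nat_into A"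
  have wW: "w k \<in> W" for k using from_nat_into[OF A(3)] A(2) unfolding w_def by blast
  have w_surj: "\<exists>k. w k = v" if "v \<in> S q" "q \<in> dirs" for v q
    unfolding w_def using that by (intro from_nat_into_surj A(1)) (auto simp: A_def)
  have wG: "w k \<in> borel_measurable G" for k using wW W vec_LpD(1) by blast
  define X where "X \<omega> = closure (range (\<lambda>k. w k \<omega>))" for \<omega>
  have X: "set_measurable G X" unfolding X_def by (rule set_measurable_closure_range[OF wG])
  have "selectors p M G X = W"
  proof
    show "W \<subseteq> selectors p M G X"
    proof
      fix u assume u: "u \<in> W"
      have "AE \<omega> in M. \<forall>q\<in>dirs. (INF v\<in>S q. d q v \<omega>) \<le> d q u \<omega>"
        using inf[OF u] by (simp add: AE_ball_countable)
      then have "AE \<omega> in M. u \<omega> \<in> X \<omega>"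
      proof eventually_elim
        case (elim \<omega>)
        have "\<exists>k. dist (w k \<omega>) (u \<omega>) < e" if e: "0 < e" for e
        proof -
          \<comment> \<open>A value below 1 keeps the truncation in d inactive, and twice b is at
            most e, as the triangle inequality requires.\<close>
          define b where "b = min (e/2) (1/2)"
          have b: "0 < b" "b < 1" using e by (auto simp: b_def)
          have "u \<omega> \<in> closure dirs" by simp
          then obtain q where q: "q \<in> dirs" "dist q (u \<omega>) < b" unfolding closure_approachable using b by blast
          have "(INF v\<in>S q. d q v \<omega>) \<le> d q u \<omega>" using elim q(1) by blast
          also have "\<dots> < ennreal b" unfolding d_def using q b by (intro ennreal_lessI) auto
          finally obtain v where v: "v \<in> S q" "d q v \<omega> < ennreal b" unfolding INF_less_iff by blast
          then have "dist q (v \<omega>) < b" using b by (auto simp: d_def ennreal_less_iff)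
          then have "dist (v \<omega>) (u \<omega>) < b + b" using q(2) dist_triangle[of "v \<omega>" "u \<omega>" q] by (simp add: dist_commute)
          also have "\<dots> \<le> e" by (simp add: b_def)
          finally show ?thesis using w_surj[OF v(1) q(1)] by blast
        qed
        then show ?case unfolding X_def closure_approachable by blast
      qed
      then show "u \<in> selectors p M G X" using u W by (auto simp: selectors_def)
    qed
    show "selectors p M G X \<subseteq> W"
    proof
      fix u assume u: "u \<in> selectors p M G X"
      note uL = selectorsD(1)[OF u]
      have uG [measurable]: "u \<in> borel_measurable G" using vec_LpD(1)[OF uL] .
      have uM [measurable]: "u \<in> borel_measurable M" using vec_Lp_measurable[OF G uL] .
      have wM [measurable]: "w k \<in> borel_measurable M" for k using W_meas[OF wW] .
      note [measurable] = wG
      have "u \<in> Lp_closure p M G W"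
      proof (rule Lp_closureI[OF uL])
        fix e :: real assume e: "0 < e"
        \<comment> \<open>Since c is at most 1 and p is positive, c^p is at most c, hence at most
          e/2.\<close>
        define c where "c = min 1 (e/2)"
        have c: "0 < c" "c \<le> 1" "c \<le> e/2" using e by (auto simp: c_def)
        define D where "D n = {\<omega>\<in>space G. dist (w n \<omega>) (u \<omega>) < c}" for n
        have D: "D n \<in> sets G" for n unfolding D_def by measurable
        \<comment> \<open>Paste \<open>w n\<close> on \<open>D n\<close> over the previous function.
          Decomposability keeps every stage in W, and \<open>v n\<close> is within c of u wherever
          one of the first n events occurs.\<close>
        define v where "v = rec_nat (w 0) (\<lambda>n f \<omega>. if \<omega> \<in> D n then w n \<omega> else f \<omega>)"
        have v_0: "v 0 = w 0" by (simp add: v_def)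
        have v_Suc: "v (Suc n) = (\<lambda>\<omega>. if \<omega> \<in> D n then w n \<omega> else v n \<omega>)" for n
          by (simp add: v_def cong: if_cong)
        have vW: "v n \<in> W" for n
        proof (induction n)
          case (Suc n) then show ?case unfolding v_Suc using dec wW D by (simp add: decomposable_def)
        qed (simp add: v_0 wW)
        have v_near: "if \<exists>k<n. \<omega> \<in> D k then dist (v n \<omega>) (u \<omega>) < c else v n \<omega> = w 0 \<omega>" for n \<omega>
        proof (induction n)
          case (Suc n)
          show ?case
          proof (cases "\<omega> \<in> D n")
            case True then show ?thesis by (auto simp: v_Suc D_def)
          next
            case False
            then have "(\<exists>k<Suc n. \<omega> \<in> D k) \<longleftrightarrow> (\<exists>k<n. \<omega> \<in> D k)" using less_Suc_eq by auto
            then show ?thesis using Suc False by (simp add: v_Suc)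
          qed
        qed (simp add: v_0)
        \<comment> \<open>The remaining error, on the points reached by none of the first n events.
          Dominated convergence sends its integral to 0 because the points
          \<open>w k \<omega>\<close> are dense in \<open>X \<omega>\<close>.\<close>
        define h where "h n \<omega> = (if \<exists>k<n. \<omega> \<in> D k then 0 else ennreal (norm (u \<omega> - w 0 \<omega>)) ^ p)" for n \<omega>
        have [measurable]: "D n \<in> sets M" for n using D G by (auto simp: subalgebra_def)
        have h_meas [measurable]: "h n \<in> borel_measurable M" for n unfolding h_def by measurable
        have "(\<lambda>n. \<integral>\<^sup>+\<omega>. h n \<omega> \<partial>M) \<longlonglongrightarrow> (\<integral>\<^sup>+\<omega>. 0 \<partial>M)"
        proof (rule nn_integral_dominated_convergence[where w = "\<lambda>\<omega>. ennreal (norm (u \<omega> - w 0 \<omega>)) ^ p"])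
          show "AE \<omega> in M. h j \<omega> \<le> ennreal (norm (u \<omega> - w 0 \<omega>)) ^ p" for j
            by (simp add: h_def)
          have "Lp_dist p M u (w 0) \<le> 2 ^ p * ((\<integral>\<^sup>+\<omega>. ennreal (norm (u \<omega> - 0)) ^ p \<partial>M) +
              (\<integral>\<^sup>+\<omega>. ennreal (norm (0 - w 0 \<omega>)) ^ p \<partial>M))"
            by (rule Lp_triangle[OF uM borel_measurable_const wM])
          also have "\<dots> < \<infinity>"
            using vec_LpD(2)[OF uL] vec_LpD(2)[OF subsetD[OF W wW[of 0]]]
            by (simp add: ennreal_mult_less_top power_less_top_ennreal)
          finally show "Lp_dist p M u (w 0) < \<infinity>" .
          show "AE \<omega> in M. (\<lambda>n. h n \<omega>) \<longlonglongrightarrow> 0"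
            using selectorsD(2)[OF u] AE_space
          proof eventually_elim
            case (elim \<omega>)
            then obtain k where "dist (w k \<omega>) (u \<omega>) < c"
              unfolding X_def closure_approachable using c by auto
            then have k: "\<omega> \<in> D k" using elim(2) by (simp add: D_def sp)
            show ?case
            proof (rule tendsto_eventually, unfold eventually_sequentially, intro exI allI impI)
              fix n assume "Suc k \<le> n"
              then show "h n \<omega> = 0" using k unfolding h_def by auto
            qed
          qed
        qed measurable
        then have "\<forall>\<^sub>F n in sequentially. (\<integral>\<^sup>+\<omega>. h n \<omega> \<partial>M) < ennreal (e/2)"
          using e by (intro order_tendstoD(2)) auto
        then obtain n where n: "(\<integral>\<^sup>+\<omega>. h n \<omega> \<partial>M) < ennreal (e/2)"
          unfolding eventually_sequentially by blast
        have "Lp_dist p M u (v n) \<le> (\<integral>\<^sup>+\<omega>. ennreal (e/2) + h n \<omega> \<partial>M)"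
        proof (rule nn_integral_mono)
          fix \<omega>
          show "ennreal (norm (u \<omega> - v n \<omega>)) ^ p \<le> ennreal (e/2) + h n \<omega>"
          proof (cases "\<exists>k<n. \<omega> \<in> D k")
            case True
            then have "norm (u \<omega> - v n \<omega>) \<le> c" using v_near[of n \<omega>] by (simp add: dist_norm norm_minus_commute)
            then have "norm (u \<omega> - v n \<omega>) ^ p \<le> c ^ p" by (intro power_mono) auto
            also have "\<dots> \<le> c ^ 1" using c p by (intro power_decreasing) auto
            finally have "ennreal (norm (u \<omega> - v n \<omega>) ^ p) \<le> ennreal (e/2)" using c by (intro ennreal_leI) simp
            then show ?thesis by (simp add: ennreal_power add_increasing2)
          next
            case False
            then have "v n \<omega> = w 0 \<omega>" "h n \<omega> = ennreal (norm (u \<omega> - w 0 \<omega>)) ^ p"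
              using v_near[of n \<omega>] by (auto simp: h_def split: if_splits)
            then show ?thesis by (simp add: add_increasing)
          qed
        qed
        also have "\<dots> = ennreal (e/2) + (\<integral>\<^sup>+\<omega>. h n \<omega> \<partial>M)"
          by (subst nn_integral_add) (simp_all add: emeasure_space_1)
        also have "\<dots> \<le> ennreal (e/2) + ennreal (e/2)" using n by (intro add_left_mono) simp
        also have "\<dots> = ennreal e" using e by (subst ennreal_plus[symmetric]) auto
        finally show "\<exists>v\<in>W. Lp_dist p M u v \<le> ennreal e" using vW by blast
      qed
      then show "u \<in> W" using cl by blast
    qed
  qed
  with X show ?thesis by (rule that)
qed

subsection \<open>Essential hulls\<close>

text \<open>Time integrals and conditional expectations are used only through this minimality property.\<close>
definition ess_hull :: "'w measure \<Rightarrow> ('w \<Rightarrow> 'v::euclidean_space) set \<Rightarrow> ('w \<Rightarrow> 'v set) \<Rightarrow> bool" where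
  "ess_hull M V X \<longleftrightarrow> V \<noteq> {} \<and> (\<forall>v\<in>V. AE \<omega> in M. v \<omega> \<in> X \<omega>) \<and>
     (\<forall>C. (\<forall>\<omega>\<in>space M. closed (C \<omega>)) \<longrightarrow> (\<forall>v\<in>V. AE \<omega> in M. v \<omega> \<in> C \<omega>) \<longrightarrow> (AE \<omega> in M. X \<omega> \<subseteq> C \<omega>))"

lemma ess_hullD:
  assumes "ess_hull M V X"
  shows "V \<noteq> {}" "v \<in> V \<Longrightarrow> AE \<omega> in M. v \<omega> \<in> X \<omega>"
  using assms by (auto simp: ess_hull_def)

lemma ess_hull_subset:
  assumes "ess_hull M V X" "\<And>\<omega>. \<omega> \<in> space M \<Longrightarrow> closed (C \<omega>)" "\<And>v. v \<in> V \<Longrightarrow> AE \<omega> in M. v \<omega> \<in> C \<omega>"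
  shows "AE \<omega> in M. X \<omega> \<subseteq> C \<omega>"
proof -
  have "(\<forall>\<omega>\<in>space M. closed (C \<omega>)) \<longrightarrow> (\<forall>v\<in>V. AE \<omega> in M. v \<omega> \<in> C \<omega>) \<longrightarrow> (AE \<omega> in M. X \<omega> \<subseteq> C \<omega>)"
    using assms(1) unfolding ess_hull_def by blast
  then show ?thesis using assms(2,3) by blast
qed

text \<open>By \<open>selectors_AE_subset\<close>, an inclusion between sets of selectors is an
  almost sure inclusion between the random sets.\<close>

lemma ess_hullI:
  fixes X :: "'w \<Rightarrow> 'v::euclidean_space set"
  assumes M: "finite_measure M" and G: "subalgebra M G" and X: "set_measurable G X"
    and V: "V \<noteq> {}" "V \<subseteq> vec_Lp p M G" "V \<subseteq> selectors p M G X"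
    and min: "\<And>C. (\<And>\<omega>. \<omega> \<in> space M \<Longrightarrow> closed (C \<omega>)) \<Longrightarrow> V \<subseteq> selectors p M G C \<Longrightarrow> selectors p M G X \<subseteq> selectors p M G C"
  shows "ess_hull M V X"
  unfolding ess_hull_def
proof (intro conjI ballI allI impI)
  show "V \<noteq> {}" by (rule V)
  show "AE \<omega> in M. v \<omega> \<in> X \<omega>" if "v \<in> V" for v using V(3) that selectorsD(2) by blast
  fix C assume C: "\<forall>\<omega>\<in>space M. closed (C \<omega>)" "\<forall>v\<in>V. AE \<omega> in M. v \<omega> \<in> C \<omega>"
  then have "V \<subseteq> selectors p M G C" using V(2) unfolding selectors_def by blast
  then have sub: "selectors p M G X \<subseteq> selectors p M G C" using C(1) by (intro min) auto
  have ne: "selectors p M G X \<noteq> {}" using V by blast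
  show "AE \<omega> in M. X \<omega> \<subseteq> C \<omega>"
    by (rule selectors_AE_subset[OF M G X ne]) (use C sub selectorsD(2) in blast)+
qed

text \<open>Minimality is applied twice: for fixed v to the points whose midpoint with v lies in X,
  then to the points whose midpoints with all of X lie in X. This absorbs the null sets belonging to
  the members of V, of which there may be uncountably many.\<close>

lemma ess_hull_convex:
  fixes X :: "'w \<Rightarrow> 'v::euclidean_space set"
  assumes X: "ess_hull M V X" and cl: "\<And>\<omega>. \<omega> \<in> space M \<Longrightarrow> closed (X \<omega>)"
    and mid: "\<And>v w. v \<in> V \<Longrightarrow> w \<in> V \<Longrightarrow> AE \<omega> in M. midpoint (v \<omega>) (w \<omega>) \<in> X \<omega>"
  shows "AE \<omega> in M. convex (X \<omega>)"
proof -
  have cont: "continuous_on UNIV (\<lambda>x. midpoint x y)" for y :: 'v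
    unfolding midpoint_def by (intro continuous_intros)
  have closed_mid: "closed {x. midpoint x y \<in> X \<omega>}" if "\<omega> \<in> space M" for y \<omega>
    using continuous_closed_vimage[OF cl[OF that], of "\<lambda>x. midpoint x y"] cont[of y] unfolding vimage_def
    by (simp add: continuous_on_eq_continuous_at)
  have 1: "AE \<omega> in M. \<forall>x\<in>X \<omega>. midpoint x (v \<omega>) \<in> X \<omega>" if v: "v \<in> V" for v
  proof -
    have "AE \<omega> in M. X \<omega> \<subseteq> {x. midpoint x (v \<omega>) \<in> X \<omega>}"
      by (rule ess_hull_subset[OF X]) (use closed_mid mid v in auto)
    then show ?thesis by eventually_elim auto
  qed
  have "AE \<omega> in M. X \<omega> \<subseteq> {y. \<forall>x\<in>X \<omega>. midpoint x y \<in> X \<omega>}"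
  proof (rule ess_hull_subset[OF X])
    fix \<omega> assume "\<omega> \<in> space M"
    then have "closed (\<Inter>x\<in>X \<omega>. {y. midpoint y x \<in> X \<omega>})" using closed_mid by blast
    also have "(\<Inter>x\<in>X \<omega>. {y. midpoint y x \<in> X \<omega>}) = {y. \<forall>x\<in>X \<omega>. midpoint x y \<in> X \<omega>}"
      by (auto simp: midpoint_sym)
    finally show "closed {y. \<forall>x\<in>X \<omega>. midpoint x y \<in> X \<omega>}" .
  qed (use 1 in simp)
  then show ?thesis using AE_space
  proof eventually_elim
    case (elim \<omega>)
    then show ?case using cl by (intro convex_midpoint_closed) auto
  qed
qed

subsection \<open>The progressive sigma-algebra\<close>

locale filtration = prob_space M for M :: "'w measure" +
  fixes F :: "real \<Rightarrow> 'w measure" and T :: real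
  assumes T_pos: "0 < T"
    and subalg: "\<And>t. t \<in> {0..T} \<Longrightarrow> subalgebra M (F t)"
    and F_mono: "\<And>s t. s \<in> {0..T} \<Longrightarrow> t \<in> {0..T} \<Longrightarrow> s \<le> t \<Longrightarrow> sets (F s) \<subseteq> sets (F t)"
begin

lemma space_F: "t \<in> {0..T} \<Longrightarrow> space (F t) = space M"
  using subalg by (simp add: subalgebra_def)

lemma measurable_F_M: "t \<in> {0..T} \<Longrightarrow> g \<in> measurable (F t) N \<Longrightarrow> g \<in> measurable M N"
  using subalg measurable_from_subalg by blast

lemma measurable_F_mono:
  assumes "s \<in> {0..T}" "t \<in> {0..T}" "s \<le> t" "g \<in> measurable (F s) N"
  shows "g \<in> measurable (F t) N"
proof -
  have "subalgebra (F t) (F s)" using F_mono assms space_F by (simp add: subalgebra_def)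
  then show ?thesis using assms(4) by (rule measurable_from_subalg)
qed

lemma space_prog_space: "t \<in> {0..T} \<Longrightarrow> space (prog_space F t) = {0..t} \<times> space M"
  by (simp add: space_pair_measure space_restrict_space space_F)

text \<open>With this single sigma-algebra on [0,T] x \<Omega>, progressive measurability becomes
  ordinary measurability, and every result on measurable set-valued maps applies to
  processes.\<close>

definition prog :: "(real \<times> 'w) measure" where
  "prog = sigma ({0..T} \<times> space M)
     {A. A \<subseteq> {0..T} \<times> space M \<and> (\<forall>t\<in>{0..T}. A \<inter> ({0..t} \<times> space M) \<in> sets (prog_space F t))}"

lemma space_prog: "space prog = {0..T} \<times> space M"
  unfolding prog_def by (rule space_measure_of) auto

lemma sets_prog: "sets prog =
  {A. A \<subseteq> {0..T} \<times> space M \<and> (\<forall>t\<in>{0..T}. A \<inter> ({0..t} \<times> space M) \<in> sets (prog_space F t))}"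
proof -
  let ?\<A> = "{A. A \<subseteq> {0..T} \<times> space M \<and> (\<forall>t\<in>{0..T}. A \<inter> ({0..t} \<times> space M) \<in> sets (prog_space F t))}"
  have "sigma_algebra ({0..T} \<times> space M) ?\<A>"
    unfolding sigma_algebra_iff2
  proof (intro conjI ballI allI impI)
    fix A assume A: "A \<in> ?\<A>"
    have "({0..T} \<times> space M - A) \<inter> ({0..t} \<times> space M) \<in> sets (prog_space F t)" if t: "t \<in> {0..T}" for t
    proof -
      have "({0..T} \<times> space M - A) \<inter> ({0..t} \<times> space M) = space (prog_space F t) - A \<inter> ({0..t} \<times> space M)"
        using t by (auto simp: space_prog_space)
      then show ?thesis using A t by (simp only:) (intro sets.compl_sets, simp)
    qed
    then show "{0..T} \<times> space M - A \<in> ?\<A>" by blast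
  next
    fix A :: "nat \<Rightarrow> (real \<times> 'w) set" assume A: "range A \<subseteq> ?\<A>"
    have "(\<Union>i. A i) \<inter> ({0..t} \<times> space M) \<in> sets (prog_space F t)" if t: "t \<in> {0..T}" for t
    proof -
      have "(\<Union>i. A i) \<inter> ({0..t} \<times> space M) = (\<Union>i. A i \<inter> ({0..t} \<times> space M))" by blast
      also have "\<dots> \<in> sets (prog_space F t)"
      proof (rule sets.countable_UN'')
        fix i have "A i \<in> ?\<A>" using A by blast
        then show "A i \<inter> ({0..t} \<times> space M) \<in> sets (prog_space F t)" using t by blast
      qed simp
      finally show ?thesis .
    qed
    then show "(\<Union>i. A i) \<in> ?\<A>" using A by blast
  qed auto
  then show ?thesis unfolding prog_def by (subst sigma_algebra.sets_measure_of_eq) auto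
qed

lemma measurable_prog_iff: "g \<in> measurable prog N \<longleftrightarrow> (\<forall>t\<in>{0..T}. g \<in> measurable (prog_space F t) N)"
proof safe
  fix t assume g: "g \<in> measurable prog N" and t: "t \<in> {0..T}"
  show "g \<in> measurable (prog_space F t) N"
  proof (rule measurableI)
    show "g x \<in> space N" if "x \<in> space (prog_space F t)" for x
      using measurable_space[OF g, of x] that t by (auto simp: space_prog space_prog_space)
    fix B assume "B \<in> sets N"
    from measurable_sets[OF g this] have "(g -` B \<inter> space prog) \<inter> ({0..t} \<times> space M) \<in> sets (prog_space F t)"
      using t unfolding sets_prog by blast
    also have "(g -` B \<inter> space prog) \<inter> ({0..t} \<times> space M) = g -` B \<inter> space (prog_space F t)"
      using t by (auto simp: space_prog space_prog_space)
    finally show "g -` B \<inter> space (prog_space F t) \<in> sets (prog_space F t)" .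
  qed
next
  assume g: "\<forall>t\<in>{0..T}. g \<in> measurable (prog_space F t) N"
  have T: "T \<in> {0..T}" using T_pos by simp
  show "g \<in> measurable prog N"
  proof (rule measurableI)
    show "g x \<in> space N" if "x \<in> space prog" for x
      using measurable_space[OF bspec[OF g T], of x] that T by (simp only: space_prog space_prog_space)
    fix B assume B: "B \<in> sets N"
    have "(g -` B \<inter> space prog) \<inter> ({0..t} \<times> space M) \<in> sets (prog_space F t)" if t: "t \<in> {0..T}" for t
    proof -
      have "(g -` B \<inter> space prog) \<inter> ({0..t} \<times> space M) = g -` B \<inter> space (prog_space F t)"
        using t by (auto simp: space_prog space_prog_space)
      then show ?thesis using measurable_sets[OF bspec[OF g t] B] by simp
    qed
    then show "g -` B \<inter> space prog \<in> sets prog" unfolding sets_prog by (auto simp: space_prog)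
  qed
qed

lemma prog_compose:
  assumes "case_prod g \<in> measurable prog N" "h \<in> measurable N L"
  shows "case_prod (\<lambda>s \<omega>. h (g s \<omega>)) \<in> measurable prog L"
  using measurable_compose[OF assms] by (simp add: case_prod_unfold)

lemma progressive_iff: "progressive F T \<phi> \<longleftrightarrow> case_prod \<phi> \<in> borel_measurable prog"
  unfolding progressive_def measurable_prog_iff ..

text \<open>Measurability is transferred through the real functions \<open>infdist q\<close>, for
  which \<open>measurable_prog_iff\<close> is available; closed nonempty values are read off at t =
  T.\<close>

lemma set_progressive_iff:
  fixes \<Phi> :: "real \<Rightarrow> 'w \<Rightarrow> 'v::euclidean_space set"
  shows "set_progressive F T \<Phi> \<longleftrightarrow> set_measurable prog (case_prod \<Phi>)"
proof
  assume \<Phi>: "set_measurable prog (case_prod \<Phi>)"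
  have "(\<lambda>x. x) \<in> measurable (prog_space F t) prog" if "t \<in> {0..T}" for t
    using measurable_prog_iff[of "\<lambda>x. x" prog] measurable_ident[of prog] that by (simp add: id_def)
  then show "set_progressive F T \<Phi>" unfolding set_progressive_def using set_measurable_compose[OF _ \<Phi>] by blast
next
  assume \<Phi>: "set_progressive F T \<Phi>"
  show "set_measurable prog (case_prod \<Phi>)"
  proof (rule set_measurableI_infdist)
    fix e assume "e \<in> space prog"
    then have "e \<in> space (prog_space F T)" using T_pos by (simp add: space_prog space_prog_space)
    moreover have "set_measurable (prog_space F T) (case_prod \<Phi>)" using \<Phi> T_pos by (simp add: set_progressive_def)
    ultimately show "closed (case_prod \<Phi> e)" "case_prod \<Phi> e \<noteq> {}"
      using set_measurableD[of "prog_space F T" "case_prod \<Phi>" e] by simp_all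
  next
    show "(\<lambda>e. infdist q (case_prod \<Phi> e)) \<in> borel_measurable prog" for q
      unfolding measurable_prog_iff using \<Phi> set_measurable_infdist by (auto simp: set_progressive_def)
  qed
qed

lemma prog_section:
  assumes g: "case_prod g \<in> measurable prog N" and t: "t \<in> {0..T}"
  shows "g t \<in> measurable (F t) N"
proof -
  have "(\<lambda>\<omega>. (t, \<omega>)) \<in> measurable (F t) (prog_space F t)"
    using t by (intro measurable_Pair measurable_const measurable_ident_sets) (auto simp: space_restrict_space)
  from measurable_compose[OF this, of "case_prod g" N] g t show ?thesis by (simp add: measurable_prog_iff)
qed

lemma set_prog_section:
  assumes "set_measurable prog (case_prod \<Phi>)" and t: "t \<in> {0..T}"
  shows "set_measurable (F t) (\<Phi> t :: 'w \<Rightarrow> 'v::euclidean_space set)"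
proof -
  have "case_prod Pair \<in> measurable prog prog" using measurable_ident[of prog] by (simp add: id_def case_prod_eta)
  from prog_section[OF this t] have "(\<lambda>\<omega>. (t, \<omega>)) \<in> measurable (F t) prog" .
  from set_measurable_compose[OF this assms(1)] show ?thesis by simp
qed

text \<open>\<open>prog\<close> is not a product, so parameter integrals and Fubini need a
  product-measurable extension. Clamping time to [0,u] maps into \<open>prog_space F u\<close>;
  afterwards the values outside [0,u] are reset to the constant c.\<close>

lemma prog_If:
  assumes g: "case_prod g \<in> measurable prog N" and u: "u \<in> {0..T}" and c: "c \<in> space N"
  shows "(\<lambda>(\<omega>, s). if s \<in> {0..u} then g s \<omega> else c) \<in> measurable (F u \<Otimes>\<^sub>M lborel) N"
proof -
  have "(\<lambda>(\<omega>, s). (max 0 (min s u), \<omega>)) \<in> measurable (F u \<Otimes>\<^sub>M lborel) (prog_space F u)"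
    unfolding case_prod_beta
    using u by (intro measurable_Pair measurable_restrict_space2) auto
  moreover have "case_prod g \<in> measurable (prog_space F u) N" using g u by (simp add: measurable_prog_iff)
  ultimately have "(\<lambda>x. case_prod g ((\<lambda>(\<omega>, s). (max 0 (min s u), \<omega>)) x)) \<in> measurable (F u \<Otimes>\<^sub>M lborel) N"
    by (rule measurable_compose)
  then have [measurable]: "(\<lambda>(\<omega>, s). g (max 0 (min s u)) \<omega>) \<in> measurable (F u \<Otimes>\<^sub>M lborel) N"
    by (simp add: case_prod_beta)
  have "(\<lambda>(\<omega>, s). if s \<in> {0..u} then g (max 0 (min s u)) \<omega> else c) \<in> measurable (F u \<Otimes>\<^sub>M lborel) N"
    using c by measurable
  also have "(\<lambda>(\<omega>, s). if s \<in> {0..u} then g (max 0 (min s u)) \<omega> else c) = (\<lambda>(\<omega>, s). if s \<in> {0..u} then g s \<omega> else c)"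
    by (auto simp: fun_eq_iff)
  finally show ?thesis .
qed

lemma prog_If_M:
  assumes g: "case_prod g \<in> measurable prog N" and c: "c \<in> space N"
  shows "(\<lambda>(\<omega>, s). if s \<in> {0..T} then g s \<omega> else c) \<in> measurable (M \<Otimes>\<^sub>M lborel) N"
proof -
  have T: "T \<in> {0..T}" using T_pos by simp
  have "(\<lambda>x. x) \<in> measurable M (F T)" using measurable_F_M[OF T measurable_ident] by (simp add: id_def)
  then have "(\<lambda>(\<omega>, s). (\<omega>, s)) \<in> measurable (M \<Otimes>\<^sub>M lborel) (F T \<Otimes>\<^sub>M lborel)"
    unfolding case_prod_beta by (intro measurable_Pair measurable_compose[OF measurable_fst]) auto
  from measurable_compose[OF this prog_If[OF g T c]] show ?thesis by (simp add: case_prod_beta)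
qed

lemma prog_sec_borel:
  fixes g :: "real \<Rightarrow> 'w \<Rightarrow> 'v::euclidean_space"
  assumes g: "case_prod g \<in> borel_measurable prog" and \<omega>: "\<omega> \<in> space M"
  shows "(\<lambda>s. indicator {0..T} s *\<^sub>R g s \<omega>) \<in> borel_measurable lborel"
proof -
  have "(\<lambda>s. (\<lambda>(\<omega>, s). if s \<in> {0..T} then g s \<omega> else 0) (\<omega>, s)) \<in> borel_measurable lborel"
    using prog_If_M[OF g, of 0] \<omega> by (intro measurable_compose[OF measurable_Pair1']) auto
  also have "(\<lambda>s. (\<lambda>(\<omega>, s). if s \<in> {0..T} then g s \<omega> else 0) (\<omega>, s)) = (\<lambda>s. indicator {0..T} s *\<^sub>R g s \<omega>)"
    by (auto simp: fun_eq_iff)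
  finally show ?thesis .
qed

lemma time_integral_adapted:
  fixes g :: "real \<Rightarrow> 'w \<Rightarrow> 'v::euclidean_space"
  assumes g: "case_prod g \<in> borel_measurable prog" and ab: "0 \<le> a" "b \<in> {0..T}"
  shows "(\<lambda>\<omega>. LBINT s:{a..b}. g s \<omega>) \<in> borel_measurable (F b)"
proof -
  note [measurable] = prog_If[OF g ab(2), of 0, simplified]
  have "(\<lambda>\<omega>. \<integral>s. indicator {a..b} s *\<^sub>R (\<lambda>(\<omega>, s). if 0 \<le> s \<and> s \<le> b then g s \<omega> else 0) (\<omega>, s) \<partial>lborel) \<in> borel_measurable (F b)"
    by measurable
  also have "(\<lambda>\<omega>. \<integral>s. indicator {a..b} s *\<^sub>R (\<lambda>(\<omega>, s). if 0 \<le> s \<and> s \<le> b then g s \<omega> else 0) (\<omega>, s) \<partial>lborel) = (\<lambda>\<omega>. LBINT s:{a..b}. g s \<omega>)"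
    unfolding set_lebesgue_integral_def using ab
    by (intro ext Bochner_Integration.integral_cong) (auto simp: indicator_def)
  finally show ?thesis .
qed

text \<open>The upper limit is moved into the integrand as the cut-off s \<le> t, which makes this
  an ordinary parameter integral over \<open>prog_space F u\<close>.\<close>

lemma time_integral_progressive:
  fixes g :: "real \<Rightarrow> 'w \<Rightarrow> 'v::euclidean_space"
  assumes g: "case_prod g \<in> borel_measurable prog"
  shows "(\<lambda>(t, \<omega>). LBINT s:{0..t}. g s \<omega>) \<in> borel_measurable prog"
  unfolding measurable_prog_iff
proof
  fix u assume u: "u \<in> {0..T}"
  have I: "(\<lambda>(\<omega>, s). if 0 \<le> s \<and> s \<le> u then g s \<omega> else 0) \<in> borel_measurable (F u \<Otimes>\<^sub>M lborel)"
    using prog_If[OF g u, of 0] by simp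
  have [measurable]: "(\<lambda>t. t) \<in> borel_measurable (restrict_space borel {0..u})"
    by (intro measurable_restrict_space1) simp
  have [measurable]: "(\<lambda>x. fst (fst x)) \<in> borel_measurable (prog_space F u \<Otimes>\<^sub>M lborel)"
    by measurable
  have "(\<lambda>(x, s). (snd x, s)) \<in> measurable (prog_space F u \<Otimes>\<^sub>M lborel) (F u \<Otimes>\<^sub>M lborel)"
    by measurable
  from measurable_compose[OF this I]
  have [measurable]: "(\<lambda>x. if 0 \<le> snd x \<and> snd x \<le> u then g (snd x) (snd (fst x)) else 0) \<in> borel_measurable (prog_space F u \<Otimes>\<^sub>M lborel)"
    by (simp only: case_prod_beta fst_conv snd_conv)
  have "(\<lambda>(x, s). if 0 \<le> s \<and> s \<le> fst x then (if 0 \<le> s \<and> s \<le> u then g s (snd x) else 0) else 0) \<in> borel_measurable (prog_space F u \<Otimes>\<^sub>M lborel)"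
    unfolding case_prod_beta by measurable
  then have "(\<lambda>x. \<integral>s. (if 0 \<le> s \<and> s \<le> fst x then (if 0 \<le> s \<and> s \<le> u then g s (snd x) else 0) else 0) \<partial>lborel) \<in> borel_measurable (prog_space F u)"
    by (rule lborel.borel_measurable_lebesgue_integral)
  also have "?this \<longleftrightarrow> (\<lambda>(t, \<omega>). LBINT s:{0..t}. g s \<omega>) \<in> borel_measurable (prog_space F u)"
  proof (rule measurable_cong)
    fix x assume "x \<in> space (prog_space F u)"
    then have "fst x \<le> u" using u by (auto simp: space_prog_space)
    then show "(\<integral>s. (if 0 \<le> s \<and> s \<le> fst x then (if 0 \<le> s \<and> s \<le> u then g s (snd x) else 0) else 0) \<partial>lborel) = (case x of (t, \<omega>) \<Rightarrow> LBINT s:{0..t}. g s \<omega>)"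
      unfolding set_lebesgue_integral_def case_prod_beta
      by (intro Bochner_Integration.integral_cong) (auto simp: indicator_def)
  qed
  finally show "(\<lambda>(t, \<omega>). LBINT s:{0..t}. g s \<omega>) \<in> borel_measurable (prog_space F u)" .
qed

section \<open>Fubini for progressive processes\<close>

lemma nn_time_Fubini:
  assumes g: "case_prod g \<in> borel_measurable prog" and S: "S \<subseteq> {0..T}" "S \<in> sets borel"
  shows "(\<integral>\<^sup>+\<omega>. (\<integral>\<^sup>+s\<in>S. (g s \<omega> :: ennreal) \<partial>lborel) \<partial>M) = (\<integral>\<^sup>+s\<in>S. (\<integral>\<^sup>+\<omega>. g s \<omega> \<partial>M) \<partial>lborel)"
proof -
  interpret P: pair_sigma_finite M lborel ..
  note [measurable] = prog_If_M[OF g, of 0, simplified] S(2)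
  let ?g = "\<lambda>(\<omega>, s). (if 0 \<le> s \<and> s \<le> T then g s \<omega> else 0) * indicator S s"
  have m: "?g \<in> borel_measurable (M \<Otimes>\<^sub>M lborel)" unfolding case_prod_beta
    using prog_If_M[OF g, of 0, simplified] by (intro borel_measurable_times_ennreal) (auto simp: case_prod_beta)
  have eq: "?g (\<omega>, s) = g s \<omega> * indicator S s" for s \<omega> using S(1) by (auto simp: indicator_def)
  have "(\<integral>\<^sup>+\<omega>. (\<integral>\<^sup>+s. ?g (\<omega>, s) \<partial>lborel) \<partial>M) = (\<integral>\<^sup>+s. (\<integral>\<^sup>+\<omega>. ?g (\<omega>, s) \<partial>M) \<partial>lborel)"
    by (rule P.Fubini[OF m, symmetric])
  also have "\<dots> = (\<integral>\<^sup>+s. (\<integral>\<^sup>+\<omega>. g s \<omega> \<partial>M) * indicator S s \<partial>lborel)"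
    unfolding eq by (intro nn_integral_cong) (auto simp: indicator_def)
  finally show ?thesis unfolding eq .
qed

lemma nn_time_integral_measurable:
  assumes g: "case_prod g \<in> borel_measurable prog" and S: "S \<subseteq> {0..T}" "S \<in> sets borel"
  shows "(\<lambda>\<omega>. \<integral>\<^sup>+s\<in>S. (g s \<omega> :: ennreal) \<partial>lborel) \<in> borel_measurable M"
proof -
  let ?g = "\<lambda>(\<omega>, s). (if 0 \<le> s \<and> s \<le> T then g s \<omega> else 0) * indicator S s"
  note [measurable] = S(2)
  have m: "?g \<in> borel_measurable (M \<Otimes>\<^sub>M lborel)" unfolding case_prod_beta
    using prog_If_M[OF g, of 0, simplified] by (intro borel_measurable_times_ennreal) (auto simp: case_prod_beta)
  have eq: "?g (\<omega>, s) = g s \<omega> * indicator S s" for s \<omega> using S(1) by (auto simp: indicator_def)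
  have "(\<lambda>\<omega>. \<integral>\<^sup>+s. ?g (\<omega>, s) \<partial>lborel) \<in> borel_measurable M"
    using m by (rule lborel.borel_measurable_nn_integral_fst)
  then show ?thesis unfolding eq .
qed

lemma nn_expectation_measurable:
  assumes g: "case_prod g \<in> borel_measurable prog"
  shows "(\<lambda>s. (\<integral>\<^sup>+\<omega>. (g s \<omega> :: ennreal) \<partial>M) * indicator {0..T} s) \<in> borel_measurable lborel"
proof -
  interpret P: pair_sigma_finite M lborel ..
  let ?g = "\<lambda>(\<omega>, s). if s \<in> {0..T} then g s \<omega> else 0"
  have "(\<lambda>(s, \<omega>). ?g (\<omega>, s)) \<in> borel_measurable (lborel \<Otimes>\<^sub>M M)"
    using measurable_pair_swap[OF prog_If_M[OF g, of 0]] by simp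
  then have "(\<lambda>s. \<integral>\<^sup>+\<omega>. ?g (\<omega>, s) \<partial>M) \<in> borel_measurable lborel"
    using borel_measurable_nn_integral by (simp add: case_prod_beta)
  also have "(\<lambda>s. \<integral>\<^sup>+\<omega>. ?g (\<omega>, s) \<partial>M) = (\<lambda>s. (\<integral>\<^sup>+\<omega>. g s \<omega> \<partial>M) * indicator {0..T} s)"
    by (auto simp: fun_eq_iff indicator_def)
  finally show ?thesis .
qed

text \<open>P need not define a measurable set, so Fubini is applied to a measurable null set
  covering its failures.\<close>

lemma AE_time_swap:
  assumes "AE (s, \<omega>) in lborel \<Otimes>\<^sub>M M. P s \<omega>"
  shows "AE \<omega> in M. AE s in lborel. P s \<omega>"
proof -
  interpret P: pair_sigma_finite lborel M ..
  from assms obtain N where N: "{x \<in> space (lborel \<Otimes>\<^sub>M M). \<not> (case x of (s, \<omega>) \<Rightarrow> P s \<omega>)} \<subseteq> N"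
    "N \<in> null_sets (lborel \<Otimes>\<^sub>M M)" by (auto simp: eventually_ae_filter)
  have sN: "N \<in> sets (lborel \<Otimes>\<^sub>M M)" using N(2) by auto
  have "AE x in lborel \<Otimes>\<^sub>M M. x \<notin> N" using N(2) by (rule AE_not_in)
  then have "AE x in lborel \<Otimes>\<^sub>M M. (fst x, snd x) \<notin> N" by simp
  then have "AE s in lborel. AE \<omega> in M. (s, \<omega>) \<notin> N" using P.AE_pair[of "\<lambda>x. x \<notin> N"] by simp
  moreover have "{x \<in> space (lborel \<Otimes>\<^sub>M M). (fst x, snd x) \<notin> N} = space (lborel \<Otimes>\<^sub>M M) - N" by auto
  then have "{x \<in> space (lborel \<Otimes>\<^sub>M M). (fst x, snd x) \<notin> N} \<in> sets (lborel \<Otimes>\<^sub>M M)"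
    using sets.compl_sets[OF sN] by (simp only:)
  ultimately have "AE \<omega> in M. AE s in lborel. (s, \<omega>) \<notin> N" by (subst (asm) P.AE_commute)
  then show ?thesis using AE_space
  proof eventually_elim
    case (elim \<omega>)
    from elim(1) show ?case
    proof eventually_elim
      case (elim s)
      then show ?case using N(1) \<open>\<omega> \<in> space M\<close> by (auto simp: space_pair_measure)
    qed
  qed
qed

section \<open>Square-integrable processes and their time integrals\<close>

definition L2_process :: "(real \<Rightarrow> 'w \<Rightarrow> 'v::euclidean_space) \<Rightarrow> bool" where
  "L2_process g \<longleftrightarrow> case_prod g \<in> borel_measurable prog \<and>
     (\<integral>\<^sup>+\<omega>. (\<integral>\<^sup>+t\<in>{0..T}. ennreal (norm (g t \<omega>)) ^ 2 \<partial>lborel) \<partial>M) < \<infinity>"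

abbreviation process_sq :: "(real \<Rightarrow> 'w \<Rightarrow> 'v::euclidean_space) \<Rightarrow> ennreal" where
  "process_sq g \<equiv> \<integral>\<^sup>+\<omega>. (\<integral>\<^sup>+t\<in>{0..T}. ennreal (norm (g t \<omega>)) ^ 2 \<partial>lborel) \<partial>M"

text \<open>The time interval has finite length, so x \<le> 1 + x^2 reduces integrability in time to
  the square integral, which is almost surely finite.\<close>

lemma L2_process_AE_integrable:
  assumes g: "L2_process g"
  shows "AE \<omega> in M. set_integrable lborel {0..T} (\<lambda>s. g s \<omega>)"
proof -
  have gm: "case_prod g \<in> borel_measurable prog" using g by (simp add: L2_process_def)
  have "case_prod (\<lambda>s \<omega>. ennreal (norm (g s \<omega>)) ^ 2) \<in> borel_measurable prog"
    by (rule prog_compose[OF gm, of "\<lambda>x. ennreal (norm x) ^ 2"]) simp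
  from nn_time_integral_measurable[OF this, of "{0..T}"]
  have "AE \<omega> in M. (\<integral>\<^sup>+t\<in>{0..T}. ennreal (norm (g t \<omega>)) ^ 2 \<partial>lborel) \<noteq> \<infinity>"
    using g by (intro nn_integral_PInf_AE) (auto simp: L2_process_def)
  then show ?thesis using AE_space
  proof eventually_elim
    case (elim \<omega>)
    have m: "(\<lambda>s. indicator {0..T} s *\<^sub>R g s \<omega>) \<in> borel_measurable lborel" by (rule prog_sec_borel[OF gm elim(2)])
    show ?case unfolding set_integrable_def
    proof (rule integrableI_bounded[OF m])
      have "(\<integral>\<^sup>+s. ennreal (norm (indicator {0..T} s *\<^sub>R g s \<omega>)) \<partial>lborel) \<le>
        (\<integral>\<^sup>+s. indicator {0..T} s + ennreal (norm (indicator {0..T} s *\<^sub>R g s \<omega>)) ^ 2 \<partial>lborel)"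
      proof (rule nn_integral_mono)
        fix s
        have "0 \<le> (norm (g s \<omega>) - 1) ^ 2" by simp
        then have "2 * norm (g s \<omega>) \<le> 1 + norm (g s \<omega>) ^ 2" by (simp add: power2_diff)
        then have "norm (g s \<omega>) \<le> 1 + norm (g s \<omega>) ^ 2" using norm_ge_zero[of "g s \<omega>"] by linarith
        then have "ennreal (norm (g s \<omega>)) \<le> ennreal (1 + norm (g s \<omega>) ^ 2)" by (rule ennreal_leI)
        also have "\<dots> = 1 + ennreal (norm (g s \<omega>)) ^ 2" by (simp add: ennreal_power)
        finally show "ennreal (norm (indicator {0..T} s *\<^sub>R g s \<omega>)) \<le> indicator {0..T} s + ennreal (norm (indicator {0..T} s *\<^sub>R g s \<omega>)) ^ 2"
          by (simp add: indicator_def)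
      qed
      also have "\<dots> = (\<integral>\<^sup>+s. indicator {0..T} s \<partial>lborel) + (\<integral>\<^sup>+s. ennreal (norm (indicator {0..T} s *\<^sub>R g s \<omega>)) ^ 2 \<partial>lborel)"
        using measurable_compose[OF m, of "\<lambda>x. ennreal (norm x) ^ 2"] by (intro nn_integral_add) simp_all
      also have "(\<integral>\<^sup>+s. ennreal (norm (indicator {0..T} s *\<^sub>R g s \<omega>)) ^ 2 \<partial>lborel) = (\<integral>\<^sup>+t\<in>{0..T}. ennreal (norm (g t \<omega>)) ^ 2 \<partial>lborel)"
        by (intro nn_integral_cong) (auto simp: indicator_def)
      also have "(\<integral>\<^sup>+s. indicator {0..T} s \<partial>lborel) + \<dots> < \<infinity>"
        using elim(1) T_pos by (simp add: less_top)
      finally show "(\<integral>\<^sup>+s. ennreal (norm (indicator {0..T} s *\<^sub>R g s \<omega>)) \<partial>lborel) < \<infinity>" .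
    qed
  qed
qed

text \<open>Cauchy-Schwarz against the indicator of [0,T]. The constant is T rather than the length
  of [a,b], hence the same for all times later on.\<close>

lemma time_integral_sq_le:
  fixes g :: "real \<Rightarrow> 'v::euclidean_space"
  assumes m: "(\<lambda>s. indicator {0..T} s *\<^sub>R g s) \<in> borel_measurable lborel" and S: "{a..b} \<subseteq> {0..T}"
  shows "ennreal (norm (LBINT s:{a..b}. g s)) ^ 2 \<le> ennreal T * (\<integral>\<^sup>+s\<in>{a..b}. ennreal (norm (g s)) ^ 2 \<partial>lborel)"
proof (cases "integrable lborel (\<lambda>s. indicator {a..b} s *\<^sub>R g s)")
  case True
  have "ennreal (norm (LBINT s:{a..b}. g s)) \<le> (\<integral>\<^sup>+s. ennreal (norm (indicator {a..b} s *\<^sub>R g s)) \<partial>lborel)"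
    unfolding set_lebesgue_integral_def by (rule integral_norm_bound_ennreal[OF True])
  also have "\<dots> = (\<integral>\<^sup>+s. ennreal (norm (indicator {a..b} s *\<^sub>R g s)) * indicator {0..T} s \<partial>lborel)"
    using S by (intro nn_integral_cong) (auto simp: indicator_def)
  finally have "ennreal (norm (LBINT s:{a..b}. g s)) ^ 2 \<le> (\<integral>\<^sup>+s. ennreal (norm (indicator {a..b} s *\<^sub>R g s)) * indicator {0..T} s \<partial>lborel) ^ 2"
    by (intro power_mono) auto
  also have "\<dots> \<le> (\<integral>\<^sup>+s. ennreal (norm (indicator {a..b} s *\<^sub>R g s)) ^ 2 \<partial>lborel) * (\<integral>\<^sup>+s. indicator {0..T} s ^ 2 \<partial>lborel)"
    by (intro Cauchy_Schwarz_nn_integral borel_measurable_indicator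
        measurable_compose[OF borel_measurable_integrable[OF True]]) simp_all
  also have "(\<integral>\<^sup>+s. indicator {0..T} s ^ 2 \<partial>lborel) = (\<integral>\<^sup>+s. indicator {0..T} s \<partial>lborel)"
    by (intro nn_integral_cong) (auto simp: indicator_def)
  also have "\<dots> = ennreal T" using T_pos by simp
  also have "(\<integral>\<^sup>+s. ennreal (norm (indicator {a..b} s *\<^sub>R g s)) ^ 2 \<partial>lborel) = (\<integral>\<^sup>+s\<in>{a..b}. ennreal (norm (g s)) ^ 2 \<partial>lborel)"
    by (intro nn_integral_cong) (auto simp: indicator_def)
  finally show ?thesis by (simp add: mult.commute)
next
  \<comment> \<open>The Bochner integral of a function that is not integrable is 0 by
    convention.\<close>
  case False
  then show ?thesis by (simp add: set_lebesgue_integral_def not_integrable_integral_eq)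
qed

lemma L2_process_integral_vec_Lp:
  fixes g :: "real \<Rightarrow> 'w \<Rightarrow> 'v::euclidean_space"
  assumes g: "L2_process g" and ab: "0 \<le> a" "b \<in> {0..T}"
  shows "(\<lambda>\<omega>. LBINT s:{a..b}. g s \<omega>) \<in> vec_Lp 2 M (F b)"
proof -
  have gm: "case_prod g \<in> borel_measurable prog" using g by (simp add: L2_process_def)
  have gm2: "case_prod (\<lambda>s \<omega>. ennreal (norm (g s \<omega>)) ^ 2) \<in> borel_measurable prog"
    by (rule prog_compose[OF gm, of "\<lambda>x. ennreal (norm x) ^ 2"]) simp
  have sub: "{a..b} \<subseteq> {0..T}" using ab by auto
  have "(\<integral>\<^sup>+\<omega>. ennreal (norm (LBINT s:{a..b}. g s \<omega>)) ^ 2 \<partial>M) \<le> (\<integral>\<^sup>+\<omega>. ennreal T * (\<integral>\<^sup>+s\<in>{0..T}. ennreal (norm (g s \<omega>)) ^ 2 \<partial>lborel) \<partial>M)"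
  proof (rule nn_integral_mono)
    fix \<omega> assume "\<omega> \<in> space M"
    have "(\<integral>\<^sup>+s\<in>{a..b}. ennreal (norm (g s \<omega>)) ^ 2 \<partial>lborel) \<le> (\<integral>\<^sup>+s\<in>{0..T}. ennreal (norm (g s \<omega>)) ^ 2 \<partial>lborel)"
      using sub by (intro nn_integral_mono mult_left_mono) (auto simp: indicator_def)
    then show "ennreal (norm (LBINT s:{a..b}. g s \<omega>)) ^ 2 \<le> ennreal T * (\<integral>\<^sup>+s\<in>{0..T}. ennreal (norm (g s \<omega>)) ^ 2 \<partial>lborel)"
      using order_trans[OF time_integral_sq_le[OF prog_sec_borel[OF gm \<open>\<omega> \<in> space M\<close>] sub] mult_left_mono] by simp
  qed
  also have "\<dots> = ennreal T * process_sq g"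
    by (intro nn_integral_cmult nn_time_integral_measurable[OF gm2]) auto
  also have "\<dots> < \<infinity>" using g by (simp add: L2_process_def ennreal_mult_less_top)
  finally show ?thesis using time_integral_adapted[OF gm ab] by (simp add: vec_Lp_def)
qed

end

subsection \<open>Conditional expectations of random sets\<close>

lemma prob_space_sigma_finite_subalgebra:
  assumes "prob_space M" "subalgebra M G"
  shows "sigma_finite_subalgebra M G"
proof -
  interpret prob_space M by fact
  show ?thesis
    by (rule finite_measure_subalgebra_is_sigma_finite)
       (simp add: finite_measure_subalgebra_def finite_measure_subalgebra_axioms_def finite_measure_axioms assms)
qed

lemma vec_L1_iff:
  fixes g :: "'w \<Rightarrow> 'v::euclidean_space"
  assumes "subalgebra M G"
  shows "g \<in> vec_Lp 1 M G \<longleftrightarrow> g \<in> borel_measurable G \<and> integrable M g"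
proof -
  have "g \<in> borel_measurable M" if "g \<in> borel_measurable G" by (rule measurable_from_subalg[OF assms that])
  then show ?thesis unfolding vec_Lp_def integrable_iff_bounded power_one_right by blast
qed

lemma measurable_vec_component:
  assumes "\<And>i. (\<lambda>x. g x $ i) \<in> borel_measurable N"
  shows "(g :: 'w \<Rightarrow> real ^ 'd) \<in> borel_measurable N"
proof (rule borel_measurable_euclidean_space[THEN iffD2], rule)
  fix b :: "real ^ 'd" assume "b \<in> Basis"
  have "(\<lambda>x. \<Sum>i\<in>UNIV. b $ i * g x $ i) \<in> borel_measurable N" using assms by measurable
  then show "(\<lambda>x. g x \<bullet> b) \<in> borel_measurable N" by (simp add: inner_vec_def mult.commute)
qed

locale sub_prob = prob_space M for M :: "'w measure" +
  fixes G :: "'w measure"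
  assumes sub_G: "subalgebra M G"
begin

sublocale S: sigma_finite_subalgebra M G
  by (rule prob_space_sigma_finite_subalgebra[OF prob_space_axioms sub_G])

lemma integrable_component: "integrable M (g :: 'w \<Rightarrow> real ^ 'd) \<Longrightarrow> integrable M (\<lambda>\<omega>. g \<omega> $ i)"
  by (rule integrable_bounded_linear[OF bounded_linear_vec_nth])

lemma vec_cond_exp_integrable:
  assumes g: "integrable M (g :: 'w \<Rightarrow> real ^ 'd)"
  shows "vec_cond_exp M G g \<in> borel_measurable G" "integrable M (vec_cond_exp M G g)"
proof -
  show m: "vec_cond_exp M G g \<in> borel_measurable G"
    unfolding vec_cond_exp_def by (intro measurable_vec_component) simp
  show "integrable M (vec_cond_exp M G g)"
  proof (rule Bochner_Integration.integrable_bound)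
    show "integrable M (\<lambda>\<omega>. \<Sum>i\<in>UNIV. \<bar>real_cond_exp M G (\<lambda>\<omega>. g \<omega> $ i) \<omega>\<bar>)"
      by (intro Bochner_Integration.integrable_sum integrable_abs S.real_cond_exp_int integrable_component g)
    show "vec_cond_exp M G g \<in> borel_measurable M" by (rule measurable_from_subalg[OF sub_G m])
    show "AE \<omega> in M. norm (vec_cond_exp M G g \<omega>) \<le> norm (\<Sum>i\<in>UNIV. \<bar>real_cond_exp M G (\<lambda>\<omega>. g \<omega> $ i) \<omega>\<bar>)"
    proof (rule AE_I2)
      fix \<omega>
      have "norm (vec_cond_exp M G g \<omega>) \<le> (\<Sum>i\<in>UNIV. \<bar>vec_cond_exp M G g \<omega> $ i\<bar>)" by (rule norm_le_l1_cart)
      then show "norm (vec_cond_exp M G g \<omega>) \<le> norm (\<Sum>i\<in>UNIV. \<bar>real_cond_exp M G (\<lambda>\<omega>. g \<omega> $ i) \<omega>\<bar>)"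
        by (simp add: vec_cond_exp_def)
    qed
  qed
qed

text \<open>Linearity of the scalar conditional expectation in the finitely many coordinates; the
  null set depends on p.\<close>

lemma inner_vec_cond_exp:
  assumes g: "integrable M (g :: 'w \<Rightarrow> real ^ 'd)"
  shows "AE \<omega> in M. p \<bullet> vec_cond_exp M G g \<omega> = real_cond_exp M G (\<lambda>\<omega>. p \<bullet> g \<omega>) \<omega>"
proof -
  have "AE \<omega> in M. \<forall>i\<in>UNIV. real_cond_exp M G (\<lambda>\<omega>. p $ i * g \<omega> $ i) \<omega> = p $ i * real_cond_exp M G (\<lambda>\<omega>. g \<omega> $ i) \<omega>"
    using S.real_cond_exp_cmult[OF integrable_component[OF g]] by (intro AE_finite_allI) auto
  moreover have "AE \<omega> in M. real_cond_exp M G (\<lambda>\<omega>. \<Sum>i\<in>UNIV. p $ i * g \<omega> $ i) \<omega> = (\<Sum>i\<in>UNIV. real_cond_exp M G (\<lambda>\<omega>. p $ i * g \<omega> $ i) \<omega>)"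
    by (intro S.real_cond_exp_sum integrable_mult_right integrable_component g)
  ultimately show ?thesis
    by eventually_elim (simp add: inner_vec_def vec_cond_exp_def)
qed

lemma vec_cond_exp_eqI:
  assumes g: "integrable M (g :: 'w \<Rightarrow> real ^ 'd)"
    and h: "\<And>i. AE \<omega> in M. real_cond_exp M G (\<lambda>\<omega>. g \<omega> $ i) \<omega> = h \<omega> $ i"
  shows "AE \<omega> in M. vec_cond_exp M G g \<omega> = h \<omega>"
proof -
  have "AE \<omega> in M. \<forall>i\<in>UNIV. real_cond_exp M G (\<lambda>\<omega>. g \<omega> $ i) \<omega> = h \<omega> $ i"
    using h by (intro AE_finite_allI) auto
  then show ?thesis by eventually_elim (simp add: vec_cond_exp_def vec_eq_iff)
qed

text \<open>The case distinction is \<open>indicator D\<close> times a difference plus the second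
  function, and the G-measurable indicator is taken out.\<close>

lemma vec_cond_exp_If:
  assumes g: "integrable M (g1 :: 'w \<Rightarrow> real ^ 'd)" "integrable M g2" and D: "D \<in> sets G"
  shows "AE \<omega> in M. vec_cond_exp M G (\<lambda>\<omega>. if \<omega> \<in> D then g1 \<omega> else g2 \<omega>) \<omega> =
    (if \<omega> \<in> D then vec_cond_exp M G g1 \<omega> else vec_cond_exp M G g2 \<omega>)"
proof (rule vec_cond_exp_eqI)
  have DM: "D \<in> sets M" using D sub_G by (auto simp: subalgebra_def)
  have eq: "(if \<omega> \<in> D then a else b) = indicator D \<omega> * (a - b) + (b :: real)" for a b \<omega>
    by (simp add: indicator_def)
  have "integrable M (\<lambda>\<omega>. indicator D \<omega> *\<^sub>R (g1 \<omega> - g2 \<omega>) + g2 \<omega>)"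
    using g DM by (intro Bochner_Integration.integrable_add integrable_mult_indicator Bochner_Integration.integrable_diff)
  also have "(\<lambda>\<omega>. indicator D \<omega> *\<^sub>R (g1 \<omega> - g2 \<omega>) + g2 \<omega>) = (\<lambda>\<omega>. if \<omega> \<in> D then g1 \<omega> else g2 \<omega>)"
    by (auto simp: indicator_def)
  finally show "integrable M (\<lambda>\<omega>. if \<omega> \<in> D then g1 \<omega> else g2 \<omega>)" .
  fix i
  note g' = integrable_component[OF g(1), of i] integrable_component[OF g(2), of i]
  have id: "integrable M (\<lambda>\<omega>. indicator D \<omega> * (g1 \<omega> $ i - g2 \<omega> $ i))"
    using integrable_mult_indicator[OF DM Bochner_Integration.integrable_diff[OF g']] by simp
  have "AE \<omega> in M. real_cond_exp M G (\<lambda>\<omega>. indicator D \<omega> * (g1 \<omega> $ i - g2 \<omega> $ i) + g2 \<omega> $ i) \<omega> =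
    real_cond_exp M G (\<lambda>\<omega>. indicator D \<omega> * (g1 \<omega> $ i - g2 \<omega> $ i)) \<omega> + real_cond_exp M G (\<lambda>\<omega>. g2 \<omega> $ i) \<omega>"
    by (rule S.real_cond_exp_add[OF id g'(2)])
  moreover have "AE \<omega> in M. real_cond_exp M G (\<lambda>\<omega>. indicator D \<omega> * (g1 \<omega> $ i - g2 \<omega> $ i)) \<omega> =
    indicator D \<omega> * real_cond_exp M G (\<lambda>\<omega>. g1 \<omega> $ i - g2 \<omega> $ i) \<omega>"
    using D g' id by (intro S.real_cond_exp_mult) auto
  moreover have "AE \<omega> in M. real_cond_exp M G (\<lambda>\<omega>. g1 \<omega> $ i - g2 \<omega> $ i) \<omega> =
    real_cond_exp M G (\<lambda>\<omega>. g1 \<omega> $ i) \<omega> - real_cond_exp M G (\<lambda>\<omega>. g2 \<omega> $ i) \<omega>"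
    by (rule S.real_cond_exp_diff[OF g'])
  ultimately show "AE \<omega> in M. real_cond_exp M G (\<lambda>\<omega>. (if \<omega> \<in> D then g1 \<omega> else g2 \<omega>) $ i) \<omega> =
    (if \<omega> \<in> D then vec_cond_exp M G g1 \<omega> else vec_cond_exp M G g2 \<omega>) $ i"
  proof eventually_elim
    case (elim \<omega>)
    have "(\<lambda>\<omega>. (if \<omega> \<in> D then g1 \<omega> else g2 \<omega>) $ i) = (\<lambda>\<omega>. indicator D \<omega> * (g1 \<omega> $ i - g2 \<omega> $ i) + g2 \<omega> $ i)"
      by (auto simp: indicator_def)
    then show ?case using elim by (auto simp: vec_cond_exp_def indicator_def)
  qed
qed

lemma subalgebra_refl: "subalgebra M M"
  by (simp add: subalgebra_def)

lemma selectors_L1_integrable: "g \<in> selectors 1 M M X \<Longrightarrow> integrable M (g :: 'w \<Rightarrow> 'v::euclidean_space)"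
  using selectorsD(1) vec_L1_iff[OF subalgebra_refl] by blast

lemma vec_cond_exp_selectors_L1:
  "vec_cond_exp M G ` selectors 1 M M X \<subseteq> vec_Lp 1 M G" for X :: "'w \<Rightarrow> (real ^ 'd) set"
  using vec_L1_iff[OF sub_G] vec_cond_exp_integrable selectors_L1_integrable by fastforce

text \<open>Conditional expectations of selectors may be pasted along a set of G, up to a null set,
  because the selectors may. The L^1 error of a pasted approximation is at most the sum of the two
  errors.\<close>

lemma cond_exp_closure_decomposable:
  fixes X :: "'w \<Rightarrow> (real ^ 'd) set"
  shows "decomposable G (Lp_closure 1 M G (vec_cond_exp M G ` selectors 1 M M X))" (is "decomposable G (Lp_closure 1 M G ?V)")
  unfolding decomposable_def
proof (intro ballI)
  fix D h1 h2 assume D: "D \<in> sets G" and h: "h1 \<in> Lp_closure 1 M G ?V" "h2 \<in> Lp_closure 1 M G ?V"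
  have DM: "D \<in> sets M" using D sub_G by (auto simp: subalgebra_def)
  show "(\<lambda>\<omega>. if \<omega> \<in> D then h1 \<omega> else h2 \<omega>) \<in> Lp_closure 1 M G ?V" (is "?h \<in> _")
  proof (rule Lp_closureI)
    show "?h \<in> vec_Lp 1 M G" by (intro vec_Lp_If sub_G D Lp_closureD(1)[OF h(1)] Lp_closureD(1)[OF h(2)])
    fix e :: real assume "0 < e"
    then have e: "0 < e/2" by simp
    obtain g1 where g1: "g1 \<in> selectors 1 M M X" "Lp_dist 1 M h1 (vec_cond_exp M G g1) < ennreal (e/2)"
      using Lp_closureD(2)[OF h(1) e] by blast
    obtain g2 where g2: "g2 \<in> selectors 1 M M X" "Lp_dist 1 M h2 (vec_cond_exp M G g2) < ennreal (e/2)"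
      using Lp_closureD(2)[OF h(2) e] by blast
    let ?g = "\<lambda>\<omega>. if \<omega> \<in> D then g1 \<omega> else g2 \<omega>"
    note ig = selectors_L1_integrable[OF g1(1)] selectors_L1_integrable[OF g2(1)]
    have [measurable]: "h1 \<in> borel_measurable M" "h2 \<in> borel_measurable M"
      using vec_Lp_measurable[OF sub_G Lp_closureD(1)[OF h(1)]] vec_Lp_measurable[OF sub_G Lp_closureD(1)[OF h(2)]] by auto
    note [measurable] = borel_measurable_integrable[OF vec_cond_exp_integrable(2)[OF ig(1)]]
      borel_measurable_integrable[OF vec_cond_exp_integrable(2)[OF ig(2)]]
    have "?g \<in> selectors 1 M M X"
      using selectors_decomposable[OF subalgebra_refl, of 1 X] DM g1(1) g2(1) unfolding decomposable_def by blast
    moreover have "Lp_dist 1 M ?h (vec_cond_exp M G ?g) \<le>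
      (\<integral>\<^sup>+\<omega>. ennreal (norm (h1 \<omega> - vec_cond_exp M G g1 \<omega>)) ^ 1 + ennreal (norm (h2 \<omega> - vec_cond_exp M G g2 \<omega>)) ^ 1 \<partial>M)"
      using vec_cond_exp_If[OF ig D] by (intro nn_integral_mono_AE) (auto elim!: eventually_mono)
    moreover have "\<dots> = Lp_dist 1 M h1 (vec_cond_exp M G g1) + Lp_dist 1 M h2 (vec_cond_exp M G g2)"
      by (rule nn_integral_add) measurable
    moreover have "\<dots> \<le> ennreal (e/2) + ennreal (e/2)" using g1(2) g2(2) by (intro add_mono) auto
    moreover have "\<dots> = ennreal e" using e by (subst ennreal_plus[symmetric]) auto
    ultimately show "\<exists>v\<in>?V. Lp_dist 1 M ?h v \<le> ennreal e"
      by (intro bexI[of _ "vec_cond_exp M G ?g"] imageI) auto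
  qed
qed

text \<open>The defining closure is nonempty, closed and decomposable, so
  \<open>decomposable_eq_selectors\<close> represents it.\<close>

lemma set_cond_exp_exists:
  fixes X :: "'w \<Rightarrow> (real ^ 'd) set"
  assumes "integrably_bounded M X" and ne: "selectors 1 M M X \<noteq> {}"
  obtains Z where "is_set_cond_exp M G X Z"
proof -
  let ?V = "vec_cond_exp M G ` selectors 1 M M X"
  have V: "?V \<subseteq> Lp_closure 1 M G ?V" by (intro Lp_closure_superset vec_cond_exp_selectors_L1) simp
  then have "Lp_closure 1 M G ?V \<noteq> {}" using ne by blast
  moreover have "Lp_closure 1 M G (Lp_closure 1 M G ?V) \<subseteq> Lp_closure 1 M G ?V"
    using vec_cond_exp_integrable(2) selectors_L1_integrable by (intro Lp_closure_closed sub_G) fastforce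
  ultimately obtain Z where "set_measurable G Z" "selectors 1 M G Z = Lp_closure 1 M G ?V"
    using decomposable_eq_selectors[OF prob_space_axioms sub_G zero_less_one _ Lp_closure_subset_vec_Lp _ cond_exp_closure_decomposable]
    by metis
  with assms show ?thesis by (intro that) (simp add: is_set_cond_exp_def)
qed

text \<open>The selectors of a closed-valued C are closed in L^1, so they contain the defining
  closure as soon as they contain the conditional expectations.\<close>

lemma set_cond_exp_hull:
  fixes X :: "'w \<Rightarrow> (real ^ 'd) set"
  assumes Z: "is_set_cond_exp M G X Z" and ne: "selectors 1 M M X \<noteq> {}"
  shows "ess_hull M (vec_cond_exp M G ` selectors 1 M M X) Z"
proof (rule ess_hullI[OF finite_measure_axioms sub_G])
  let ?V = "vec_cond_exp M G ` selectors 1 M M X"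
  have sel: "selectors 1 M G Z = Lp_closure 1 M G ?V" using Z by (simp add: is_set_cond_exp_def)
  show "set_measurable G Z" using Z by (simp add: is_set_cond_exp_def)
  show "?V \<noteq> {}" using ne by blast
  show "?V \<subseteq> vec_Lp 1 M G" by (rule vec_cond_exp_selectors_L1)
  show "?V \<subseteq> selectors 1 M G Z" unfolding sel by (intro Lp_closure_superset vec_cond_exp_selectors_L1) simp
  fix C :: "'w \<Rightarrow> (real ^ 'd) set"
  assume C: "\<And>\<omega>. \<omega> \<in> space M \<Longrightarrow> closed (C \<omega>)" "?V \<subseteq> selectors 1 M G C"
  have "selectors 1 M G Z \<subseteq> Lp_closure 1 M G (selectors 1 M G C)"
    unfolding sel using C(2) by (rule Lp_closure_mono)
  also have "\<dots> \<subseteq> selectors 1 M G C" using C(1) by (intro selectors_closed sub_G) auto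
  finally show "selectors 1 M G Z \<subseteq> selectors 1 M G C" .
qed

text \<open>\<open>U p\<close> plays the part of the support function of X, which is known only
  almost surely when X involves a version of the time integral. Half-spaces whose random level is
  the conditional expectation of \<open>U p\<close> bound Z from above by minimality; conditional
  expectations of nearly optimal selectors lie in Z and bound it from below; midpoints of selectors
  give convexity.\<close>

lemma set_cond_exp_supp:
  fixes X :: "'w \<Rightarrow> (real ^ 'd) set"
  assumes Z: "is_set_cond_exp M G X Z" and ne: "selectors 1 M M X \<noteq> {}"
    and conv: "AE \<omega> in M. convex (X \<omega>)"
    and U: "\<And>p. integrable M (U p)"
    and upper: "\<And>p. AE \<omega> in M. \<forall>x\<in>X \<omega>. p \<bullet> x \<le> U p \<omega>"
    and lower: "\<And>p e. 0 < e \<Longrightarrow> \<exists>g\<in>selectors 1 M M X. AE \<omega> in M. U p \<omega> - e \<le> p \<bullet> g \<omega>"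
  shows "AE \<omega> in M. Z \<omega> \<in> compact_convex_sets"
    "AE \<omega> in M. \<forall>p\<in>dirs. supp (Z \<omega>) p = real_cond_exp M G (U p) \<omega>"
proof -
  let ?V = "vec_cond_exp M G ` selectors 1 M M X"
  let ?y = "\<lambda>\<omega> p. real_cond_exp M G (U p) \<omega>"
  note hull = set_cond_exp_hull[OF Z ne]
  have Zm: "set_measurable G Z" using Z by (simp add: is_set_cond_exp_def)
  have sp: "space G = space M" using sub_G by (simp add: subalgebra_def)
  have Z_closed: "closed (Z \<omega>)" "Z \<omega> \<noteq> {}" if "\<omega> \<in> space M" for \<omega>
    using set_measurableD[OF Zm] that by (auto simp: sp)
  have "AE \<omega> in M. \<forall>p\<in>dirs. Z \<omega> \<subseteq> {z. p \<bullet> z \<le> ?y \<omega> p}"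
    unfolding AE_ball_countable[OF countable_dirs]
  proof
    fix p :: "real ^ 'd"
    show "AE \<omega> in M. Z \<omega> \<subseteq> {z. p \<bullet> z \<le> ?y \<omega> p}"
    proof (rule ess_hull_subset[OF hull])
      show "closed {z. p \<bullet> z \<le> ?y \<omega> p}" for \<omega> by (rule closed_halfspace_le)
      fix v assume "v \<in> ?V"
      then obtain g where g: "g \<in> selectors 1 M M X" "v = vec_cond_exp M G g" by blast
      note ig = selectors_L1_integrable[OF g(1)]
      have "AE \<omega> in M. p \<bullet> g \<omega> \<le> U p \<omega>" using selectorsD(2)[OF g(1)] upper[of p] by eventually_elim auto
      then have "AE \<omega> in M. real_cond_exp M G (\<lambda>\<omega>. p \<bullet> g \<omega>) \<omega> \<le> ?y \<omega> p"
        using ig U by (intro S.real_cond_exp_mono) auto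
      with inner_vec_cond_exp[OF ig, of p] show "AE \<omega> in M. v \<omega> \<in> {z. p \<bullet> z \<le> ?y \<omega> p}"
        by eventually_elim (simp add: g(2))
    qed
  qed
  then have sub: "AE \<omega> in M. Z \<omega> \<subseteq> supp_set (?y \<omega>)"
    by eventually_elim (auto simp: supp_set_def)
  have mid: "AE \<omega> in M. convex (Z \<omega>)"
  proof (rule ess_hull_convex[OF hull Z_closed(1)])
    fix v w assume "v \<in> ?V" "w \<in> ?V"
    then obtain g h where g: "g \<in> selectors 1 M M X" "v = vec_cond_exp M G g"
      and h: "h \<in> selectors 1 M M X" "w = vec_cond_exp M G h" by blast
    note ig = selectors_L1_integrable[OF g(1)] and ih = selectors_L1_integrable[OF h(1)]
    let ?m = "\<lambda>\<omega>. midpoint (g \<omega>) (h \<omega>)"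
    have im: "integrable M ?m" unfolding midpoint_def using ig ih by simp
    have "AE \<omega> in M. ?m \<omega> \<in> X \<omega>" using selectorsD(2)[OF g(1)] selectorsD(2)[OF h(1)] conv
    proof eventually_elim
      case (elim \<omega>)
      then show ?case using midpoint_in_closed_segment closed_segment_subset by blast
    qed
    then have "?m \<in> selectors 1 M M X"
      using im vec_L1_iff[OF subalgebra_refl, of ?m] by (simp add: selectors_def)
    then have "AE \<omega> in M. vec_cond_exp M G ?m \<omega> \<in> Z \<omega>" by (intro ess_hullD(2)[OF hull] imageI)
    moreover have "AE \<omega> in M. vec_cond_exp M G ?m \<omega> = midpoint (v \<omega>) (w \<omega>)"
    proof (rule vec_cond_exp_eqI[OF im])
      fix i
      note ig' = integrable_component[OF ig, of i] and ih' = integrable_component[OF ih, of i]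
      have "AE \<omega> in M. real_cond_exp M G (\<lambda>\<omega>. (g \<omega> $ i + h \<omega> $ i) / 2) \<omega> = real_cond_exp M G (\<lambda>\<omega>. g \<omega> $ i + h \<omega> $ i) \<omega> / 2"
        using ig' ih' by (intro S.real_cond_exp_cdiv) auto
      with S.real_cond_exp_add[OF ig' ih']
      show "AE \<omega> in M. real_cond_exp M G (\<lambda>\<omega>. midpoint (g \<omega>) (h \<omega>) $ i) \<omega> = midpoint (v \<omega>) (w \<omega>) $ i"
      proof eventually_elim
        case (elim \<omega>)
        have "(\<lambda>\<omega>. midpoint (g \<omega>) (h \<omega>) $ i) = (\<lambda>\<omega>. (g \<omega> $ i + h \<omega> $ i) / 2)"
          by (simp add: midpoint_def)
        moreover have "midpoint (v \<omega>) (w \<omega>) $ i = (real_cond_exp M G (\<lambda>\<omega>. g \<omega> $ i) \<omega> + real_cond_exp M G (\<lambda>\<omega>. h \<omega> $ i) \<omega>) / 2"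
          by (simp add: midpoint_def g(2) h(2) vec_cond_exp_def)
        ultimately show ?case using elim by simp
      qed
    qed
    ultimately show "AE \<omega> in M. midpoint (v \<omega>) (w \<omega>) \<in> Z \<omega>" by eventually_elim auto
  qed
  show K: "AE \<omega> in M. Z \<omega> \<in> compact_convex_sets"
    using sub mid AE_space
  proof eventually_elim
    case (elim \<omega>)
    have "compact (supp_set (?y \<omega>) \<inter> Z \<omega>)" using Z_closed(1)[OF elim(3)] supp_set_compact by (rule compact_Int_closed[rotated])
    moreover have "supp_set (?y \<omega>) \<inter> Z \<omega> = Z \<omega>" using elim(1) by blast
    ultimately show ?case using elim(2) Z_closed(2)[OF elim(3)] by (simp add: compact_convex_sets_def)
  qed
  \<comment> \<open>Tolerances 1/(n+1) instead of all positive e, so that only countably many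
    exceptional sets arise.\<close>
  have "AE \<omega> in M. \<forall>p\<in>dirs. \<forall>n::nat. ?y \<omega> p - 1 / Suc n \<le> supp (Z \<omega>) p"
    unfolding AE_ball_countable[OF countable_dirs] AE_all_countable
  proof (intro ballI allI)
    fix p :: "real ^ 'd" and n :: nat
    obtain g where g: "g \<in> selectors 1 M M X" "AE \<omega> in M. U p \<omega> - 1 / Suc n \<le> p \<bullet> g \<omega>"
      using lower[of "1 / Suc n" p] by auto
    note ig = selectors_L1_integrable[OF g(1)]
    have c: "integrable M (\<lambda>_. 1 / real (Suc n))" by simp
    have "AE \<omega> in M. real_cond_exp M G (\<lambda>\<omega>. U p \<omega> - 1 / Suc n) \<omega> \<le> real_cond_exp M G (\<lambda>\<omega>. p \<bullet> g \<omega>) \<omega>"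
      using g(2) U ig c by (intro S.real_cond_exp_mono Bochner_Integration.integrable_diff) auto
    moreover have "AE \<omega> in M. real_cond_exp M G (\<lambda>\<omega>. U p \<omega> - 1 / Suc n) \<omega> = ?y \<omega> p - real_cond_exp M G (\<lambda>_. 1 / Suc n) \<omega>"
      by (rule S.real_cond_exp_diff[OF U c])
    moreover have "AE \<omega> in M. real_cond_exp M G (\<lambda>_. 1 / real (Suc n)) \<omega> = 1 / Suc n"
      by (rule S.real_cond_exp_F_meas[OF c]) simp
    moreover have "AE \<omega> in M. vec_cond_exp M G g \<omega> \<in> Z \<omega>" using g(1) by (intro ess_hullD(2)[OF hull] imageI)
    ultimately show "AE \<omega> in M. ?y \<omega> p - 1 / Suc n \<le> supp (Z \<omega>) p"
      using inner_vec_cond_exp[OF ig, of p] K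
    proof eventually_elim
      case (elim \<omega>)
      have "p \<bullet> vec_cond_exp M G g \<omega> \<le> supp (Z \<omega>) p" using elim ccsD(2) by (intro supp_ge) auto
      then show ?case using elim by linarith
    qed
  qed
  then show "AE \<omega> in M. \<forall>p\<in>dirs. supp (Z \<omega>) p = ?y \<omega> p"
    using sub AE_space
  proof eventually_elim
    case (elim \<omega>)
    show ?case
    proof (intro ballI antisym)
      fix p :: "real ^ 'd" assume p: "p \<in> dirs"
      show "supp (Z \<omega>) p \<le> ?y \<omega> p"
        using elim(2) p by (intro supp_le Z_closed(2)[OF elim(3)]) (auto simp: supp_set_def)
      have "(\<lambda>n. ?y \<omega> p - inverse (real (Suc n))) \<longlonglongrightarrow> ?y \<omega> p - 0"
        by (intro tendsto_intros LIMSEQ_inverse_real_of_nat)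
      then have lim: "(\<lambda>n. ?y \<omega> p - 1 / real (Suc n)) \<longlonglongrightarrow> ?y \<omega> p" by (simp add: inverse_eq_divide)
      show "?y \<omega> p \<le> supp (Z \<omega>) p"
        by (rule LIMSEQ_le_const2[OF lim]) (use elim(1) p in blast)
    qed
  qed
qed

end

subsection \<open>Set-valued time integrals\<close>

lemma vec_Lp_closed: "Lp_closure p M G (vec_Lp p M G) \<subseteq> vec_Lp p M G"
  by (rule Lp_closure_subset_vec_Lp)

lemma vec_Lp_decomposable: "subalgebra M G \<Longrightarrow> decomposable G (vec_Lp p M G)"
  unfolding decomposable_def using vec_Lp_If by blast

lemma dec_closure_least:
  assumes "V \<subseteq> W" "W \<subseteq> vec_Lp 2 M G" "Lp_closure 2 M G W \<subseteq> W" "decomposable G W"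
  shows "dec_closure M G V \<subseteq> W"
proof -
  have "Lp_closure 2 M G W = W" using assms(3) Lp_closure_superset[OF assms(2)] by auto
  with assms show ?thesis unfolding dec_closure_def by blast
qed

lemma dec_closure_props:
  assumes G: "subalgebra M G" and V: "V \<subseteq> vec_Lp 2 M G"
  shows "V \<subseteq> dec_closure M G V" "dec_closure M G V \<subseteq> vec_Lp 2 M G"
    "Lp_closure 2 M G (dec_closure M G V) \<subseteq> dec_closure M G V" "decomposable G (dec_closure M G V)"
proof -
  let ?\<W> = "{W. V \<subseteq> W \<and> W \<subseteq> vec_Lp 2 M G \<and> Lp_closure 2 M G W = W \<and> decomposable G W}"
  show "V \<subseteq> dec_closure M G V" unfolding dec_closure_def by blast
  show "dec_closure M G V \<subseteq> vec_Lp 2 M G"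
    using dec_closure_least[OF V order_refl vec_Lp_closed vec_Lp_decomposable[OF G]] .
  show "Lp_closure 2 M G (dec_closure M G V) \<subseteq> dec_closure M G V"
  proof
    fix g assume g: "g \<in> Lp_closure 2 M G (dec_closure M G V)"
    have "g \<in> W" if W: "W \<in> ?\<W>" for W
    proof -
      have "dec_closure M G V \<subseteq> W" unfolding dec_closure_def using W by blast
      then have "g \<in> Lp_closure 2 M G W" using g Lp_closure_mono by blast
      then show ?thesis using W by blast
    qed
    then show "g \<in> dec_closure M G V" unfolding dec_closure_def by blast
  qed
  show "decomposable G (dec_closure M G V)"
    unfolding dec_closure_def decomposable_def by blast
qed

text \<open>Meant for sums with a version of the time integral, whose compactness is known only
  almost surely, so that \<open>set_norm_eq\<close> does not cover them.\<close>

lemma set_norm_le: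
  fixes A :: "'v::euclidean_space set"
  assumes "A \<noteq> {}" "\<And>a. a \<in> A \<Longrightarrow> norm a \<le> r"
  shows "set_norm A \<le> ennreal r"
proof -
  obtain a where a: "a \<in> A" using assms(1) by blast
  have "infdist 0 A \<le> r" using infdist_le[OF a, of 0] assms(2)[OF a] by simp
  moreover have "infdist a {0} \<le> r" if "a \<in> A" for a using assms(2)[OF that] by simp
  ultimately show ?thesis
    unfolding set_norm_def hausdorff_dist_def by (auto intro!: SUP_least ennreal_leI)
qed

context filtration
begin

lemma T_in: "T \<in> {0..T}"
  using T_pos by simp

lemma set_measurable_F_M:
  assumes t: "t \<in> {0..T}" and X: "set_measurable (F t) X"
  shows "set_measurable M (X :: 'w \<Rightarrow> 'v::euclidean_space set)"
proof -
  have "(\<lambda>x. x) \<in> measurable M (F t)" using measurable_F_M[OF t measurable_ident] by (simp add: id_def)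
  from set_measurable_compose[OF this X] show ?thesis .
qed

lemma vec_L2_integrable:
  fixes v :: "'w \<Rightarrow> 'v::euclidean_space"
  assumes "v \<in> borel_measurable M" "(\<integral>\<^sup>+\<omega>. ennreal (norm (v \<omega>)) ^ 2 \<partial>M) < \<infinity>"
  shows "integrable M v"
proof (rule integrableI_bounded[OF assms(1)])
  have "(\<integral>\<^sup>+\<omega>. ennreal (norm (v \<omega>)) \<partial>M) \<le> (\<integral>\<^sup>+\<omega>. 1 + ennreal (norm (v \<omega>)) ^ 2 \<partial>M)"
  proof (rule nn_integral_mono)
    fix \<omega>
    have "0 \<le> (norm (v \<omega>) - 1) ^ 2" by simp
    then have "2 * norm (v \<omega>) \<le> 1 + norm (v \<omega>) ^ 2" by (simp add: power2_diff)
    then have "norm (v \<omega>) \<le> 1 + norm (v \<omega>) ^ 2" using norm_ge_zero[of "v \<omega>"] by linarith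
    then have "ennreal (norm (v \<omega>)) \<le> ennreal (1 + norm (v \<omega>) ^ 2)" by (rule ennreal_leI)
    then show "ennreal (norm (v \<omega>)) \<le> 1 + ennreal (norm (v \<omega>)) ^ 2" by (simp add: ennreal_power)
  qed
  also have "\<dots> = 1 + (\<integral>\<^sup>+\<omega>. ennreal (norm (v \<omega>)) ^ 2 \<partial>M)"
    using measurable_compose[OF assms(1), of "\<lambda>x. ennreal (norm x) ^ 2"]
    by (subst nn_integral_add) (simp_all add: emeasure_space_1)
  also have "\<dots> < \<infinity>" using assms(2) by simp
  finally show "(\<integral>\<^sup>+\<omega>. ennreal (norm (v \<omega>)) \<partial>M) < \<infinity>" .
qed

lemma vec_Lp2_integrable: "t \<in> {0..T} \<Longrightarrow> v \<in> vec_Lp 2 M (F t) \<Longrightarrow> integrable M (v :: 'w \<Rightarrow> 'v::euclidean_space)"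
  by (intro vec_L2_integrable vec_Lp_measurable[OF subalg]) (auto dest: vec_LpD)

lemma L2_process_bound:
  fixes g :: "real \<Rightarrow> 'w \<Rightarrow> 'v::euclidean_space" and h :: "real \<Rightarrow> 'w \<Rightarrow> 'u::euclidean_space"
  assumes g: "case_prod g \<in> borel_measurable prog" and h: "L2_process h"
    and le: "\<And>s \<omega>. s \<in> {0..T} \<Longrightarrow> \<omega> \<in> space M \<Longrightarrow> norm (g s \<omega>) \<le> c * norm (h s \<omega>)"
  shows "L2_process g"
proof -
  have h2: "case_prod (\<lambda>s \<omega>. ennreal (norm (h s \<omega>)) ^ 2) \<in> borel_measurable prog"
    using h by (intro prog_compose[of h borel "\<lambda>x. ennreal (norm x) ^ 2"]) (auto simp: L2_process_def)
  have "process_sq g \<le>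
    (\<integral>\<^sup>+\<omega>. (\<integral>\<^sup>+s\<in>{0..T}. ennreal (c\<^sup>2) * ennreal (norm (h s \<omega>)) ^ 2 \<partial>lborel) \<partial>M)"
  proof (intro nn_integral_mono)
    fix \<omega> s assume \<omega>: "\<omega> \<in> space M"
    show "ennreal (norm (g s \<omega>)) ^ 2 * indicator {0..T} s \<le> ennreal (c\<^sup>2) * ennreal (norm (h s \<omega>)) ^ 2 * indicator {0..T} s"
    proof (cases "s \<in> {0..T}")
      case True
      have "norm (g s \<omega>) ^ 2 \<le> (c * norm (h s \<omega>)) ^ 2" using le[OF True \<omega>] by (intro power_mono) auto
      then have "ennreal (norm (g s \<omega>) ^ 2) \<le> ennreal (c\<^sup>2 * norm (h s \<omega>) ^ 2)"
        by (intro ennreal_leI) (simp add: power_mult_distrib)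
      then show ?thesis using True by (simp add: ennreal_mult ennreal_power)
    qed simp
  qed
  also have "\<dots> = (\<integral>\<^sup>+s\<in>{0..T}. (\<integral>\<^sup>+\<omega>. ennreal (c\<^sup>2) * ennreal (norm (h s \<omega>)) ^ 2 \<partial>M) \<partial>lborel)"
    by (intro nn_time_Fubini prog_compose[OF h2, of "\<lambda>x. ennreal (c\<^sup>2) * x"]) auto
  also have "\<dots> = (\<integral>\<^sup>+s\<in>{0..T}. ennreal (c\<^sup>2) * (\<integral>\<^sup>+\<omega>. ennreal (norm (h s \<omega>)) ^ 2 \<partial>M) \<partial>lborel)"
  proof (rule nn_integral_cong)
    fix s
    show "(\<integral>\<^sup>+\<omega>. ennreal (c\<^sup>2) * ennreal (norm (h s \<omega>)) ^ 2 \<partial>M) * indicator {0..T} s =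
      ennreal (c\<^sup>2) * (\<integral>\<^sup>+\<omega>. ennreal (norm (h s \<omega>)) ^ 2 \<partial>M) * indicator {0..T} s"
    proof (cases "s \<in> {0..T}")
      case True
      then show ?thesis using measurable_F_M[OF True prog_section[OF h2 True]] by (simp add: nn_integral_cmult)
    qed simp
  qed
  also have "\<dots> = ennreal (c\<^sup>2) * (\<integral>\<^sup>+s\<in>{0..T}. (\<integral>\<^sup>+\<omega>. ennreal (norm (h s \<omega>)) ^ 2 \<partial>M) \<partial>lborel)"
    unfolding mult.assoc by (rule nn_integral_cmult[OF nn_expectation_measurable[OF h2]])
  also have "(\<integral>\<^sup>+s\<in>{0..T}. (\<integral>\<^sup>+\<omega>. ennreal (norm (h s \<omega>)) ^ 2 \<partial>M) \<partial>lborel) = process_sq h"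
    by (rule nn_time_Fubini[OF h2, symmetric]) auto
  also have "ennreal (c\<^sup>2) * \<dots> < \<infinity>" using h by (simp add: L2_process_def ennreal_mult_less_top)
  finally show ?thesis using g by (simp add: L2_process_def)
qed

lemma prog_sec_nn:
  assumes g: "case_prod g \<in> borel_measurable prog" and \<omega>: "\<omega> \<in> space M"
  shows "(\<lambda>s. (g s \<omega> :: ennreal) * indicator {0..T} s) \<in> borel_measurable lborel"
proof -
  have "(\<lambda>s. (\<lambda>(\<omega>, s). if s \<in> {0..T} then g s \<omega> else 0) (\<omega>, s)) \<in> borel_measurable lborel"
    using prog_If_M[OF g, of 0] \<omega> by (intro measurable_compose[OF measurable_Pair1']) auto
  also have "(\<lambda>s. (\<lambda>(\<omega>, s). if s \<in> {0..T} then g s \<omega> else 0) (\<omega>, s)) = (\<lambda>s. g s \<omega> * indicator {0..T} s)"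
    by (auto simp: fun_eq_iff)
  finally show ?thesis .
qed

lemma L2_process_add:
  fixes g h :: "real \<Rightarrow> 'w \<Rightarrow> 'v::euclidean_space"
  assumes g: "L2_process g" and h: "L2_process h"
  shows "L2_process (\<lambda>s \<omega>. g s \<omega> + h s \<omega>)"
proof -
  have gm: "case_prod g \<in> borel_measurable prog" and hm: "case_prod h \<in> borel_measurable prog"
    using g h by (auto simp: L2_process_def)
  have m: "case_prod (\<lambda>s \<omega>. g s \<omega> + h s \<omega>) \<in> borel_measurable prog"
    using gm hm unfolding case_prod_unfold by (intro borel_measurable_add) auto
  have sq: "case_prod (\<lambda>s \<omega>. ennreal (norm (k s \<omega>)) ^ 2) \<in> borel_measurable prog"
    if "case_prod k \<in> borel_measurable prog" for k :: "real \<Rightarrow> 'w \<Rightarrow> 'v"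
    by (rule prog_compose[OF that, of "\<lambda>x. ennreal (norm x) ^ 2"]) simp
  have "(\<integral>\<^sup>+\<omega>. (\<integral>\<^sup>+s\<in>{0..T}. ennreal (norm (g s \<omega> + h s \<omega>)) ^ 2 \<partial>lborel) \<partial>M) \<le>
    (\<integral>\<^sup>+\<omega>. 2 ^ 2 * ((\<integral>\<^sup>+s\<in>{0..T}. ennreal (norm (g s \<omega>)) ^ 2 \<partial>lborel) + (\<integral>\<^sup>+s\<in>{0..T}. ennreal (norm (h s \<omega>)) ^ 2 \<partial>lborel)) \<partial>M)"
  proof (rule nn_integral_mono)
    fix \<omega> assume \<omega>: "\<omega> \<in> space M"
    note gs = prog_sec_nn[OF sq[OF gm] \<omega>] and hs = prog_sec_nn[OF sq[OF hm] \<omega>]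
    have "(\<integral>\<^sup>+s\<in>{0..T}. ennreal (norm (g s \<omega> + h s \<omega>)) ^ 2 \<partial>lborel) \<le>
      (\<integral>\<^sup>+s. 2 ^ 2 * (ennreal (norm (g s \<omega>)) ^ 2 * indicator {0..T} s + ennreal (norm (h s \<omega>)) ^ 2 * indicator {0..T} s) \<partial>lborel)"
    proof (rule nn_integral_mono)
      fix s
      show "ennreal (norm (g s \<omega> + h s \<omega>)) ^ 2 * indicator {0..T} s \<le>
        2 ^ 2 * (ennreal (norm (g s \<omega>)) ^ 2 * indicator {0..T} s + ennreal (norm (h s \<omega>)) ^ 2 * indicator {0..T} s)"
        using ennreal_norm_add_power_le[of "g s \<omega>" "h s \<omega>" 2] by (cases "s \<in> {0..T}") simp_all
    qed
    also have "\<dots> = 2 ^ 2 * ((\<integral>\<^sup>+s\<in>{0..T}. ennreal (norm (g s \<omega>)) ^ 2 \<partial>lborel) + (\<integral>\<^sup>+s\<in>{0..T}. ennreal (norm (h s \<omega>)) ^ 2 \<partial>lborel))"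
      unfolding nn_integral_add[OF gs hs, symmetric] by (rule nn_integral_cmult[OF borel_measurable_add[OF gs hs]])
    finally show "(\<integral>\<^sup>+s\<in>{0..T}. ennreal (norm (g s \<omega> + h s \<omega>)) ^ 2 \<partial>lborel) \<le> \<dots>" .
  qed
  also have "\<dots> = 2 ^ 2 * (process_sq g + process_sq h)"
  proof -
    have gM: "(\<lambda>\<omega>. \<integral>\<^sup>+s\<in>{0..T}. ennreal (norm (g s \<omega>)) ^ 2 \<partial>lborel) \<in> borel_measurable M"
      by (rule nn_time_integral_measurable[OF sq[OF gm]]) auto
    have hM: "(\<lambda>\<omega>. \<integral>\<^sup>+s\<in>{0..T}. ennreal (norm (h s \<omega>)) ^ 2 \<partial>lborel) \<in> borel_measurable M"
      by (rule nn_time_integral_measurable[OF sq[OF hm]]) auto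
    show ?thesis
      unfolding nn_integral_add[OF gM hM, symmetric] by (rule nn_integral_cmult[OF borel_measurable_add[OF gM hM]])
  qed
  also have "\<dots> < \<infinity>" using g h by (simp add: L2_process_def ennreal_mult_less_top power_less_top_ennreal)
  finally show ?thesis using m by (simp add: L2_process_def)
qed

text \<open>All values are compact and convex, so the extended \<open>set_norm\<close> may be
  replaced by the real \<open>nrm\<close>; the conditions indexed by t become one condition on
  \<open>prog\<close>.\<close>

lemma set_process_L2_iff:
  fixes \<Phi> :: "real \<Rightarrow> 'w \<Rightarrow> 'v::euclidean_space set"
  shows "\<Phi> \<in> set_process_L2 M F T \<longleftrightarrow> set_measurable prog (case_prod \<Phi>) \<and>
    (\<forall>t\<in>{0..T}. \<forall>\<omega>\<in>space M. \<Phi> t \<omega> \<in> compact_convex_sets) \<and> L2_process (\<lambda>t \<omega>. nrm (\<Phi> t \<omega>))"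
proof -
  have "(\<integral>\<^sup>+\<omega>. (\<integral>\<^sup>+t\<in>{0..T}. set_norm (\<Phi> t \<omega>) ^ 2 \<partial>lborel) \<partial>M) =
    (\<integral>\<^sup>+\<omega>. (\<integral>\<^sup>+t\<in>{0..T}. ennreal (norm (nrm (\<Phi> t \<omega>))) ^ 2 \<partial>lborel) \<partial>M)"
    if K: "\<forall>t\<in>{0..T}. \<forall>\<omega>\<in>space M. \<Phi> t \<omega> \<in> compact_convex_sets"
  proof (intro nn_integral_cong)
    fix \<omega> t assume \<omega>: "\<omega> \<in> space M"
    show "set_norm (\<Phi> t \<omega>) ^ 2 * indicator {0..T} t = ennreal (norm (nrm (\<Phi> t \<omega>))) ^ 2 * indicator {0..T} t"
    proof (cases "t \<in> {0..T}")
      case True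
      then have "\<Phi> t \<omega> \<in> compact_convex_sets" using K \<omega> by blast
      then show ?thesis by (simp add: set_norm_eq nrm_nonneg)
    qed simp
  qed
  moreover have "case_prod (\<lambda>t \<omega>. nrm (\<Phi> t \<omega>)) \<in> borel_measurable prog"
    if "set_measurable prog (case_prod \<Phi>)" "\<forall>t\<in>{0..T}. \<forall>\<omega>\<in>space M. \<Phi> t \<omega> \<in> compact_convex_sets"
    using hdist_measurable[OF that(1) _ set_measurable_const[OF ccs_closed_sets[OF zero_ccs]] zero_ccs] that(2)
    by (auto simp: space_prog case_prod_unfold)
  ultimately show ?thesis
    unfolding set_process_L2_def set_progressive_iff L2_process_def mem_Collect_eq by auto
qed

lemma set_integral_mono_time:
  fixes g h :: "real \<Rightarrow> real"
  assumes g: "set_integrable lborel {0..T} g" and h: "set_integrable lborel {0..T} h"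
    and le: "AE s in lborel. s \<in> {0..T} \<longrightarrow> g s \<le> h s" and t: "t \<in> {0..T}"
  shows "(LBINT s:{t..T}. g s) \<le> (LBINT s:{t..T}. h s)"
  unfolding set_lebesgue_integral_def
proof (rule integral_mono_AE)
  have "set_integrable lborel {t..T} g" using g t by (rule_tac set_integrable_subset) auto
  then show "integrable lborel (\<lambda>s. indicator {t..T} s *\<^sub>R g s)" by (simp add: set_integrable_def)
  have "set_integrable lborel {t..T} h" using h t by (rule_tac set_integrable_subset) auto
  then show "integrable lborel (\<lambda>s. indicator {t..T} s *\<^sub>R h s)" by (simp add: set_integrable_def)
  show "AE s in lborel. indicator {t..T} s *\<^sub>R g s \<le> indicator {t..T} s *\<^sub>R h s"
    using le by eventually_elim (use t in \<open>auto simp: indicator_def\<close>)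
qed

lemma inner_time_integral:
  fixes g :: "real \<Rightarrow> 'u::euclidean_space"
  assumes g: "set_integrable lborel {0..T} g" and t: "t \<in> {0..T}"
  shows "set_integrable lborel {0..T} (\<lambda>s. p \<bullet> g s)" "p \<bullet> (LBINT s:{t..T}. g s) = (LBINT s:{t..T}. p \<bullet> g s)"
proof -
  show "set_integrable lborel {0..T} (\<lambda>s. p \<bullet> g s)"
    using integrable_inner_right[of p lborel, OF g[unfolded set_integrable_def]] by (simp add: set_integrable_def)
  have "set_integrable lborel {t..T} g" using g t by (rule_tac set_integrable_subset) auto
  then have "p \<bullet> (LBINT s:{t..T}. g s) = (\<integral>s. p \<bullet> (indicator {t..T} s *\<^sub>R g s) \<partial>lborel)"
    unfolding set_lebesgue_integral_def set_integrable_def by (intro integral_inner_right[symmetric])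
  also have "\<dots> = (LBINT s:{t..T}. p \<bullet> g s)" by (simp add: set_lebesgue_integral_def)
  finally show "p \<bullet> (LBINT s:{t..T}. g s) = (LBINT s:{t..T}. p \<bullet> g s)" .
qed

context
  fixes \<Phi> :: "real \<Rightarrow> 'w \<Rightarrow> 'v::euclidean_space set"
  assumes \<Phi>: "\<Phi> \<in> set_process_L2 M F T"
begin

lemma process_measurable: "set_measurable prog (case_prod \<Phi>)"
  using \<Phi> unfolding set_process_L2_iff by blast

lemma process_ccs: "t \<in> {0..T} \<Longrightarrow> \<omega> \<in> space M \<Longrightarrow> \<Phi> t \<omega> \<in> compact_convex_sets"
  using \<Phi> unfolding set_process_L2_iff by blast

lemma process_nrm_L2: "L2_process (\<lambda>t \<omega>. nrm (\<Phi> t \<omega>))"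
  using \<Phi> unfolding set_process_L2_iff by blast

lemma process_ccs': "x \<in> space prog \<Longrightarrow> case_prod \<Phi> x \<in> compact_convex_sets"
  using process_ccs by (auto simp: space_prog)

lemma process_supp_L2: "L2_process (\<lambda>t \<omega>. supp (\<Phi> t \<omega>) p)"
proof (rule L2_process_bound[OF _ process_nrm_L2])
  have "(\<lambda>x. supp (case_prod \<Phi> x) p) \<in> borel_measurable prog"
    by (intro supp_measurable process_measurable ccsD(2) process_ccs')
  then show "(\<lambda>(t, \<omega>). supp (\<Phi> t \<omega>) p) \<in> borel_measurable prog" by (simp add: case_prod_unfold)
  show "norm (supp (\<Phi> t \<omega>) p) \<le> norm p * norm (nrm (\<Phi> t \<omega>))" if "t \<in> {0..T}" "\<omega> \<in> space M" for t \<omega>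
    using abs_supp_le[OF process_ccs[OF that], of p] nrm_nonneg[OF process_ccs[OF that]] by simp
qed

lemma process_selectorD:
  assumes "\<phi> \<in> process_selectors M F T \<Phi>"
  shows "L2_process \<phi>" "AE \<omega> in M. AE s in lborel. s \<in> {0..T} \<longrightarrow> \<phi> s \<omega> \<in> \<Phi> s \<omega>"
  using assms AE_time_swap unfolding process_selectors_def progressive_iff L2_process_def by blast+

lemma process_selectorI:
  assumes "L2_process \<phi>" "\<And>s \<omega>. s \<in> {0..T} \<Longrightarrow> \<omega> \<in> space M \<Longrightarrow> \<phi> s \<omega> \<in> \<Phi> s \<omega>"
  shows "\<phi> \<in> process_selectors M F T \<Phi>"
proof -
  have "AE (t, \<omega>) in lborel \<Otimes>\<^sub>M M. t \<in> {0..T} \<longrightarrow> \<phi> t \<omega> \<in> \<Phi> t \<omega>"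
    using assms(2) by (intro AE_I2) (auto simp: space_pair_measure)
  with assms(1) show ?thesis unfolding process_selectors_def progressive_iff L2_process_def by simp
qed

text \<open>Near-optimal selection on \<open>prog\<close>; square integrability is inherited from
  \<open>nrm (\<Phi> s \<omega>)\<close>, which dominates every selector.\<close>

lemma eps_process_selector:
  assumes "0 < eps"
  obtains \<phi> where "\<phi> \<in> process_selectors M F T \<Phi>"
    "\<And>s \<omega>. s \<in> {0..T} \<Longrightarrow> \<omega> \<in> space M \<Longrightarrow> supp (\<Phi> s \<omega>) p - eps \<le> p \<bullet> \<phi> s \<omega>"
proof -
  obtain g where g: "g \<in> borel_measurable prog" "\<And>x. x \<in> space prog \<Longrightarrow> g x \<in> case_prod \<Phi> x"
    "\<And>x. x \<in> space prog \<Longrightarrow> supp (case_prod \<Phi> x) p - eps \<le> p \<bullet> g x"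
    using eps_support_selection[OF process_measurable ccsD(2)[OF process_ccs'] assms] by blast
  define \<phi> where "\<phi> s \<omega> = g (s, \<omega>)" for s \<omega>
  have in_\<Phi>: "\<phi> s \<omega> \<in> \<Phi> s \<omega>" if "s \<in> {0..T}" "\<omega> \<in> space M" for s \<omega>
    using g(2)[of "(s, \<omega>)"] that by (simp add: \<phi>_def space_prog)
  have "L2_process \<phi>"
  proof (rule L2_process_bound[OF _ process_nrm_L2])
    show "case_prod \<phi> \<in> borel_measurable prog" using g(1) by (simp add: \<phi>_def case_prod_unfold)
    show "norm (\<phi> t \<omega>) \<le> 1 * norm (nrm (\<Phi> t \<omega>))" if "t \<in> {0..T}" "\<omega> \<in> space M" for t \<omega>
      using norm_le_nrm[OF process_ccs[OF that] in_\<Phi>[OF that]] by simp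
  qed
  then show ?thesis using in_\<Phi> g(3) by (intro that[of \<phi>] process_selectorI) (auto simp: \<phi>_def space_prog)
qed

abbreviation selector_integrals :: "real \<Rightarrow> ('w \<Rightarrow> 'v) set" where
  "selector_integrals t \<equiv> (\<lambda>\<phi> \<omega>. LBINT s:{t..T}. \<phi> s \<omega>) ` process_selectors M F T \<Phi>"

lemma selector_integrals_ne: "selector_integrals t \<noteq> {}"
  using eps_process_selector[of 1] by auto

lemma selector_integrals_L2: "t \<in> {0..T} \<Longrightarrow> selector_integrals t \<subseteq> vec_Lp 2 M (F T)"
  using L2_process_integral_vec_Lp[OF process_selectorD(1) _ T_in] by auto

lemma set_time_integral_exists:
  assumes t: "t \<in> {0..T}"
  obtains I where "is_set_time_integral M F T t \<Phi> I"
proof -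
  note sub = subalg[OF T_in] and props = dec_closure_props[OF subalg[OF T_in] selector_integrals_L2[OF t]]
  have "dec_closure M (F T) (selector_integrals t) \<noteq> {}" using props(1) selector_integrals_ne[of t] by blast
  then obtain I where "set_measurable (F T) I" "selectors 2 M (F T) I = dec_closure M (F T) (selector_integrals t)"
    using decomposable_eq_selectors[OF prob_space_axioms sub _ _ props(2,3,4)] by auto
  then show ?thesis using \<Phi> by (intro that) (simp add: is_set_time_integral_def)
qed

text \<open>The selectors of any closed-valued C form a closed decomposable set, hence contain the
  decomposable closure as soon as they contain the selector integrals. Minimality among sets of
  functions thus becomes minimality among random sets.\<close>

lemma set_time_integral_hull:
  assumes t: "t \<in> {0..T}" and I: "is_set_time_integral M F T t \<Phi> I"
  shows "ess_hull M (selector_integrals t) I"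
proof (rule ess_hullI[OF finite_measure_axioms subalg[OF T_in]])
  note sub = subalg[OF T_in] and props = dec_closure_props[OF subalg[OF T_in] selector_integrals_L2[OF t]]
  have sel: "selectors 2 M (F T) I = dec_closure M (F T) (selector_integrals t)"
    using I by (simp add: is_set_time_integral_def)
  show "set_measurable (F T) I" using I by (simp add: is_set_time_integral_def)
  show "selector_integrals t \<noteq> {}" by (rule selector_integrals_ne)
  show "selector_integrals t \<subseteq> vec_Lp 2 M (F T)" by (rule selector_integrals_L2[OF t])
  show "selector_integrals t \<subseteq> selectors 2 M (F T) I" unfolding sel by (rule props(1))
  fix C :: "'w \<Rightarrow> 'v set"
  assume C: "\<And>\<omega>. \<omega> \<in> space M \<Longrightarrow> closed (C \<omega>)" "selector_integrals t \<subseteq> selectors 2 M (F T) C"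
  show "selectors 2 M (F T) I \<subseteq> selectors 2 M (F T) C"
    unfolding sel
  proof (rule dec_closure_least[OF C(2)])
    show "selectors 2 M (F T) C \<subseteq> vec_Lp 2 M (F T)" using selectorsD(1) by blast
    show "Lp_closure 2 M (F T) (selectors 2 M (F T) C) \<subseteq> selectors 2 M (F T) C"
      by (rule selectors_closed[OF sub C(1)]) simp_all
    show "decomposable (F T) (selectors 2 M (F T) C)" by (rule selectors_decomposable[OF sub])
  qed
qed

text \<open>The half-space whose random level is the integral of the support functions contains
  every selector integral; minimality transfers this to I.\<close>

lemma set_time_integral_supp:
  assumes t: "t \<in> {0..T}" and I: "is_set_time_integral M F T t \<Phi> I"
  shows "AE \<omega> in M. \<forall>x\<in>I \<omega>. p \<bullet> x \<le> (LBINT s:{t..T}. supp (\<Phi> s \<omega>) p)"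
proof -
  have "AE \<omega> in M. I \<omega> \<subseteq> {x. p \<bullet> x \<le> (LBINT s:{t..T}. supp (\<Phi> s \<omega>) p)}"
  proof (rule ess_hull_subset[OF set_time_integral_hull[OF t I] closed_halfspace_le])
    fix v assume "v \<in> selector_integrals t"
    then obtain \<phi> where \<phi>: "\<phi> \<in> process_selectors M F T \<Phi>" "v = (\<lambda>\<omega>. LBINT s:{t..T}. \<phi> s \<omega>)" by blast
    show "AE \<omega> in M. v \<omega> \<in> {x. p \<bullet> x \<le> (LBINT s:{t..T}. supp (\<Phi> s \<omega>) p)}"
      using process_selectorD(2)[OF \<phi>(1)] L2_process_AE_integrable[OF process_selectorD(1)[OF \<phi>(1)]]
        L2_process_AE_integrable[OF process_supp_L2[of p]] AE_space
    proof eventually_elim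
      case (elim \<omega>)
      have "AE s in lborel. s \<in> {0..T} \<longrightarrow> p \<bullet> \<phi> s \<omega> \<le> supp (\<Phi> s \<omega>) p"
        using elim(1) by eventually_elim (use elim(4) supp_ge ccsD(2) process_ccs in blast)
      from set_integral_mono_time[OF inner_time_integral(1)[OF elim(2) t] elim(3) this t]
      show ?case using inner_time_integral(2)[OF elim(2) t] \<phi>(2) by simp
    qed
  qed
  then show ?thesis by eventually_elim auto
qed

text \<open>The same argument with random balls. It yields the integrable bound under which the
  conditional expectation is defined.\<close>

lemma set_time_integral_norm:
  assumes t: "t \<in> {0..T}" and I: "is_set_time_integral M F T t \<Phi> I"
  shows "AE \<omega> in M. \<forall>x\<in>I \<omega>. norm x \<le> (LBINT s:{t..T}. nrm (\<Phi> s \<omega>))"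
proof -
  have "AE \<omega> in M. I \<omega> \<subseteq> cball 0 (LBINT s:{t..T}. nrm (\<Phi> s \<omega>))"
  proof (rule ess_hull_subset[OF set_time_integral_hull[OF t I] closed_cball])
    fix v assume "v \<in> selector_integrals t"
    then obtain \<phi> where \<phi>: "\<phi> \<in> process_selectors M F T \<Phi>" "v = (\<lambda>\<omega>. LBINT s:{t..T}. \<phi> s \<omega>)" by blast
    show "AE \<omega> in M. v \<omega> \<in> cball 0 (LBINT s:{t..T}. nrm (\<Phi> s \<omega>))"
      using process_selectorD(2)[OF \<phi>(1)] L2_process_AE_integrable[OF process_selectorD(1)[OF \<phi>(1)]]
        L2_process_AE_integrable[OF process_nrm_L2] AE_space
    proof eventually_elim
      case (elim \<omega>)
      have "AE s in lborel. s \<in> {0..T} \<longrightarrow> norm (\<phi> s \<omega>) \<le> nrm (\<Phi> s \<omega>)"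
        using elim(1) by eventually_elim (use elim(4) norm_le_nrm process_ccs in blast)
      from set_integral_mono_time[OF set_integrable_norm[OF elim(2)] elim(3) this t]
      have "(LBINT s:{t..T}. norm (\<phi> s \<omega>)) \<le> (LBINT s:{t..T}. nrm (\<Phi> s \<omega>))" .
      moreover have "set_integrable lborel {t..T} (\<lambda>s. \<phi> s \<omega>)"
        using elim(2) t by (rule_tac set_integrable_subset) auto
      from set_integral_norm_bound[OF this] have "norm (v \<omega>) \<le> (LBINT s:{t..T}. norm (\<phi> s \<omega>))" by (simp add: \<phi>(2))
      ultimately show ?case by simp
    qed
  qed
  then show ?thesis by eventually_elim auto
qed

text \<open>The midpoint of two process selectors is a selector because
  \<open>\<Phi> s \<omega>\<close> is convex, so midpoints of selector integrals are almost surely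
  selector integrals and \<open>ess_hull_convex\<close> applies.\<close>

lemma set_time_integral_convex:
  assumes t: "t \<in> {0..T}" and I: "is_set_time_integral M F T t \<Phi> I"
  shows "AE \<omega> in M. convex (I \<omega>)"
proof (rule ess_hull_convex[OF set_time_integral_hull[OF t I]])
  have "set_measurable (F T) I" using I by (simp add: is_set_time_integral_def)
  then show "closed (I \<omega>)" if "\<omega> \<in> space M" for \<omega>
    using that set_measurableD(1)[of "F T" I \<omega>] by (simp add: space_F[OF T_in])
  fix v w assume "v \<in> selector_integrals t" "w \<in> selector_integrals t"
  then obtain \<phi> \<psi> where \<phi>: "\<phi> \<in> process_selectors M F T \<Phi>" "v = (\<lambda>\<omega>. LBINT s:{t..T}. \<phi> s \<omega>)"
    and \<psi>: "\<psi> \<in> process_selectors M F T \<Phi>" "w = (\<lambda>\<omega>. LBINT s:{t..T}. \<psi> s \<omega>)" by blast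
  note L = process_selectorD(1)[OF \<phi>(1)] process_selectorD(1)[OF \<psi>(1)]
  let ?m = "\<lambda>s \<omega>. midpoint (\<phi> s \<omega>) (\<psi> s \<omega>)"
  have m_meas: "case_prod ?m \<in> borel_measurable prog"
    using L unfolding L2_process_def midpoint_def case_prod_unfold
    by (intro borel_measurable_scaleR borel_measurable_add) auto
  have in_\<Phi>: "AE (s, \<omega>) in lborel \<Otimes>\<^sub>M M. s \<in> {0..T} \<longrightarrow> ?m s \<omega> \<in> \<Phi> s \<omega>"
  proof -
    have "AE (s, \<omega>) in lborel \<Otimes>\<^sub>M M. s \<in> {0..T} \<longrightarrow> \<phi> s \<omega> \<in> \<Phi> s \<omega>" "AE (s, \<omega>) in lborel \<Otimes>\<^sub>M M. s \<in> {0..T} \<longrightarrow> \<psi> s \<omega> \<in> \<Phi> s \<omega>"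
      using \<phi>(1) \<psi>(1) by (simp_all add: process_selectors_def)
    then show ?thesis using AE_space
    proof eventually_elim
      case (elim x)
      obtain s \<omega> where x: "x = (s, \<omega>)" by fastforce
      show ?case unfolding x prod.case
      proof
        assume s: "s \<in> {0..T}"
        have "convex (\<Phi> s \<omega>)" using s elim(3) by (intro ccsD(3) process_ccs) (auto simp: x space_pair_measure)
        then have "closed_segment (\<phi> s \<omega>) (\<psi> s \<omega>) \<subseteq> \<Phi> s \<omega>"
          using s elim(1,2) by (intro closed_segment_subset) (simp_all add: x)
        then show "?m s \<omega> \<in> \<Phi> s \<omega>" using midpoint_in_closed_segment by blast
      qed
    qed
  qed
  have "L2_process ?m"
    by (rule L2_process_bound[OF m_meas L2_process_add[OF L], of "1/2"]) (simp add: midpoint_def)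
  then have "?m \<in> process_selectors M F T \<Phi>"
    using in_\<Phi> unfolding process_selectors_def progressive_iff L2_process_def by simp
  then have "AE \<omega> in M. (LBINT s:{t..T}. ?m s \<omega>) \<in> I \<omega>"
    by (intro ess_hullD(2)[OF set_time_integral_hull[OF t I], of "\<lambda>\<omega>. LBINT s:{t..T}. ?m s \<omega>"] imageI)
  then show "AE \<omega> in M. midpoint (v \<omega>) (w \<omega>) \<in> I \<omega>"
    using L2_process_AE_integrable[OF L(1)] L2_process_AE_integrable[OF L(2)]
  proof eventually_elim
    case (elim \<omega>)
    have "set_integrable lborel {t..T} (\<lambda>s. \<phi> s \<omega>)" "set_integrable lborel {t..T} (\<lambda>s. \<psi> s \<omega>)"
      using elim t by (auto intro: set_integrable_subset)
    then have "midpoint (v \<omega>) (w \<omega>) = (LBINT s:{t..T}. ?m s \<omega>)"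
      unfolding midpoint_def \<phi>(2) \<psi>(2) by (simp add: set_integral_add)
    then show ?case using elim(1) by simp
  qed
qed

end

end

subsection \<open>The right-hand side of the equation\<close>

lemma vec_Lp_add:
  fixes g h :: "'w \<Rightarrow> 'v::euclidean_space"
  assumes G: "subalgebra M G" and g: "g \<in> vec_Lp p M G" and h: "h \<in> vec_Lp p M G"
  shows "(\<lambda>\<omega>. g \<omega> + h \<omega>) \<in> vec_Lp p M G"
proof -
  note [measurable] = vec_Lp_measurable[OF G g] vec_Lp_measurable[OF G h]
  have "(\<integral>\<^sup>+\<omega>. ennreal (norm (g \<omega> + h \<omega>)) ^ p \<partial>M) \<le> (\<integral>\<^sup>+\<omega>. 2 ^ p * (ennreal (norm (g \<omega>)) ^ p + ennreal (norm (h \<omega>)) ^ p) \<partial>M)"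
    by (intro nn_integral_mono ennreal_norm_add_power_le)
  also have "\<dots> = 2 ^ p * ((\<integral>\<^sup>+\<omega>. ennreal (norm (g \<omega>)) ^ p \<partial>M) + (\<integral>\<^sup>+\<omega>. ennreal (norm (h \<omega>)) ^ p \<partial>M))"
    by (subst nn_integral_cmult; (subst nn_integral_add)?) simp_all
  also have "\<dots> < \<infinity>" using vec_LpD(2)[OF g] vec_LpD(2)[OF h] by (simp add: ennreal_mult_less_top power_less_top_ennreal)
  finally show ?thesis using vec_LpD(1)[OF g] vec_LpD(1)[OF h] by (simp add: vec_Lp_def)
qed

text \<open>Conditional Jensen for the square. A finite right-hand side makes X integrable; an
  infinite one is trivial.\<close>

lemma (in sub_prob) cond_exp_sq_le:
  fixes X :: "'w \<Rightarrow> real"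
  assumes X: "X \<in> borel_measurable M"
  shows "(\<integral>\<^sup>+\<omega>. ennreal (norm (real_cond_exp M G X \<omega>)) ^ 2 \<partial>M) \<le> (\<integral>\<^sup>+\<omega>. ennreal (norm (X \<omega>)) ^ 2 \<partial>M)"
proof (cases "(\<integral>\<^sup>+\<omega>. ennreal (norm (X \<omega>)) ^ 2 \<partial>M) = \<infinity>")
  case False
  have sq: "ennreal (norm x) ^ 2 = ennreal (x\<^sup>2)" for x :: real by (simp add: ennreal_power)
  have X2: "integrable M (\<lambda>\<omega>. (X \<omega>)\<^sup>2)"
  proof (rule integrableI_nonneg)
    show "(\<integral>\<^sup>+\<omega>. ennreal ((X \<omega>)\<^sup>2) \<partial>M) < \<infinity>" using False unfolding sq by (simp add: less_top)
  qed (use X in auto)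
  have X1: "integrable M X"
  proof (rule Bochner_Integration.integrable_bound)
    show "integrable M (\<lambda>\<omega>. 1 + (X \<omega>)\<^sup>2)" using X2 by simp
    show "AE \<omega> in M. norm (X \<omega>) \<le> norm (1 + (X \<omega>)\<^sup>2)"
    proof (rule AE_I2)
      fix \<omega>
      have "0 \<le> (\<bar>X \<omega>\<bar> - 1)\<^sup>2" by simp
      then have "2 * \<bar>X \<omega>\<bar> \<le> 1 + (X \<omega>)\<^sup>2" by (simp add: power2_diff)
      then show "norm (X \<omega>) \<le> norm (1 + (X \<omega>)\<^sup>2)" by simp
    qed
  qed (rule X)
  have "AE \<omega> in M. (real_cond_exp M G X \<omega>)\<^sup>2 \<le> real_cond_exp M G (\<lambda>\<omega>. (X \<omega>)\<^sup>2) \<omega>"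
    using X1 X2 by (intro S.real_cond_exp_jensens_inequality(2)[where I = UNIV]) (auto simp: convex_power2)
  then have "(\<integral>\<^sup>+\<omega>. ennreal (norm (real_cond_exp M G X \<omega>)) ^ 2 \<partial>M) \<le> (\<integral>\<^sup>+\<omega>. ennreal (real_cond_exp M G (\<lambda>\<omega>. (X \<omega>)\<^sup>2) \<omega>) \<partial>M)"
    unfolding sq by (intro nn_integral_mono_AE) (auto elim!: eventually_mono intro: ennreal_leI)
  also have "\<dots> = ennreal (\<integral>\<omega>. real_cond_exp M G (\<lambda>\<omega>. (X \<omega>)\<^sup>2) \<omega> \<partial>M)"
    using X2 by (intro nn_integral_eq_integral S.real_cond_exp_int S.real_cond_exp_pos) auto
  also have "\<dots> = ennreal (\<integral>\<omega>. (X \<omega>)\<^sup>2 \<partial>M)" by (simp add: S.real_cond_exp_int(2)[OF X2])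
  also have "\<dots> = (\<integral>\<^sup>+\<omega>. ennreal (norm (X \<omega>)) ^ 2 \<partial>M)"
    unfolding sq using X2 by (intro nn_integral_eq_integral[symmetric]) auto
  finally show ?thesis .
qed simp

text \<open>\<open>hdist\<close> is a supremum over countably many directions in the unit ball, so
  one null set suffices to compare all conditional expectations of \<open>V p\<close> with that of
  R. V will be the difference of two right-hand sides, or a single one compared with the set
  {0}.\<close>

lemma (in sub_prob) hdist_cond_exp_le:
  fixes Y1 Y2 :: "'w \<Rightarrow> 'v::euclidean_space set"
  assumes Y: "AE \<omega> in M. \<forall>p\<in>dirs. supp (Y1 \<omega>) p - supp (Y2 \<omega>) p = real_cond_exp M G (V p) \<omega>"
    and V: "\<And>p. integrable M (V p)" and R: "integrable M R"
    and le: "\<And>p. AE \<omega> in M. \<bar>V p \<omega>\<bar> \<le> norm p * R \<omega>" and R_pos: "AE \<omega> in M. 0 \<le> R \<omega>"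
  shows "AE \<omega> in M. hdist (Y1 \<omega>) (Y2 \<omega>) \<le> real_cond_exp M G R \<omega>"
proof -
  have "AE \<omega> in M. \<forall>p\<in>dirs. norm p \<le> 1 \<longrightarrow> \<bar>real_cond_exp M G (V p) \<omega>\<bar> \<le> real_cond_exp M G R \<omega>"
    unfolding AE_ball_countable[OF countable_dirs]
  proof
    fix p :: 'v
    show "AE \<omega> in M. norm p \<le> 1 \<longrightarrow> \<bar>real_cond_exp M G (V p) \<omega>\<bar> \<le> real_cond_exp M G R \<omega>"
    proof (cases "norm p \<le> 1")
      case True
      have 1: "AE \<omega> in M. \<bar>V p \<omega>\<bar> \<le> R \<omega>"
        using le[of p] R_pos
      proof eventually_elim
        case (elim \<omega>)
        then show ?case using mult_right_mono[OF True elim(2)] by simp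
      qed
      have "AE \<omega> in M. real_cond_exp M G (V p) \<omega> \<le> real_cond_exp M G R \<omega>"
        using 1 V R by (intro S.real_cond_exp_mono) (auto elim!: eventually_mono)
      moreover have "AE \<omega> in M. real_cond_exp M G (\<lambda>\<omega>. - 1 * V p \<omega>) \<omega> \<le> real_cond_exp M G R \<omega>"
        using 1 V R by (intro S.real_cond_exp_mono) (auto elim!: eventually_mono)
      moreover have "AE \<omega> in M. real_cond_exp M G (\<lambda>\<omega>. - 1 * V p \<omega>) \<omega> = - 1 * real_cond_exp M G (V p) \<omega>"
        by (rule S.real_cond_exp_cmult[OF V])
      ultimately show ?thesis by eventually_elim auto
    qed simp
  qed
  with Y show ?thesis
  proof eventually_elim
    case (elim \<omega>)
    then show ?case by (intro hdist_least) auto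
  qed
qed

context filtration
begin

lemma sub_prob_F: "t \<in> {0..T} \<Longrightarrow> sub_prob M (F t)"
  by (intro sub_prob.intro sub_prob_axioms.intro prob_space_axioms subalg)

text \<open>The support function, in direction p, of the random set under the conditional
  expectation, written down without choosing a version of the set-valued integral.\<close>

definition rhs :: "('w \<Rightarrow> 'v::euclidean_space set) \<Rightarrow> (real \<Rightarrow> 'w \<Rightarrow> 'v set) \<Rightarrow> real \<Rightarrow> 'v \<Rightarrow> 'w \<Rightarrow> real" where
  "rhs \<xi> \<Phi> t p \<omega> = supp (\<xi> \<omega>) p + (LBINT s:{t..T}. supp (\<Phi> s \<omega>) p)"

lemma set_Lp2D:
  fixes \<xi> :: "'w \<Rightarrow> 'v::euclidean_space set"
  assumes "\<xi> \<in> set_Lp 2 M (F T)"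
  shows "set_measurable (F T) \<xi>" "\<omega> \<in> space M \<Longrightarrow> \<xi> \<omega> \<in> compact_convex_sets"
    "(\<lambda>\<omega>. nrm (\<xi> \<omega>)) \<in> vec_Lp 2 M (F T)" "(\<lambda>\<omega>. supp (\<xi> \<omega>) p) \<in> vec_Lp 2 M (F T)"
proof -
  show m: "set_measurable (F T) \<xi>" and K: "\<And>\<omega>. \<omega> \<in> space M \<Longrightarrow> \<xi> \<omega> \<in> compact_convex_sets"
    using assms by (auto simp: set_Lp_def)
  note K' = K[folded space_F[OF T_in]]
  have nm: "(\<lambda>\<omega>. nrm (\<xi> \<omega>)) \<in> borel_measurable (F T)"
    by (rule hdist_measurable[OF m K' set_measurable_const[OF ccs_closed_sets[OF zero_ccs]] zero_ccs])
  have "(\<integral>\<^sup>+\<omega>. ennreal (norm (nrm (\<xi> \<omega>))) ^ 2 \<partial>M) = (\<integral>\<^sup>+\<omega>. set_norm (\<xi> \<omega>) ^ 2 \<partial>M)"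
    using K by (intro nn_integral_cong) (simp add: set_norm_eq nrm_nonneg)
  also have "\<dots> < \<infinity>" using assms by (simp add: set_Lp_def)
  finally have fin: "(\<integral>\<^sup>+\<omega>. ennreal (norm (nrm (\<xi> \<omega>))) ^ 2 \<partial>M) < \<infinity>" .
  with nm show "(\<lambda>\<omega>. nrm (\<xi> \<omega>)) \<in> vec_Lp 2 M (F T)" by (simp add: vec_Lp_def)
  have sm: "(\<lambda>\<omega>. supp (\<xi> \<omega>) p) \<in> borel_measurable (F T)"
    by (rule supp_measurable[OF m ccsD(2)[OF K']])
  have "(\<integral>\<^sup>+\<omega>. ennreal (norm (supp (\<xi> \<omega>) p)) ^ 2 \<partial>M) \<le> (\<integral>\<^sup>+\<omega>. ennreal ((norm p)\<^sup>2) * ennreal (norm (nrm (\<xi> \<omega>))) ^ 2 \<partial>M)"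
  proof (rule nn_integral_mono)
    fix \<omega> assume "\<omega> \<in> space M"
    then have "norm (supp (\<xi> \<omega>) p) ^ 2 \<le> (norm p * norm (nrm (\<xi> \<omega>))) ^ 2"
      using abs_supp_le[OF K, of \<omega> p] nrm_nonneg[OF K, of \<omega>] by (intro power_mono) auto
    then have "ennreal (norm (supp (\<xi> \<omega>) p) ^ 2) \<le> ennreal ((norm p)\<^sup>2 * norm (nrm (\<xi> \<omega>)) ^ 2)"
      by (intro ennreal_leI) (simp add: power_mult_distrib)
    then show "ennreal (norm (supp (\<xi> \<omega>) p)) ^ 2 \<le> ennreal ((norm p)\<^sup>2) * ennreal (norm (nrm (\<xi> \<omega>))) ^ 2"
      by (simp add: ennreal_mult ennreal_power)
  qed
  also have "\<dots> = ennreal ((norm p)\<^sup>2) * (\<integral>\<^sup>+\<omega>. ennreal (norm (nrm (\<xi> \<omega>))) ^ 2 \<partial>M)"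
    by (rule nn_integral_cmult) (use measurable_F_M[OF T_in nm] in measurable)
  also have "\<dots> < \<infinity>" using fin by (simp add: ennreal_mult_less_top)
  finally show "(\<lambda>\<omega>. supp (\<xi> \<omega>) p) \<in> vec_Lp 2 M (F T)" using sm by (simp add: vec_Lp_def)
qed

context
  fixes \<xi> :: "'w \<Rightarrow> (real ^ 'd) set" and \<Phi> :: "real \<Rightarrow> 'w \<Rightarrow> (real ^ 'd) set" and t :: real
  assumes \<xi>: "\<xi> \<in> set_Lp 2 M (F T)" and \<Phi>: "\<Phi> \<in> set_process_L2 M F T" and t: "t \<in> {0..T}"
begin

lemma rhs_L2: "rhs \<xi> \<Phi> t p \<in> vec_Lp 2 M (F T)"
  unfolding rhs_def using t
  by (intro vec_Lp_add[OF subalg[OF T_in]] set_Lp2D[OF \<xi>] L2_process_integral_vec_Lp[OF process_supp_L2[OF \<Phi>]] T_in) auto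

lemma rhs_integrable: "integrable M (rhs \<xi> \<Phi> t p)"
  by (rule vec_Lp2_integrable[OF T_in rhs_L2])

lemma nrm_rhs_L2: "(\<lambda>\<omega>. nrm (\<xi> \<omega>) + (LBINT s:{t..T}. nrm (\<Phi> s \<omega>))) \<in> vec_Lp 2 M (F T)"
  using t by (intro vec_Lp_add[OF subalg[OF T_in]] set_Lp2D(3)[OF \<xi>] L2_process_integral_vec_Lp[OF process_nrm_L2[OF \<Phi>]] T_in) auto

text \<open>These are the premises of \<open>set_cond_exp_supp\<close> for the sum of \<xi> and a
  version of the integral, with \<open>rhs\<close> as its support function.\<close>

lemma step_sum:
  assumes I: "is_set_time_integral M F T t \<Phi> I"
  shows "integrably_bounded M (\<lambda>\<omega>. \<xi> \<omega> + I \<omega>)" "AE \<omega> in M. convex (\<xi> \<omega> + I \<omega>)"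
    "AE \<omega> in M. \<forall>x\<in>\<xi> \<omega> + I \<omega>. p \<bullet> x \<le> rhs \<xi> \<Phi> t p \<omega>"
    "0 < e \<Longrightarrow> \<exists>g\<in>selectors 1 M M (\<lambda>\<omega>. \<xi> \<omega> + I \<omega>). AE \<omega> in M. rhs \<xi> \<Phi> t p \<omega> - e \<le> p \<bullet> g \<omega>"
proof -
  have Im: "set_measurable (F T) I" using I by (simp add: is_set_time_integral_def)
  have Xm: "set_measurable M (\<lambda>\<omega>. \<xi> \<omega> + I \<omega>)"
    by (intro set_measurable_plus set_measurable_F_M[OF T_in] set_Lp2D(1)[OF \<xi>] Im ccsD(2) set_Lp2D(2)[OF \<xi>])
  have "(\<integral>\<^sup>+\<omega>. set_norm (\<xi> \<omega> + I \<omega>) \<partial>M) \<le> (\<integral>\<^sup>+\<omega>. ennreal (nrm (\<xi> \<omega>) + (LBINT s:{t..T}. nrm (\<Phi> s \<omega>))) \<partial>M)"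
  proof (rule nn_integral_mono_AE)
    show "AE \<omega> in M. set_norm (\<xi> \<omega> + I \<omega>) \<le> ennreal (nrm (\<xi> \<omega>) + (LBINT s:{t..T}. nrm (\<Phi> s \<omega>)))"
      using set_time_integral_norm[OF \<Phi> t I] AE_space
    proof eventually_elim
      case (elim \<omega>)
      show ?case
      proof (rule set_norm_le)
        show "\<xi> \<omega> + I \<omega> \<noteq> {}" using set_measurableD(2)[OF Xm elim(2)] .
        fix x assume "x \<in> \<xi> \<omega> + I \<omega>"
        then obtain a b where "x = a + b" "a \<in> \<xi> \<omega>" "b \<in> I \<omega>" by (rule set_plus_elim)
        then show "norm x \<le> nrm (\<xi> \<omega>) + (LBINT s:{t..T}. nrm (\<Phi> s \<omega>))"
          using norm_triangle_mono[OF norm_le_nrm[OF set_Lp2D(2)[OF \<xi> elim(2)]] bspec[OF elim(1)], of a b] by simp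
      qed
    qed
  qed
  also have "\<dots> \<le> (\<integral>\<^sup>+\<omega>. ennreal (norm (nrm (\<xi> \<omega>) + (LBINT s:{t..T}. nrm (\<Phi> s \<omega>)))) \<partial>M)"
    by (intro nn_integral_mono ennreal_leI) simp
  also have "\<dots> < \<infinity>" using vec_Lp2_integrable[OF T_in nrm_rhs_L2] by (simp add: integrable_iff_bounded)
  finally show "integrably_bounded M (\<lambda>\<omega>. \<xi> \<omega> + I \<omega>)" using Xm by (simp add: integrably_bounded_def)
  show "AE \<omega> in M. convex (\<xi> \<omega> + I \<omega>)"
    using set_time_integral_convex[OF \<Phi> t I] AE_space
  proof eventually_elim
    case (elim \<omega>)
    show ?case by (rule convex_set_plus[OF ccsD(3)[OF set_Lp2D(2)[OF \<xi> elim(2)]] elim(1)])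
  qed
  show "AE \<omega> in M. \<forall>x\<in>\<xi> \<omega> + I \<omega>. p \<bullet> x \<le> rhs \<xi> \<Phi> t p \<omega>"
    using set_time_integral_supp[OF \<Phi> t I, of p] AE_space
  proof eventually_elim
    case (elim \<omega>)
    show ?case
    proof
      fix x assume "x \<in> \<xi> \<omega> + I \<omega>"
      then obtain a b where x: "x = a + b" "a \<in> \<xi> \<omega>" "b \<in> I \<omega>" by (rule set_plus_elim)
      have "p \<bullet> a \<le> supp (\<xi> \<omega>) p" by (rule supp_ge[OF ccsD(2)[OF set_Lp2D(2)[OF \<xi> elim(2)]] x(2)])
      with elim(1) x show "p \<bullet> x \<le> rhs \<xi> \<Phi> t p \<omega>" by (auto simp: rhs_def inner_add_right intro: add_mono)
    qed
  qed
  assume e: "0 < e"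
  have ccs': "compact (\<xi> \<omega>)" if "\<omega> \<in> space (F T)" for \<omega>
    using that by (intro ccsD(2) set_Lp2D(2)[OF \<xi>]) (simp add: space_F[OF T_in])
  obtain a where a: "a \<in> borel_measurable (F T)" "\<And>\<omega>. \<omega> \<in> space (F T) \<Longrightarrow> a \<omega> \<in> \<xi> \<omega>"
    "\<And>\<omega>. \<omega> \<in> space (F T) \<Longrightarrow> supp (\<xi> \<omega>) p - e/2 \<le> p \<bullet> a \<omega>"
    using eps_support_selection[OF set_Lp2D(1)[OF \<xi>] ccs', of "e/2" p] e by auto
  \<comment> \<open>The tolerance e/2 left for the integral, spread over an interval of length at
    most T.\<close>
  have e': "0 < e / (2 * T)" using e T_pos by simp
  obtain \<phi> where \<phi>: "\<phi> \<in> process_selectors M F T \<Phi>"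
    "\<And>s \<omega>. s \<in> {0..T} \<Longrightarrow> \<omega> \<in> space M \<Longrightarrow> supp (\<Phi> s \<omega>) p - e / (2 * T) \<le> p \<bullet> \<phi> s \<omega>"
    using eps_process_selector[OF \<Phi> e', of p] by auto
  define b where "b \<omega> = (LBINT s:{t..T}. \<phi> s \<omega>)" for \<omega>
  have b_I: "AE \<omega> in M. b \<omega> \<in> I \<omega>"
    unfolding b_def using \<phi>(1)
    by (intro ess_hullD(2)[OF set_time_integral_hull[OF \<Phi> t I], of "\<lambda>\<omega>. LBINT s:{t..T}. \<phi> s \<omega>"] imageI)
  have "b \<in> vec_Lp 2 M (F T)"
    unfolding b_def using t by (intro L2_process_integral_vec_Lp[OF process_selectorD(1)[OF \<Phi> \<phi>(1)]] T_in) auto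
  then have ib: "integrable M b" by (rule vec_Lp2_integrable[OF T_in])
  have ia: "integrable M a"
  proof (rule Bochner_Integration.integrable_bound)
    show "integrable M (\<lambda>\<omega>. nrm (\<xi> \<omega>))" by (rule vec_Lp2_integrable[OF T_in set_Lp2D(3)[OF \<xi>]])
    show "a \<in> borel_measurable M" by (rule measurable_F_M[OF T_in a(1)])
    show "AE \<omega> in M. norm (a \<omega>) \<le> norm (nrm (\<xi> \<omega>))"
    proof (rule AE_I2)
      fix \<omega> assume \<omega>: "\<omega> \<in> space M"
      then have "norm (a \<omega>) \<le> nrm (\<xi> \<omega>)" by (intro norm_le_nrm set_Lp2D(2)[OF \<xi>] a(2)) (simp_all add: space_F[OF T_in])
      then show "norm (a \<omega>) \<le> norm (nrm (\<xi> \<omega>))" by simp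
    qed
  qed
  let ?g = "\<lambda>\<omega>. a \<omega> + b \<omega>"
  have "integrable M ?g" using ia ib by simp
  moreover have "AE \<omega> in M. ?g \<omega> \<in> \<xi> \<omega> + I \<omega>"
    using b_I AE_space by eventually_elim (simp add: a(2) space_F[OF T_in] set_plus_intro)
  ultimately have "?g \<in> selectors 1 M M (\<lambda>\<omega>. \<xi> \<omega> + I \<omega>)"
    using vec_L1_iff[of M M ?g] by (simp add: selectors_def subalgebra_def)
  moreover have "AE \<omega> in M. rhs \<xi> \<Phi> t p \<omega> - e \<le> p \<bullet> ?g \<omega>"
    using L2_process_AE_integrable[OF process_selectorD(1)[OF \<Phi> \<phi>(1)]]
      L2_process_AE_integrable[OF process_supp_L2[OF \<Phi>, of p]] AE_space
  proof eventually_elim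
    case (elim \<omega>)
    have c: "set_integrable lborel {0..T} (\<lambda>_. e / (2 * T))"
      unfolding set_integrable_def using T_pos by (intro integrable_scaleR_left integrable_real_indicator) auto
    have t': "0 \<le> t" "t \<le> T" using t by auto
    have "(LBINT s:{t..T}. supp (\<Phi> s \<omega>) p - e / (2 * T)) \<le> (LBINT s:{t..T}. p \<bullet> \<phi> s \<omega>)"
      using \<phi>(2) elim(3) by (intro set_integral_mono_time[OF _ inner_time_integral(1)[OF elim(1) t] _ t] set_integral_diff(1)[OF elim(2) c]) auto
    also have "\<dots> = p \<bullet> b \<omega>" unfolding b_def by (rule inner_time_integral(2)[OF elim(1) t, symmetric])
    also have "(LBINT s:{t..T}. supp (\<Phi> s \<omega>) p - e / (2 * T)) = (LBINT s:{t..T}. supp (\<Phi> s \<omega>) p) - (LBINT s:{t..T}. e / (2 * T))"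
      using t' by (intro set_integral_diff(2) set_integrable_subset[OF elim(2)] set_integrable_subset[OF c]) auto
    also have "(LBINT s:{t..T}. e / (2 * T)) = (T - t) * (e / (2 * T))"
      using t' by (simp add: set_lebesgue_integral_def)
    finally have "(LBINT s:{t..T}. supp (\<Phi> s \<omega>) p) - (T - t) * (e / (2 * T)) \<le> p \<bullet> b \<omega>" .
    moreover have "(T - t) * (e / (2 * T)) \<le> T * (e / (2 * T))" using e' t' by (intro mult_right_mono) auto
    moreover have "T * (e / (2 * T)) = e / 2" using T_pos by simp
    moreover have "supp (\<xi> \<omega>) p - e/2 \<le> p \<bullet> a \<omega>" using a(3) elim(3) by (simp add: space_F[OF T_in])
    ultimately show ?case unfolding rhs_def inner_add_right by linarith
  qed
  ultimately show "\<exists>g\<in>selectors 1 M M (\<lambda>\<omega>. \<xi> \<omega> + I \<omega>). AE \<omega> in M. rhs \<xi> \<Phi> t p \<omega> - e \<le> p \<bullet> g \<omega>"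
    by (intro bexI[of _ ?g])
qed

lemma step_exists:
  obtains I Z where "is_set_time_integral M F T t \<Phi> I" "is_set_cond_exp M (F t) (\<lambda>\<omega>. \<xi> \<omega> + I \<omega>) Z"
proof -
  interpret sub_prob M "F t" by (rule sub_prob_F[OF t])
  obtain I where I: "is_set_time_integral M F T t \<Phi> I" by (rule set_time_integral_exists[OF \<Phi> t])
  have "selectors 1 M M (\<lambda>\<omega>. \<xi> \<omega> + I \<omega>) \<noteq> {}" using step_sum(4)[OF I, of 1] by auto
  from set_cond_exp_exists[OF step_sum(1)[OF I] this] show ?thesis using I that by metis
qed

lemma step_supp:
  assumes I: "is_set_time_integral M F T t \<Phi> I" and Z: "is_set_cond_exp M (F t) (\<lambda>\<omega>. \<xi> \<omega> + I \<omega>) Z"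
  shows "AE \<omega> in M. Z \<omega> \<in> compact_convex_sets"
    "AE \<omega> in M. \<forall>p\<in>dirs. supp (Z \<omega>) p = real_cond_exp M (F t) (rhs \<xi> \<Phi> t p) \<omega>"
proof -
  interpret sub_prob M "F t" by (rule sub_prob_F[OF t])
  have "selectors 1 M M (\<lambda>\<omega>. \<xi> \<omega> + I \<omega>) \<noteq> {}" using step_sum(4)[OF I, of 1] by auto
  from set_cond_exp_supp[OF Z this step_sum(2)[OF I] rhs_integrable step_sum(3)[OF I] step_sum(4)[OF I]]
  show "AE \<omega> in M. Z \<omega> \<in> compact_convex_sets"
    "AE \<omega> in M. \<forall>p\<in>dirs. supp (Z \<omega>) p = real_cond_exp M (F t) (rhs \<xi> \<Phi> t p) \<omega>" by auto
qed

end

text \<open>Versions of the integral and of the conditional expectation disappear: they exist by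
  \<open>step_exists\<close>, and any of them has the support function given by \<open>rhs\<close>,
  which determines a compact convex set. What remains is a countable system of scalar equations at
  each t.\<close>

lemma set_bsde_solution_iff:
  fixes f :: "real \<Rightarrow> 'w \<Rightarrow> (real ^ 'd) set \<Rightarrow> (real ^ 'd) set"
  assumes \<xi>: "\<xi> \<in> set_Lp 2 M (F T)"
  shows "set_bsde_solution M F T \<xi> f Y \<longleftrightarrow> Y \<in> set_process_L2 M F T \<and> (\<lambda>s \<omega>. f s \<omega> (Y s \<omega>)) \<in> set_process_L2 M F T \<and>
    (\<forall>t\<in>{0..T}. AE \<omega> in M. \<forall>p\<in>dirs. supp (Y t \<omega>) p = real_cond_exp M (F t) (rhs \<xi> (\<lambda>s \<omega>. f s \<omega> (Y s \<omega>)) t p) \<omega>)"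
  (is "?L \<longleftrightarrow> ?Y \<and> ?\<Phi> \<in> _ \<and> ?R")
proof
  assume L: ?L
  then have Y: ?Y by (simp add: set_bsde_solution_def)
  have "\<exists>I. is_set_time_integral M F T T ?\<Phi> I" using L T_in unfolding set_bsde_solution_def by blast
  then have \<Phi>: "?\<Phi> \<in> set_process_L2 M F T" by (auto simp: is_set_time_integral_def)
  have ?R
  proof
    fix t assume t: "t \<in> {0..T}"
    then obtain I Z where I: "is_set_time_integral M F T t ?\<Phi> I" and Z: "is_set_cond_exp M (F t) (\<lambda>\<omega>. \<xi> \<omega> + I \<omega>) Z"
      and eq: "AE \<omega> in M. Y t \<omega> = Z \<omega>" using L unfolding set_bsde_solution_def by blast
    show "AE \<omega> in M. \<forall>p\<in>dirs. supp (Y t \<omega>) p = real_cond_exp M (F t) (rhs \<xi> ?\<Phi> t p) \<omega>"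
      using step_supp(2)[OF \<xi> \<Phi> t I Z] eq by eventually_elim simp
  qed
  with Y \<Phi> show "?Y \<and> ?\<Phi> \<in> set_process_L2 M F T \<and> ?R" by blast
next
  assume R: "?Y \<and> ?\<Phi> \<in> set_process_L2 M F T \<and> ?R"
  show ?L unfolding set_bsde_solution_def
  proof (intro conjI ballI)
    show ?Y using R by blast
    fix t assume t: "t \<in> {0..T}"
    have \<Phi>: "?\<Phi> \<in> set_process_L2 M F T" using R by blast
    obtain I Z where I: "is_set_time_integral M F T t ?\<Phi> I" and Z: "is_set_cond_exp M (F t) (\<lambda>\<omega>. \<xi> \<omega> + I \<omega>) Z"
      by (rule step_exists[OF \<xi> \<Phi> t])
    have "AE \<omega> in M. \<forall>p\<in>dirs. supp (Y t \<omega>) p = real_cond_exp M (F t) (rhs \<xi> ?\<Phi> t p) \<omega>" using R t by blast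
    then have "AE \<omega> in M. Y t \<omega> = Z \<omega>"
      using step_supp[OF \<xi> \<Phi> t I Z] AE_space
    proof eventually_elim
      case (elim \<omega>)
      have "Y t \<omega> \<in> compact_convex_sets" using R t elim(4) unfolding set_process_L2_iff by blast
      then show ?case using elim by (intro ccs_eqI) auto
    qed
    with I Z show "\<exists>I Z. is_set_time_integral M F T t ?\<Phi> I \<and> is_set_cond_exp M (F t) (\<lambda>\<omega>. \<xi> \<omega> + I \<omega>) Z \<and> (AE \<omega> in M. Y t \<omega> = Z \<omega>)"
      by blast
  qed
qed

end

subsection \<open>Progressive modifications\<close>

context filtration
begin

text \<open>For a square-integrable martingale \<open>N\<close> the function \<open>\<phi> t = E (N t)\<^sup>2\<close> is nondecreasing and
  \<open>E (N t - N s)\<^sup>2 = \<phi> t - \<phi> s\<close>. Approximating \<open>N t\<close> by \<open>N s\<close> for the first \<open>s \<le> t\<close> in a fixed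
  enumeration of the rationals and the discontinuities of \<open>\<phi>\<close> such that \<open>\<phi> t - \<phi> s < (1/4) ^ n\<close> is
  progressive and converges almost surely for every \<open>t\<close>.\<close>
lemma martingale_progressive_modification:
  fixes X :: "'w \<Rightarrow> real"
  assumes X: "X \<in> borel_measurable M" and X_fin: "(\<integral>\<^sup>+\<omega>. ennreal (norm (X \<omega>)) ^ 2 \<partial>M) < \<infinity>"
  obtains N where "case_prod N \<in> borel_measurable prog"
    "\<And>t. t \<in> {0..T} \<Longrightarrow> AE \<omega> in M. N t \<omega> = real_cond_exp M (F t) X \<omega>"
proof -
  define N where "N t = real_cond_exp M (F t) X" for t
  have sq: "ennreal (norm x) ^ 2 = ennreal (x\<^sup>2)" for x :: real by (simp add: ennreal_power)
  have N_meas_F: "N t \<in> borel_measurable (F t)" for t unfolding N_def by simp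
  have N_meas [measurable]: "N t \<in> borel_measurable M" if "t \<in> {0..T}" for t
    using measurable_F_M[OF that N_meas_F] .
  have sq_int: "integrable M (\<lambda>\<omega>. (g \<omega>)\<^sup>2)" if "g \<in> borel_measurable M" "(\<integral>\<^sup>+\<omega>. ennreal (norm (g \<omega>)) ^ 2 \<partial>M) < \<infinity>" for g :: "'w \<Rightarrow> real"
  proof (rule integrableI_nonneg)
    show "(\<integral>\<^sup>+\<omega>. ennreal ((g \<omega>)\<^sup>2) \<partial>M) < \<infinity>" using that(2) unfolding sq .
  qed (use that(1) in auto)
  have N2: "integrable M (\<lambda>\<omega>. (N t \<omega>)\<^sup>2)" if t: "t \<in> {0..T}" for t
  proof (rule sq_int[OF N_meas[OF t]])
    interpret A: sub_prob M "F t" by (rule sub_prob_F[OF t])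
    show "(\<integral>\<^sup>+\<omega>. ennreal (norm (N t \<omega>)) ^ 2 \<partial>M) < \<infinity>"
      unfolding N_def using A.cond_exp_sq_le[OF X] X_fin by (rule le_less_trans)
  qed
  note X2 = sq_int[OF X X_fin]
  have prod_int: "integrable M (\<lambda>\<omega>. g \<omega> * h \<omega>)"
    if "g \<in> borel_measurable M" "h \<in> borel_measurable M" "integrable M (\<lambda>\<omega>. (g \<omega>)\<^sup>2)" "integrable M (\<lambda>\<omega>. (h \<omega>)\<^sup>2)" for g h :: "'w \<Rightarrow> real"
  proof (rule Bochner_Integration.integrable_bound[OF Bochner_Integration.integrable_add[OF that(3,4)]])
    show "AE \<omega> in M. norm (g \<omega> * h \<omega>) \<le> norm ((g \<omega>)\<^sup>2 + (h \<omega>)\<^sup>2)"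
    proof (rule AE_I2)
      fix \<omega>
      have "2 * (\<bar>g \<omega>\<bar> * \<bar>h \<omega>\<bar>) \<le> (g \<omega>)\<^sup>2 + (h \<omega>)\<^sup>2" using sum_squares_bound[of "\<bar>g \<omega>\<bar>" "\<bar>h \<omega>\<bar>"] by simp
      moreover have "0 \<le> \<bar>g \<omega>\<bar> * \<bar>h \<omega>\<bar>" by simp
      ultimately have "\<bar>g \<omega>\<bar> * \<bar>h \<omega>\<bar> \<le> (g \<omega>)\<^sup>2 + (h \<omega>)\<^sup>2" by linarith
      then show "norm (g \<omega> * h \<omega>) \<le> norm ((g \<omega>)\<^sup>2 + (h \<omega>)\<^sup>2)" by (simp add: abs_mult)
    qed
  qed (use that in measurable)
  define \<phi> where "\<phi> t = (\<integral>\<omega>. (N t \<omega>)\<^sup>2 \<partial>M)" for t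
  have incr: "integrable M (\<lambda>\<omega>. (N t \<omega> - N s \<omega>)\<^sup>2)" "(\<integral>\<omega>. (N t \<omega> - N s \<omega>)\<^sup>2 \<partial>M) = \<phi> t - \<phi> s"
    if st: "s \<in> {0..T}" "t \<in> {0..T}" "s \<le> t" for s t
  proof -
    interpret A: sub_prob M "F s" by (rule sub_prob_F[OF st(1)])
    interpret B: sub_prob M "F t" by (rule sub_prob_F[OF st(2)])
    have iX: "integrable M (\<lambda>\<omega>. N s \<omega> * X \<omega>)" by (rule prod_int[OF N_meas[OF st(1)] X N2[OF st(1)] X2])
    \<comment> \<open>Both \<open>N s * N s\<close> and \<open>N s * N t\<close> integrate to the
      same value as \<open>N s * X\<close>, because \<open>N s\<close> is measurable for both
      sigma-algebras. Increments are thus orthogonal to the past and second moments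
      subtract.\<close>
    have "(\<integral>\<omega>. N s \<omega> * N s \<omega> \<partial>M) = (\<integral>\<omega>. N s \<omega> * X \<omega> \<partial>M)"
      using A.S.real_cond_exp_intg(2)[OF iX N_meas_F X] by (simp add: N_def)
    moreover have "(\<integral>\<omega>. N s \<omega> * N t \<omega> \<partial>M) = (\<integral>\<omega>. N s \<omega> * X \<omega> \<partial>M)"
      using B.S.real_cond_exp_intg(2)[OF iX measurable_F_mono[OF st N_meas_F] X] by (simp add: N_def)
    ultimately have eq: "(\<integral>\<omega>. N s \<omega> * N t \<omega> \<partial>M) = \<phi> s" by (simp add: \<phi>_def power2_eq_square)
    have ist: "integrable M (\<lambda>\<omega>. N s \<omega> * N t \<omega>)" by (rule prod_int[OF N_meas[OF st(1)] N_meas[OF st(2)] N2[OF st(1)] N2[OF st(2)]])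
    have sqd: "(\<lambda>\<omega>. (N t \<omega> - N s \<omega>)\<^sup>2) = (\<lambda>\<omega>. (N t \<omega>)\<^sup>2 + (N s \<omega>)\<^sup>2 - 2 * (N s \<omega> * N t \<omega>))"
      by (simp add: fun_eq_iff power2_diff)
    show "integrable M (\<lambda>\<omega>. (N t \<omega> - N s \<omega>)\<^sup>2)" unfolding sqd using N2 st ist by simp
    show "(\<integral>\<omega>. (N t \<omega> - N s \<omega>)\<^sup>2 \<partial>M) = \<phi> t - \<phi> s"
      unfolding sqd using N2[OF st(1)] N2[OF st(2)] ist eq by (simp add: \<phi>_def)
  qed
  have \<phi>_mono: "mono_on {0..T} \<phi>"
  proof (rule mono_onI)
    fix s t assume st: "s \<in> {0..T}" "t \<in> {0..T}" "s \<le> t"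
    have "0 \<le> (\<integral>\<omega>. (N t \<omega> - N s \<omega>)\<^sup>2 \<partial>M)" by (rule integral_nonneg_AE) simp
    then show "\<phi> s \<le> \<phi> t" using incr(2)[OF st] by simp
  qed
  \<comment> \<open>The point 0 has no earlier rational and is included by hand. A continuity point
    t > 0 is approximated by a rational just below it, and every other point belongs to D itself. A
    monotone function has only countably many discontinuities.\<close>
  define D where "D = {0} \<union> (\<rat> \<inter> {0..T}) \<union> {a \<in> {0..T}. \<not> continuous (at a within {0..T}) \<phi>}"
  have "countable D" unfolding D_def
    using mono_on_ctble_discont[OF \<phi>_mono] countable_subset[OF Int_lower1 countable_rat, of "{0..T}"] by simp
  have D: "D \<noteq> {}" "D \<subseteq> {0..T}" unfolding D_def using T_pos by auto
  define e where "e = from_nat_into D"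
  have e: "e i \<in> {0..T}" for i using from_nat_into[OF D(1)] D(2) unfolding e_def by blast
  have e_surj: "\<exists>i. e i = d" if "d \<in> D" for d unfolding e_def by (rule from_nat_into_surj[OF \<open>countable D\<close> that])
  have near: "\<exists>i. e i \<le> t \<and> \<phi> t - \<phi> (e i) < \<delta>" if t: "t \<in> {0..T}" and \<delta>: "0 < \<delta>" for t \<delta>
  proof (cases "t \<in> D")
    case True
    then obtain i where "e i = t" using e_surj by blast
    then show ?thesis using \<delta> by (intro exI[of _ i]) simp
  next
    case False
    then have t0: "0 < t" and "continuous (at t within {0..T}) \<phi>" using t by (auto simp: D_def)
    then obtain \<eta> where \<eta>: "0 < \<eta>" "\<And>s. s \<in> {0..T} \<Longrightarrow> dist s t < \<eta> \<Longrightarrow> dist (\<phi> s) (\<phi> t) < \<delta>"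
      unfolding continuous_within_eps_delta using \<delta> by blast
    have "max 0 (t - \<eta>) < t" using t0 \<eta>(1) by simp
    then obtain r where r: "r \<in> \<rat>" "max 0 (t - \<eta>) < r" "r < t" using Rats_dense_in_real by blast
    have rT: "r \<in> {0..T}" using r t by auto
    then have "r \<in> D" using r by (simp add: D_def)
    then obtain i where i: "e i = r" using e_surj by blast
    have "dist (\<phi> r) (\<phi> t) < \<delta>" using \<eta>(2)[OF rT] r by (simp add: dist_real_def)
    then show ?thesis using r i by (intro exI[of _ i]) (simp add: dist_real_def abs_less_iff)
  qed
  \<comment> \<open>Requiring \<open>e i \<le> t\<close> keeps the approximation adapted; the choice
    depends on t alone, not on \<omega>.\<close>
  define idx where "idx n t = (LEAST i. e i \<le> t \<and> \<phi> t - \<phi> (e i) < (1/4) ^ n)" for n t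
  have idx: "e (idx n t) \<le> t" "\<phi> t - \<phi> (e (idx n t)) < (1/4) ^ n" if "t \<in> {0..T}" for n t
    using LeastI_ex[OF near[OF that, of "(1/4) ^ n"]] unfolding idx_def by auto
  define P where "P n t \<omega> = N (e (idx n t)) \<omega>" for n t \<omega>
  have P_meas: "case_prod (P n) \<in> borel_measurable prog" for n
    unfolding measurable_prog_iff
  proof
    fix u assume u: "u \<in> {0..T}"
    have "mono_on {0..u} \<phi>" using \<phi>_mono u by (auto simp: mono_on_def)
    from borel_measurable_mono_on_fnc[OF this]
    have [measurable]: "\<phi> \<in> borel_measurable (restrict_space borel {0..u})" .
    have [measurable]: "(\<lambda>t. t) \<in> borel_measurable (restrict_space borel {0..u})"
      by (intro measurable_restrict_space1) simp
    have "idx n \<in> measurable (restrict_space borel {0..u}) (count_space UNIV)" unfolding idx_def by measurable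
    then have i_meas: "(\<lambda>x. idx n (fst x)) \<in> measurable (prog_space F u) (count_space UNIV)" by measurable
    have G_meas: "(\<lambda>x. if e i \<le> u then N (e i) (snd x) else 0) \<in> borel_measurable (prog_space F u)" for i
    proof (cases "e i \<le> u")
      case True
      have "N (e i) \<in> borel_measurable (F u)" by (rule measurable_F_mono[OF e u True N_meas_F])
      then show ?thesis using True by simp
    qed simp
    have "(\<lambda>x. if e (idx n (fst x)) \<le> u then N (e (idx n (fst x))) (snd x) else 0) \<in> borel_measurable (prog_space F u)"
      by (rule measurable_compose_countable[OF G_meas i_meas])
    also have "?this \<longleftrightarrow> case_prod (P n) \<in> borel_measurable (prog_space F u)"
    proof (rule measurable_cong)
      fix x assume "x \<in> space (prog_space F u)"
      then have "fst x \<in> {0..T}" "fst x \<le> u" using u by (auto simp: space_prog_space)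
      then have "e (idx n (fst x)) \<le> u" using idx(1)[of "fst x" n] by simp
      then show "(if e (idx n (fst x)) \<le> u then N (e (idx n (fst x))) (snd x) else 0) = case_prod (P n) x"
        by (simp add: P_def case_prod_unfold)
    qed
    finally show "case_prod (P n) \<in> borel_measurable (prog_space F u)" .
  qed
  have conv: "AE \<omega> in M. (\<lambda>n. P n t \<omega>) \<longlonglongrightarrow> N t \<omega>" if t: "t \<in> {0..T}" for t
  proof (rule Lp_summable_AE_LIMSEQ[where p = 2])
    show "N t \<in> borel_measurable M" by (rule N_meas[OF t])
    show "(\<lambda>\<omega>. P n t \<omega>) \<in> borel_measurable M" for n unfolding P_def using N_meas[OF e] by simp
    fix n
    let ?s = "e (idx n t)"
    have "(\<integral>\<^sup>+\<omega>. ennreal (norm (N t \<omega> - P n t \<omega>)) ^ 2 \<partial>M) = ennreal (\<phi> t - \<phi> ?s)"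
      unfolding P_def sq incr(2)[OF e t idx(1)[OF t], symmetric]
      by (rule nn_integral_eq_integral[OF incr(1)[OF e t idx(1)[OF t]]]) simp
    also have "\<dots> \<le> ennreal ((1/2) ^ n)"
    proof (rule ennreal_leI)
      have "(1/4 :: real) ^ n \<le> (1/2) ^ n" by (intro power_mono) auto
      then show "\<phi> t - \<phi> ?s \<le> (1/2) ^ n" using idx(2)[OF t, of n] by linarith
    qed
    finally show "(\<integral>\<^sup>+\<omega>. ennreal (norm (N t \<omega> - P n t \<omega>)) ^ 2 \<partial>M) \<le> ennreal ((1/2) ^ n)" .
  qed simp
  show ?thesis
  proof (rule that[of "\<lambda>t \<omega>. lim (\<lambda>n. P n t \<omega>)"])
    have "(\<lambda>x. lim (\<lambda>n. case_prod (P n) x)) \<in> borel_measurable prog"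
      by (rule borel_measurable_lim_metric[OF P_meas])
    then show "(\<lambda>(t, \<omega>). lim (\<lambda>n. P n t \<omega>)) \<in> borel_measurable prog" by (simp add: case_prod_unfold)
    fix t assume "t \<in> {0..T}"
    from conv[OF this] show "AE \<omega> in M. lim (\<lambda>n. P n t \<omega>) = real_cond_exp M (F t) X \<omega>"
      by eventually_elim (simp add: limI N_def)
  qed
qed

section \<open>Splitting of time integrals and estimates for one step of the iteration\<close>

lemma time_integral_split:
  fixes g :: "real \<Rightarrow> real"
  assumes g: "set_integrable lborel {0..T} g" and t: "t \<in> {0..T}"
  shows "(LBINT s:{0..T}. g s) = (LBINT s:{0..t}. g s) + (LBINT s:{t..T}. g s)"
proof -
  have i: "set_integrable lborel {0..t} g" "set_integrable lborel {t..T} g"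
    using t by (auto intro: set_integrable_subset[OF g])
  have "(LBINT s:{0..T}. g s) = (\<integral>s. indicator {0..t} s *\<^sub>R g s + indicator {t..T} s *\<^sub>R g s \<partial>lborel)"
    unfolding set_lebesgue_integral_def
  proof (rule integral_cong_AE)
    have "AE s in lborel. s \<noteq> t" by (rule AE_lborel_singleton)
    then show "AE s in lborel. indicator {0..T} s *\<^sub>R g s = indicator {0..t} s *\<^sub>R g s + indicator {t..T} s *\<^sub>R g s"
      by eventually_elim (use t in \<open>auto simp: indicator_def\<close>)
  qed (use g i in \<open>auto simp: set_integrable_def intro!: borel_measurable_add dest!: borel_measurable_integrable\<close>)
  also have "\<dots> = (LBINT s:{0..t}. g s) + (LBINT s:{t..T}. g s)"
    using i unfolding set_lebesgue_integral_def set_integrable_def by (rule Bochner_Integration.integral_add)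
  finally show ?thesis .
qed

text \<open>Comparison with the set {0} in \<open>hdist_cond_exp_le\<close>, then Jensen and
  Cauchy-Schwarz; 4 is the factor 2^2 of the squared triangle inequality. The bound does not depend
  on t, as the iteration requires.\<close>

lemma step_norm_le:
  fixes \<xi> :: "'w \<Rightarrow> (real ^ 'd) set"
  assumes \<xi>: "\<xi> \<in> set_Lp 2 M (F T)" and \<Phi>: "\<Phi> \<in> set_process_L2 M F T" and t: "t \<in> {0..T}"
    and Y: "AE \<omega> in M. \<forall>p\<in>dirs. supp (Y \<omega>) p = real_cond_exp M (F t) (rhs \<xi> \<Phi> t p) \<omega>"
  shows "(\<integral>\<^sup>+\<omega>. ennreal (nrm (Y \<omega>)) ^ 2 \<partial>M) \<le> 4 * ((\<integral>\<^sup>+\<omega>. ennreal (nrm (\<xi> \<omega>)) ^ 2 \<partial>M) +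
    ennreal T * (\<integral>\<^sup>+\<omega>. (\<integral>\<^sup>+s\<in>{0..T}. ennreal (nrm (\<Phi> s \<omega>)) ^ 2 \<partial>lborel) \<partial>M))"
proof -
  interpret A: sub_prob M "F t" by (rule sub_prob_F[OF t])
  have t': "{t..T} \<subseteq> {0..T}" using t by auto
  let ?R = "\<lambda>\<omega>. nrm (\<xi> \<omega>) + (LBINT s:{t..T}. nrm (\<Phi> s \<omega>))"
  note nL2 = process_nrm_L2[OF \<Phi>]
  have nm: "case_prod (\<lambda>s \<omega>. nrm (\<Phi> s \<omega>)) \<in> borel_measurable prog" using nL2 by (simp add: L2_process_def)
  have n2: "case_prod (\<lambda>s \<omega>. ennreal (nrm (\<Phi> s \<omega>)) ^ 2) \<in> borel_measurable prog"
    by (rule prog_compose[OF nm, of "\<lambda>x. ennreal x ^ 2"]) simp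
  have R: "integrable M ?R" by (rule vec_Lp2_integrable[OF T_in nrm_rhs_L2[OF \<xi> \<Phi> t]])
  have int_pos: "AE \<omega> in M. 0 \<le> (LBINT s:{t..T}. nrm (\<Phi> s \<omega>))"
  proof (rule AE_I2)
    fix \<omega> assume "\<omega> \<in> space M"
    then show "0 \<le> (LBINT s:{t..T}. nrm (\<Phi> s \<omega>))"
      unfolding set_lebesgue_integral_def using t' nrm_nonneg[OF process_ccs[OF \<Phi>]]
      by (intro integral_nonneg_AE AE_I2) (auto simp: indicator_def)
  qed
  have "AE \<omega> in M. hdist (Y \<omega>) {0} \<le> real_cond_exp M (F t) ?R \<omega>"
  proof (rule A.hdist_cond_exp_le[where V = "rhs \<xi> \<Phi> t", OF _ rhs_integrable[OF \<xi> \<Phi> t] R])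
    show "AE \<omega> in M. \<forall>p\<in>dirs. supp (Y \<omega>) p - supp {0} p = real_cond_exp M (F t) (rhs \<xi> \<Phi> t p) \<omega>"
      using Y by simp
    show "AE \<omega> in M. 0 \<le> ?R \<omega>"
      using int_pos AE_space by eventually_elim (intro add_nonneg_nonneg nrm_nonneg set_Lp2D(2)[OF \<xi>])
    fix p :: "real ^ 'd"
    show "AE \<omega> in M. \<bar>rhs \<xi> \<Phi> t p \<omega>\<bar> \<le> norm p * ?R \<omega>"
      using L2_process_AE_integrable[OF process_supp_L2[OF \<Phi>, of p]] L2_process_AE_integrable[OF nL2] AE_space
    proof eventually_elim
      case (elim \<omega>)
      have i: "set_integrable lborel {t..T} (\<lambda>s. supp (\<Phi> s \<omega>) p)"
        using t' by (intro set_integrable_subset[OF elim(1)]) auto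
      have c: "set_integrable lborel {0..T} (\<lambda>s. norm p * nrm (\<Phi> s \<omega>))" using elim(2) by simp
      have "\<bar>LBINT s:{t..T}. supp (\<Phi> s \<omega>) p\<bar> \<le> (LBINT s:{t..T}. norm (supp (\<Phi> s \<omega>) p))"
        using set_integral_norm_bound[OF i] by simp
      also have "\<dots> \<le> (LBINT s:{t..T}. norm p * nrm (\<Phi> s \<omega>))"
        using abs_supp_le[OF process_ccs[OF \<Phi> _ elim(3)]]
        by (intro set_integral_mono_time[OF set_integrable_norm[OF elim(1)] c _ t] AE_I2) auto
      also have "\<dots> = norm p * (LBINT s:{t..T}. nrm (\<Phi> s \<omega>))" by simp
      finally show ?case
        using abs_supp_le[OF set_Lp2D(2)[OF \<xi> elim(3)], of p] unfolding rhs_def distrib_left by linarith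
    qed
  qed
  then have "(\<integral>\<^sup>+\<omega>. ennreal (nrm (Y \<omega>)) ^ 2 \<partial>M) \<le> (\<integral>\<^sup>+\<omega>. ennreal (norm (real_cond_exp M (F t) ?R \<omega>)) ^ 2 \<partial>M)"
    by (intro nn_integral_mono_AE) (auto elim!: eventually_mono intro!: power_mono ennreal_leI)
  also have "\<dots> \<le> (\<integral>\<^sup>+\<omega>. ennreal (norm (?R \<omega>)) ^ 2 \<partial>M)"
    by (rule A.cond_exp_sq_le) (use R in auto)
  also have "\<dots> \<le> (\<integral>\<^sup>+\<omega>. 2 ^ 2 * (ennreal (norm (nrm (\<xi> \<omega>))) ^ 2 + ennreal (norm (LBINT s:{t..T}. nrm (\<Phi> s \<omega>))) ^ 2) \<partial>M)"
    by (intro nn_integral_mono ennreal_norm_add_power_le)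
  also have "\<dots> \<le> (\<integral>\<^sup>+\<omega>. 2 ^ 2 * (ennreal (nrm (\<xi> \<omega>)) ^ 2 + ennreal T * (\<integral>\<^sup>+s\<in>{0..T}. ennreal (nrm (\<Phi> s \<omega>)) ^ 2 \<partial>lborel)) \<partial>M)"
  proof (intro nn_integral_mono mult_left_mono add_mono)
    fix \<omega> assume \<omega>: "\<omega> \<in> space M"
    show "ennreal (norm (nrm (\<xi> \<omega>))) ^ 2 \<le> ennreal (nrm (\<xi> \<omega>)) ^ 2"
      using nrm_nonneg[OF set_Lp2D(2)[OF \<xi> \<omega>]] by simp
    have "ennreal (norm (LBINT s:{t..T}. nrm (\<Phi> s \<omega>))) ^ 2 \<le> ennreal T * (\<integral>\<^sup>+s\<in>{t..T}. ennreal (norm (nrm (\<Phi> s \<omega>))) ^ 2 \<partial>lborel)"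
      by (rule time_integral_sq_le[OF prog_sec_borel[OF nm \<omega>] t'])
    also have "\<dots> \<le> ennreal T * (\<integral>\<^sup>+s\<in>{0..T}. ennreal (nrm (\<Phi> s \<omega>)) ^ 2 \<partial>lborel)"
    proof (intro mult_left_mono nn_integral_mono)
      fix s
      show "ennreal (norm (nrm (\<Phi> s \<omega>))) ^ 2 * indicator {t..T} s \<le> ennreal (nrm (\<Phi> s \<omega>)) ^ 2 * indicator {0..T} s"
        using t' nrm_nonneg[OF process_ccs[OF \<Phi> _ \<omega>], of s] by (auto simp: indicator_def)
    qed simp
    finally show "ennreal (norm (LBINT s:{t..T}. nrm (\<Phi> s \<omega>))) ^ 2 \<le> ennreal T * (\<integral>\<^sup>+s\<in>{0..T}. ennreal (nrm (\<Phi> s \<omega>)) ^ 2 \<partial>lborel)" .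
  qed simp
  also have "\<dots> = 4 * ((\<integral>\<^sup>+\<omega>. ennreal (nrm (\<xi> \<omega>)) ^ 2 \<partial>M) + ennreal T * (\<integral>\<^sup>+\<omega>. (\<integral>\<^sup>+s\<in>{0..T}. ennreal (nrm (\<Phi> s \<omega>)) ^ 2 \<partial>lborel) \<partial>M))"
  proof -
    have m1: "(\<lambda>\<omega>. ennreal (nrm (\<xi> \<omega>)) ^ 2) \<in> borel_measurable M"
      by (rule measurable_compose[OF vec_Lp_measurable[OF subalg[OF T_in] set_Lp2D(3)[OF \<xi>]], of "\<lambda>x. ennreal x ^ 2"]) simp
    have m2: "(\<lambda>\<omega>. \<integral>\<^sup>+s\<in>{0..T}. ennreal (nrm (\<Phi> s \<omega>)) ^ 2 \<partial>lborel) \<in> borel_measurable M"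
      by (rule nn_time_integral_measurable[OF n2]) auto
    have "(\<integral>\<^sup>+\<omega>. 2 ^ 2 * (ennreal (nrm (\<xi> \<omega>)) ^ 2 + ennreal T * (\<integral>\<^sup>+s\<in>{0..T}. ennreal (nrm (\<Phi> s \<omega>)) ^ 2 \<partial>lborel)) \<partial>M)
      = 2 ^ 2 * (\<integral>\<^sup>+\<omega>. ennreal (nrm (\<xi> \<omega>)) ^ 2 + ennreal T * (\<integral>\<^sup>+s\<in>{0..T}. ennreal (nrm (\<Phi> s \<omega>)) ^ 2 \<partial>lborel) \<partial>M)"
      by (intro nn_integral_cmult borel_measurable_add borel_measurable_times_ennreal m1 m2) auto
    also have "(\<integral>\<^sup>+\<omega>. ennreal (nrm (\<xi> \<omega>)) ^ 2 + ennreal T * (\<integral>\<^sup>+s\<in>{0..T}. ennreal (nrm (\<Phi> s \<omega>)) ^ 2 \<partial>lborel) \<partial>M)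
      = (\<integral>\<^sup>+\<omega>. ennreal (nrm (\<xi> \<omega>)) ^ 2 \<partial>M) + (\<integral>\<^sup>+\<omega>. ennreal T * (\<integral>\<^sup>+s\<in>{0..T}. ennreal (nrm (\<Phi> s \<omega>)) ^ 2 \<partial>lborel) \<partial>M)"
      by (intro nn_integral_add borel_measurable_times_ennreal m1 m2) auto
    also have "(\<integral>\<^sup>+\<omega>. ennreal T * (\<integral>\<^sup>+s\<in>{0..T}. ennreal (nrm (\<Phi> s \<omega>)) ^ 2 \<partial>lborel) \<partial>M) = ennreal T * (\<integral>\<^sup>+\<omega>. (\<integral>\<^sup>+s\<in>{0..T}. ennreal (nrm (\<Phi> s \<omega>)) ^ 2 \<partial>lborel) \<partial>M)"
      by (rule nn_integral_cmult[OF m2])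
    finally show ?thesis by simp
  qed
  finally show ?thesis .
qed

text \<open>\<xi> cancels in the difference of the two right-hand sides, so only the integrands on
  [t,T] remain. Jensen removes the conditional expectation and Cauchy-Schwarz in time produces T.
  Keeping the integral over [t,T] instead of [0,T] is what the exponential weight exploits.\<close>

lemma step_hdist_le:
  fixes \<xi> :: "'w \<Rightarrow> (real ^ 'd) set"
  assumes \<xi>: "\<xi> \<in> set_Lp 2 M (F T)" and \<Phi>: "\<Phi>1 \<in> set_process_L2 M F T" "\<Phi>2 \<in> set_process_L2 M F T" and t: "t \<in> {0..T}"
    and Y1: "AE \<omega> in M. \<forall>p\<in>dirs. supp (Y1 \<omega>) p = real_cond_exp M (F t) (rhs \<xi> \<Phi>1 t p) \<omega>"
    and Y2: "AE \<omega> in M. \<forall>p\<in>dirs. supp (Y2 \<omega>) p = real_cond_exp M (F t) (rhs \<xi> \<Phi>2 t p) \<omega>"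
  shows "(\<integral>\<^sup>+\<omega>. ennreal (hdist (Y1 \<omega>) (Y2 \<omega>)) ^ 2 \<partial>M) \<le>
    ennreal T * (\<integral>\<^sup>+s\<in>{t..T}. (\<integral>\<^sup>+\<omega>. ennreal (hdist (\<Phi>1 s \<omega>) (\<Phi>2 s \<omega>)) ^ 2 \<partial>M) \<partial>lborel)"
proof -
  interpret A: sub_prob M "F t" by (rule sub_prob_F[OF t])
  have t': "{t..T} \<subseteq> {0..T}" using t by auto
  define \<delta> where "\<delta> s \<omega> = hdist (\<Phi>1 s \<omega>) (\<Phi>2 s \<omega>)" for s \<omega>
  note K1 = process_ccs[OF \<Phi>(1)] and K2 = process_ccs[OF \<Phi>(2)]
  have \<delta>_nonneg: "0 \<le> \<delta> s \<omega>" if "s \<in> {0..T}" "\<omega> \<in> space M" for s \<omega>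
    unfolding \<delta>_def using that by (intro hdist_nonneg K1 K2)
  have "(\<lambda>x. hdist (case_prod \<Phi>1 x) (case_prod \<Phi>2 x)) \<in> borel_measurable prog"
    by (rule hdist_measurable[OF process_measurable[OF \<Phi>(1)] process_ccs'[OF \<Phi>(1)] process_measurable[OF \<Phi>(2)] process_ccs'[OF \<Phi>(2)]])
  then have \<delta>m: "case_prod \<delta> \<in> borel_measurable prog" by (simp add: \<delta>_def case_prod_unfold)
  have \<delta>2: "case_prod (\<lambda>s \<omega>. ennreal (\<delta> s \<omega>) ^ 2) \<in> borel_measurable prog"
    by (rule prog_compose[OF \<delta>m, of "\<lambda>x. ennreal x ^ 2"]) simp
  note n1 = L2_process_AE_integrable[OF process_nrm_L2[OF \<Phi>(1)]] and n2 = L2_process_AE_integrable[OF process_nrm_L2[OF \<Phi>(2)]]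
  have \<delta>_le: "\<delta> s \<omega> \<le> nrm (\<Phi>1 s \<omega>) + nrm (\<Phi>2 s \<omega>)" if "s \<in> {0..T}" "\<omega> \<in> space M" for s \<omega>
    unfolding \<delta>_def using hdist_triangle[OF K1[OF that] zero_ccs K2[OF that]] by (simp add: hdist_commute)
  have \<delta>_int: "AE \<omega> in M. set_integrable lborel {0..T} (\<lambda>s. \<delta> s \<omega>)"
    using n1 n2 AE_space
  proof eventually_elim
    case (elim \<omega>)
    have "integrable lborel (\<lambda>s. indicator {0..T} s *\<^sub>R (nrm (\<Phi>1 s \<omega>) + nrm (\<Phi>2 s \<omega>)))"
      using set_integral_add(1)[OF elim(1,2)] unfolding set_integrable_def .
    then show ?case unfolding set_integrable_def
    proof (rule Bochner_Integration.integrable_bound[OF _ prog_sec_borel[OF \<delta>m elim(3)]])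
      show "AE s in lborel. norm (indicator {0..T} s *\<^sub>R \<delta> s \<omega>) \<le> norm (indicator {0..T} s *\<^sub>R (nrm (\<Phi>1 s \<omega>) + nrm (\<Phi>2 s \<omega>)))"
      proof (rule AE_I2)
        fix s
        show "norm (indicator {0..T} s *\<^sub>R \<delta> s \<omega>) \<le> norm (indicator {0..T} s *\<^sub>R (nrm (\<Phi>1 s \<omega>) + nrm (\<Phi>2 s \<omega>)))"
          using \<delta>_le[of s \<omega>] \<delta>_nonneg[of s \<omega>] elim(3) by (auto simp: indicator_def)
      qed
    qed
  qed
  let ?R = "\<lambda>\<omega>. LBINT s:{t..T}. \<delta> s \<omega>"
  have R_meas: "?R \<in> borel_measurable M"
    using t by (intro measurable_F_M[OF T_in time_integral_adapted[OF \<delta>m _ T_in]]) auto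
  have R: "integrable M ?R"
  proof (rule Bochner_Integration.integrable_bound[OF _ R_meas])
    show "integrable M (\<lambda>\<omega>. (LBINT s:{t..T}. nrm (\<Phi>1 s \<omega>)) + (LBINT s:{t..T}. nrm (\<Phi>2 s \<omega>)))"
      using t by (intro Bochner_Integration.integrable_add vec_Lp2_integrable[OF T_in] L2_process_integral_vec_Lp process_nrm_L2 \<Phi> T_in) auto
    show "AE \<omega> in M. norm (?R \<omega>) \<le> norm ((LBINT s:{t..T}. nrm (\<Phi>1 s \<omega>)) + (LBINT s:{t..T}. nrm (\<Phi>2 s \<omega>)))"
      using n1 n2 \<delta>_int AE_space
    proof eventually_elim
      case (elim \<omega>)
      have i: "set_integrable lborel {t..T} (\<lambda>s. nrm (\<Phi>1 s \<omega>))" "set_integrable lborel {t..T} (\<lambda>s. nrm (\<Phi>2 s \<omega>))"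
        "set_integrable lborel {t..T} (\<lambda>s. \<delta> s \<omega>)"
        using t' elim by (auto intro: set_integrable_subset)
      have "norm (?R \<omega>) \<le> (LBINT s:{t..T}. norm (\<delta> s \<omega>))" by (rule set_integral_norm_bound[OF i(3)])
      also have "\<dots> \<le> (LBINT s:{t..T}. nrm (\<Phi>1 s \<omega>) + nrm (\<Phi>2 s \<omega>))"
        using \<delta>_le \<delta>_nonneg elim(4)
        by (intro set_integral_mono_time[OF set_integrable_norm[OF elim(3)] set_integral_add(1)[OF elim(1,2)] _ t] AE_I2) auto
      also have "\<dots> = (LBINT s:{t..T}. nrm (\<Phi>1 s \<omega>)) + (LBINT s:{t..T}. nrm (\<Phi>2 s \<omega>))" by (rule set_integral_add(2)[OF i(1,2)])
      finally show ?case by simp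
    qed
  qed
  let ?V = "\<lambda>p \<omega>. rhs \<xi> \<Phi>1 t p \<omega> - rhs \<xi> \<Phi>2 t p \<omega>"
  have "AE \<omega> in M. hdist (Y1 \<omega>) (Y2 \<omega>) \<le> real_cond_exp M (F t) ?R \<omega>"
  proof (rule A.hdist_cond_exp_le[where V = ?V, OF _ _ R])
    show "integrable M (?V p)" for p by (intro Bochner_Integration.integrable_diff rhs_integrable \<xi> \<Phi> t)
    have "AE \<omega> in M. \<forall>p\<in>dirs. real_cond_exp M (F t) (?V p) \<omega> = real_cond_exp M (F t) (rhs \<xi> \<Phi>1 t p) \<omega> - real_cond_exp M (F t) (rhs \<xi> \<Phi>2 t p) \<omega>"
      unfolding AE_ball_countable[OF countable_dirs]
      by (intro ballI A.S.real_cond_exp_diff rhs_integrable \<xi> \<Phi> t)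
    then show "AE \<omega> in M. \<forall>p\<in>dirs. supp (Y1 \<omega>) p - supp (Y2 \<omega>) p = real_cond_exp M (F t) (?V p) \<omega>"
      using Y1 Y2 by eventually_elim simp
    show "AE \<omega> in M. 0 \<le> ?R \<omega>"
    proof (rule AE_I2)
      fix \<omega> assume "\<omega> \<in> space M"
      then show "0 \<le> ?R \<omega>"
        unfolding set_lebesgue_integral_def using t' \<delta>_nonneg
        by (intro integral_nonneg_AE AE_I2) (auto simp: indicator_def)
    qed
    fix p :: "real ^ 'd"
    show "AE \<omega> in M. \<bar>?V p \<omega>\<bar> \<le> norm p * ?R \<omega>"
      using L2_process_AE_integrable[OF process_supp_L2[OF \<Phi>(1), of p]] L2_process_AE_integrable[OF process_supp_L2[OF \<Phi>(2), of p]] \<delta>_int AE_space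
    proof eventually_elim
      case (elim \<omega>)
      note d = set_integral_diff(1)[OF elim(1,2)]
      have i: "set_integrable lborel {t..T} (\<lambda>s. supp (\<Phi>1 s \<omega>) p)" "set_integrable lborel {t..T} (\<lambda>s. supp (\<Phi>2 s \<omega>) p)"
        using t' elim by (auto intro: set_integrable_subset)
      have c: "set_integrable lborel {0..T} (\<lambda>s. norm p * \<delta> s \<omega>)" using elim(3) by simp
      have "?V p \<omega> = (LBINT s:{t..T}. supp (\<Phi>1 s \<omega>) p - supp (\<Phi>2 s \<omega>) p)"
        unfolding rhs_def set_integral_diff(2)[OF i] by simp
      then have "\<bar>?V p \<omega>\<bar> \<le> (LBINT s:{t..T}. norm (supp (\<Phi>1 s \<omega>) p - supp (\<Phi>2 s \<omega>) p))"
        using set_integral_norm_bound[OF set_integral_diff(1)[OF i]] by simp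
      also have "\<dots> \<le> (LBINT s:{t..T}. norm p * \<delta> s \<omega>)"
        using hdist_upper[OF K1[OF _ elim(4)] K2[OF _ elim(4)], of _ _ p]
        by (intro set_integral_mono_time[OF set_integrable_norm[OF d] c _ t] AE_I2) (auto simp: \<delta>_def)
      also have "\<dots> = norm p * ?R \<omega>" by simp
      finally show ?case .
    qed
  qed
  then have "(\<integral>\<^sup>+\<omega>. ennreal (hdist (Y1 \<omega>) (Y2 \<omega>)) ^ 2 \<partial>M) \<le> (\<integral>\<^sup>+\<omega>. ennreal (norm (real_cond_exp M (F t) ?R \<omega>)) ^ 2 \<partial>M)"
    by (intro nn_integral_mono_AE) (auto elim!: eventually_mono intro!: power_mono ennreal_leI)
  also have "\<dots> \<le> (\<integral>\<^sup>+\<omega>. ennreal (norm (?R \<omega>)) ^ 2 \<partial>M)"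
    by (rule A.cond_exp_sq_le[OF R_meas])
  also have "\<dots> \<le> (\<integral>\<^sup>+\<omega>. ennreal T * (\<integral>\<^sup>+s\<in>{t..T}. ennreal (\<delta> s \<omega>) ^ 2 \<partial>lborel) \<partial>M)"
  proof (rule nn_integral_mono)
    fix \<omega> assume \<omega>: "\<omega> \<in> space M"
    have "ennreal (norm (?R \<omega>)) ^ 2 \<le> ennreal T * (\<integral>\<^sup>+s\<in>{t..T}. ennreal (norm (\<delta> s \<omega>)) ^ 2 \<partial>lborel)"
      by (rule time_integral_sq_le[OF prog_sec_borel[OF \<delta>m \<omega>] t'])
    also have "(\<integral>\<^sup>+s\<in>{t..T}. ennreal (norm (\<delta> s \<omega>)) ^ 2 \<partial>lborel) = (\<integral>\<^sup>+s\<in>{t..T}. ennreal (\<delta> s \<omega>) ^ 2 \<partial>lborel)"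
      using t' \<delta>_nonneg[OF _ \<omega>] by (intro nn_integral_cong) (auto simp: indicator_def)
    finally show "ennreal (norm (?R \<omega>)) ^ 2 \<le> ennreal T * (\<integral>\<^sup>+s\<in>{t..T}. ennreal (\<delta> s \<omega>) ^ 2 \<partial>lborel)" .
  qed
  also have "\<dots> = ennreal T * (\<integral>\<^sup>+\<omega>. (\<integral>\<^sup>+s\<in>{t..T}. ennreal (\<delta> s \<omega>) ^ 2 \<partial>lborel) \<partial>M)"
    by (intro nn_integral_cmult nn_time_integral_measurable[OF \<delta>2] t') simp
  also have "(\<integral>\<^sup>+\<omega>. (\<integral>\<^sup>+s\<in>{t..T}. ennreal (\<delta> s \<omega>) ^ 2 \<partial>lborel) \<partial>M) = (\<integral>\<^sup>+s\<in>{t..T}. (\<integral>\<^sup>+\<omega>. ennreal (\<delta> s \<omega>) ^ 2 \<partial>M) \<partial>lborel)"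
    by (intro nn_time_Fubini[OF \<delta>2 t']) simp
  finally show ?thesis unfolding \<delta>_def .
qed

end

subsection \<open>Picard iteration\<close>

text \<open>Squared increments below s * (1/4)^n are increments below sqrt s * (1/2)^n, whose tail
  from n on is at most twice that; squaring gives the bound. By \<open>supp_set_limit\<close> the
  limits are the values of a support function, so the default of \<open>set_of_supp\<close> does not
  occur.\<close>

lemma iterates_converge:
  fixes A :: "nat \<Rightarrow> 'v::euclidean_space set"
  assumes A: "\<And>n. A n \<in> compact_convex_sets" and s: "\<And>n. 4 ^ n * (hdist (A (Suc n)) (A n))\<^sup>2 \<le> s"
  shows "(hdist (set_of_supp (\<lambda>p. lim (\<lambda>n. supp (A n) p))) (A n))\<^sup>2 \<le> 4 * s * (1/4) ^ n"
proof -
  define r where "r = sqrt s"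
  have s0: "0 \<le> s" using s[of 0] by (auto intro: order_trans[rotated])
  have h: "hdist (A (Suc n)) (A n) \<le> r * (1/2) ^ n" for n
  proof -
    have "(2 ^ n * hdist (A (Suc n)) (A n))\<^sup>2 \<le> s"
      using s[of n] by (simp add: power_mult_distrib power_mult[symmetric] mult.commute[of n 2] power_mult)
    then have "2 ^ n * hdist (A (Suc n)) (A n) \<le> r" unfolding r_def by (rule real_le_rsqrt)
    then show ?thesis by (simp add: field_simps power_one_over)
  qed
  have step: "\<bar>supp (A (Suc n)) p - supp (A n) p\<bar> \<le> norm p * (r * (1/2) ^ n)" for n p
    using hdist_upper[OF A[of "Suc n"] A[of n], of p] mult_left_mono[OF h[of n], of "norm p"] by simp
  have lim: "(\<lambda>n. supp (A n) p) \<longlonglongrightarrow> lim (\<lambda>n. supp (A n) p)" for p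
  proof -
    have "summable (\<lambda>n. norm p * (r * (1/2) ^ n))" by (intro summable_mult summable_geometric) simp
    then have "summable (\<lambda>n. supp (A (Suc n)) p - supp (A n) p)"
      by (rule summable_comparison_test'[where N = 0]) (use step in simp)
    then have "convergent (\<lambda>n. supp (A n) p - supp (A 0) p)"
      unfolding summable_iff_convergent sum_lessThan_telescope[of "\<lambda>n. supp (A n) p"] .
    then show ?thesis unfolding convergent_diff_const_right_iff convergent_LIMSEQ_iff .
  qed
  let ?B = "set_of_supp (\<lambda>p. lim (\<lambda>n. supp (A n) p))"
  note L = supp_set_limit[OF A lim]
  have B: "?B = supp_set (\<lambda>p. lim (\<lambda>n. supp (A n) p))"
    using L by (intro set_of_supp_eq)
  \<comment> \<open>The geometric partial sum is kept in closed form so that the induction on m goes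
    through.\<close>
  have tail: "\<bar>supp (A (n + m)) p - supp (A n) p\<bar> \<le> norm p * r * (2 * (1/2) ^ n - 2 * (1/2) ^ (n + m))" for m p
  proof (induction m)
    case (Suc m)
    have "norm p * r * (2 * (1/2) ^ n - 2 * (1/2) ^ (n + Suc m)) =
      norm p * r * (2 * (1/2) ^ n - 2 * (1/2) ^ (n + m)) + norm p * (r * (1/2) ^ (n + m))"
      by (simp add: algebra_simps)
    then show ?case using Suc step[of "n + m" p] by simp
  qed simp
  have "hdist ?B (A n) \<le> 2 * r * (1/2) ^ n"
  proof (rule hdist_least)
    fix p :: 'v assume p: "p \<in> unit_dirs"
    have r: "0 \<le> r" using s0 by (simp add: r_def)
    have "\<bar>supp (A (m + n)) p - supp (A n) p\<bar> \<le> 2 * r * (1/2) ^ n" for m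
    proof -
      have "\<bar>supp (A (n + m)) p - supp (A n) p\<bar> \<le> norm p * r * (2 * (1/2) ^ n - 2 * (1/2) ^ (n + m))" by (rule tail)
      also have "\<dots> \<le> 1 * r * (2 * (1/2) ^ n)"
        using p r by (intro mult_mono mult_right_mono) (auto simp: power_add power_le_one mult_left_le)
      finally show ?thesis by (simp add: add.commute mult_ac)
    qed
    moreover have "(\<lambda>m. \<bar>supp (A (m + n)) p - supp (A n) p\<bar>) \<longlonglongrightarrow> \<bar>lim (\<lambda>n. supp (A n) p) - supp (A n) p\<bar>"
      by (intro tendsto_intros LIMSEQ_ignore_initial_segment lim)
    ultimately have "\<bar>lim (\<lambda>n. supp (A n) p) - supp (A n) p\<bar> \<le> 2 * r * (1/2) ^ n"
      by (intro LIMSEQ_le_const2) auto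
    then show "\<bar>supp ?B p - supp (A n) p\<bar> \<le> 2 * r * (1/2) ^ n" using L(2) p unfolding B by simp
  qed
  then have "(hdist ?B (A n))\<^sup>2 \<le> (2 * r * (1/2) ^ n)\<^sup>2"
    by (intro power_mono hdist_nonneg set_of_supp_ccs A)
  also have "\<dots> = 4 * s * (1/4) ^ n"
    using s0 by (simp add: r_def power_mult_distrib power_divide power_mult[symmetric] mult.commute[of n 2] power_mult)
  finally show ?thesis .
qed

text \<open>Against the weight \<open>exp (\<beta> * (T - s))\<close> the Volterra operator \<open>u \<mapsto> c * \<integral>\<^sub>t\<^sup>T u ds\<close> has norm at most
  \<open>c / \<beta>\<close>, which an appropriate \<open>\<beta>\<close> makes as small as desired.\<close>
lemma exp_weight_step:
  assumes c: "0 < c" and \<beta>: "0 < \<beta>" and B: "0 \<le> B" and t: "t \<in> {0..T}"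
    and v: "v \<le> ennreal c * (\<integral>\<^sup>+s\<in>{t..T}. u s \<partial>lborel)"
    and u: "\<And>s. s \<in> {0..T} \<Longrightarrow> u s \<le> ennreal (B * exp (\<beta> * (T - s)))"
  shows "v \<le> ennreal (c / \<beta> * B * exp (\<beta> * (T - t)))"
proof -
  have "(\<integral>\<^sup>+s\<in>{t..T}. u s \<partial>lborel) \<le> (\<integral>\<^sup>+s\<in>{t..T}. ennreal (B * exp (\<beta> * (T - s))) \<partial>lborel)"
    using t u by (intro nn_integral_mono) (auto simp: indicator_def)
  also have "\<dots> = ennreal (- (B / \<beta>) * exp (\<beta> * (T - T)) - (- (B / \<beta>) * exp (\<beta> * (T - t))))"
    by (rule nn_integral_FTC_Icc[where F = "\<lambda>s. - (B / \<beta>) * exp (\<beta> * (T - s))"])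
       (use B t \<beta> in \<open>auto intro!: derivative_eq_intros\<close>)
  also have "\<dots> \<le> ennreal (B / \<beta> * exp (\<beta> * (T - t)))"
    using B \<beta> by (intro ennreal_leI) simp
  finally have "ennreal c * (\<integral>\<^sup>+s\<in>{t..T}. u s \<partial>lborel) \<le> ennreal c * ennreal (B / \<beta> * exp (\<beta> * (T - t)))"
    by (rule mult_left_mono) simp
  also have "\<dots> = ennreal (c / \<beta> * B * exp (\<beta> * (T - t)))"
    using c B \<beta> by (subst ennreal_mult[symmetric]) auto
  finally show ?thesis using v by simp
qed

text \<open>With \<beta> = c / \<theta> the factor c / \<beta> of one step is exactly \<theta>;
  removing the weight at the end costs exp (c / \<theta> * T).\<close>

lemma exp_weight_iterate:
  assumes c: "0 < c" and \<theta>: "0 < \<theta>" and A: "0 \<le> A"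
    and e0: "\<And>t. t \<in> {0..T} \<Longrightarrow> e 0 t \<le> ennreal A"
    and eS: "\<And>n t. t \<in> {0..T} \<Longrightarrow> e (Suc n) t \<le> ennreal c * (\<integral>\<^sup>+s\<in>{t..T}. e n s \<partial>lborel)"
    and t: "t \<in> {0..T}"
  shows "e n t \<le> ennreal (A * exp (c / \<theta> * T) * \<theta> ^ n)"
proof -
  have "e n t \<le> ennreal (A * \<theta> ^ n * exp (c / \<theta> * (T - t)))" if "t \<in> {0..T}" for t
    using that
  proof (induction n arbitrary: t)
    case 0
    have "A * 1 \<le> A * exp (c / \<theta> * (T - t))" using 0 A c \<theta> by (intro mult_left_mono) auto
    then have "ennreal A \<le> ennreal (A * exp (c / \<theta> * (T - t)))" by (intro ennreal_leI) simp
    then show ?case using e0[OF 0] by (simp add: order_trans)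
  next
    case (Suc n)
    have "e (Suc n) t \<le> ennreal (c / (c / \<theta>) * (A * \<theta> ^ n) * exp (c / \<theta> * (T - t)))"
      using c \<theta> A by (intro exp_weight_step[OF c _ _ Suc.prems eS[OF Suc.prems] Suc.IH]) auto
    then show ?case using c by (simp add: mult_ac)
  qed
  from this[OF t] show ?thesis
  proof (rule order_trans)
    have "c / \<theta> * (T - t) \<le> c / \<theta> * T" using c \<theta> t by (intro mult_left_mono) auto
    then have "A * \<theta> ^ n * exp (c / \<theta> * (T - t)) \<le> A * \<theta> ^ n * exp (c / \<theta> * T)" using A \<theta> by (intro mult_left_mono) auto
    then show "ennreal (A * \<theta> ^ n * exp (c / \<theta> * (T - t))) \<le> ennreal (A * exp (c / \<theta> * T) * \<theta> ^ n)"
      by (intro ennreal_leI) (simp add: mult_ac)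
  qed
qed

section \<open>One step of the iteration as a progressive process\<close>

context filtration
begin

text \<open>After Fubini, a bound on the second moments that is uniform in t is integrated over an
  interval of finite length.\<close>

lemma set_process_L2I:
  fixes Y :: "real \<Rightarrow> 'w \<Rightarrow> 'v::euclidean_space set"
  assumes m: "set_measurable prog (case_prod Y)" and K: "\<And>t \<omega>. Y t \<omega> \<in> compact_convex_sets"
    and bound: "\<And>t. t \<in> {0..T} \<Longrightarrow> (\<integral>\<^sup>+\<omega>. ennreal (nrm (Y t \<omega>)) ^ 2 \<partial>M) \<le> C" and C: "C < \<infinity>"
  shows "Y \<in> set_process_L2 M F T"
  unfolding set_process_L2_iff L2_process_def
proof (intro conjI ballI m K)
  show nm: "case_prod (\<lambda>t \<omega>. nrm (Y t \<omega>)) \<in> borel_measurable prog"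
    using hdist_measurable[OF m _ set_measurable_const[OF ccs_closed_sets[OF zero_ccs]] zero_ccs] K
    by (simp add: case_prod_unfold)
  have n2: "case_prod (\<lambda>t \<omega>. ennreal (norm (nrm (Y t \<omega>))) ^ 2) \<in> borel_measurable prog"
    by (rule prog_compose[OF nm, of "\<lambda>x. ennreal (norm x) ^ 2"]) simp
  have "(\<integral>\<^sup>+\<omega>. (\<integral>\<^sup>+t\<in>{0..T}. ennreal (norm (nrm (Y t \<omega>))) ^ 2 \<partial>lborel) \<partial>M) = (\<integral>\<^sup>+t\<in>{0..T}. (\<integral>\<^sup>+\<omega>. ennreal (norm (nrm (Y t \<omega>))) ^ 2 \<partial>M) \<partial>lborel)"
    by (rule nn_time_Fubini[OF n2]) auto
  also have "\<dots> \<le> (\<integral>\<^sup>+t\<in>{0..T}. C \<partial>lborel)"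
    using bound nrm_nonneg[OF K] by (intro nn_integral_mono) (auto simp: indicator_def)
  also have "\<dots> = C * ennreal T" using T_pos by (subst nn_integral_cmult_indicator) auto
  also have "\<dots> < \<infinity>" using C by (simp add: ennreal_mult_less_top)
  finally show "(\<integral>\<^sup>+\<omega>. (\<integral>\<^sup>+t\<in>{0..T}. ennreal (norm (nrm (Y t \<omega>))) ^ 2 \<partial>lborel) \<partial>M) < \<infinity>" .
qed

lemma step_bound_finite:
  fixes \<xi> :: "'w \<Rightarrow> 'v::euclidean_space set"
  assumes \<xi>: "\<xi> \<in> set_Lp 2 M (F T)" and \<Phi>: "\<Phi> \<in> set_process_L2 M F T"
  shows "4 * ((\<integral>\<^sup>+\<omega>. ennreal (nrm (\<xi> \<omega>)) ^ 2 \<partial>M) +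
    ennreal T * (\<integral>\<^sup>+\<omega>. (\<integral>\<^sup>+s\<in>{0..T}. ennreal (nrm (\<Phi> s \<omega> :: 'v set)) ^ 2 \<partial>lborel) \<partial>M)) < \<infinity>"
proof -
  have "(\<integral>\<^sup>+\<omega>. ennreal (nrm (\<xi> \<omega>)) ^ 2 \<partial>M) \<le> (\<integral>\<^sup>+\<omega>. ennreal (norm (nrm (\<xi> \<omega>))) ^ 2 \<partial>M)"
    by (intro nn_integral_mono power_mono ennreal_leI) auto
  also have "\<dots> < \<infinity>" by (rule vec_LpD(2)[OF set_Lp2D(3)[OF \<xi>]])
  finally have 1: "(\<integral>\<^sup>+\<omega>. ennreal (nrm (\<xi> \<omega>)) ^ 2 \<partial>M) < \<infinity>" .
  have "(\<integral>\<^sup>+\<omega>. (\<integral>\<^sup>+s\<in>{0..T}. ennreal (nrm (\<Phi> s \<omega>)) ^ 2 \<partial>lborel) \<partial>M) \<le> (\<integral>\<^sup>+\<omega>. (\<integral>\<^sup>+s\<in>{0..T}. ennreal (norm (nrm (\<Phi> s \<omega>))) ^ 2 \<partial>lborel) \<partial>M)"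
    by (intro nn_integral_mono mult_right_mono power_mono ennreal_leI) auto
  also have "\<dots> < \<infinity>" using process_nrm_L2[OF \<Phi>] by (simp add: L2_process_def)
  finally show ?thesis using 1 by (simp add: ennreal_mult_less_top)
qed

text \<open>Splitting the integral at t, the conditional expectation of \<open>rhs\<close> from t on
  is that of \<open>rhs\<close> from 0 on minus the integral over [0,t]: a martingale, which has a
  progressive modification, minus a progressive process. At each t these values are almost surely
  those of the support function of a conditional expectation Z, so \<open>set_of_supp\<close>
  returns Z and its default matters on a null set only.\<close>

lemma step_process:
  fixes \<xi> :: "'w \<Rightarrow> (real ^ 'd) set"
  assumes \<xi>: "\<xi> \<in> set_Lp 2 M (F T)" and \<Phi>: "\<Phi> \<in> set_process_L2 M F T"
  obtains Y where "Y \<in> set_process_L2 M F T"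
    "\<And>t. t \<in> {0..T} \<Longrightarrow> AE \<omega> in M. \<forall>p\<in>dirs. supp (Y t \<omega>) p = real_cond_exp M (F t) (rhs \<xi> \<Phi> t p) \<omega>"
proof -
  have zero: "0 \<in> {0..T}" using T_pos by simp
  have "\<exists>N. case_prod N \<in> borel_measurable prog \<and> (\<forall>t\<in>{0..T}. AE \<omega> in M. N t \<omega> = real_cond_exp M (F t) (rhs \<xi> \<Phi> 0 p) \<omega>)" for p
  proof -
    note L = rhs_L2[OF \<xi> \<Phi> zero, of p]
    show ?thesis
      by (rule martingale_progressive_modification[OF vec_Lp_measurable[OF subalg[OF T_in] L] vec_LpD(2)[OF L]]) blast
  qed
  then obtain N where N: "\<And>p. case_prod (N p) \<in> borel_measurable prog"
    "\<And>p t. t \<in> {0..T} \<Longrightarrow> AE \<omega> in M. N p t \<omega> = real_cond_exp M (F t) (rhs \<xi> \<Phi> 0 p) \<omega>" by metis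
  define y where "y t \<omega> p = N p t \<omega> - (LBINT s:{0..t}. supp (\<Phi> s \<omega>) p)" for t \<omega> p
  have y_meas: "(\<lambda>x. y (fst x) (snd x) p) \<in> borel_measurable prog" for p
  proof -
    have "case_prod (\<lambda>s \<omega>. supp (\<Phi> s \<omega>) p) \<in> borel_measurable prog"
      using process_supp_L2[OF \<Phi>, of p] by (simp add: L2_process_def)
    from time_integral_progressive[OF this] N(1)[of p]
    show ?thesis unfolding y_def case_prod_unfold by (intro borel_measurable_diff)
  qed
  have y: "AE \<omega> in M. real_cond_exp M (F t) (rhs \<xi> \<Phi> t p) \<omega> = y t \<omega> p" if t: "t \<in> {0..T}" for t p
  proof -
    interpret A: sub_prob M "F t" by (rule sub_prob_F[OF t])
    let ?A = "\<lambda>\<omega>. LBINT s:{0..t}. supp (\<Phi> s \<omega>) p"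
    have "?A \<in> vec_Lp 2 M (F t)" by (rule L2_process_integral_vec_Lp[OF process_supp_L2[OF \<Phi>] _ t]) simp
    then have A_meas: "?A \<in> borel_measurable (F t)" and A_int: "integrable M ?A"
      using vec_LpD(1) vec_Lp2_integrable[OF t] by blast+
    have "AE \<omega> in M. rhs \<xi> \<Phi> 0 p \<omega> = ?A \<omega> + rhs \<xi> \<Phi> t p \<omega>"
      using L2_process_AE_integrable[OF process_supp_L2[OF \<Phi>, of p]]
    proof eventually_elim
      case (elim \<omega>)
      then show ?case using time_integral_split[OF elim t] by (simp add: rhs_def)
    qed
    then have "AE \<omega> in M. real_cond_exp M (F t) (rhs \<xi> \<Phi> 0 p) \<omega> = real_cond_exp M (F t) (\<lambda>\<omega>. ?A \<omega> + rhs \<xi> \<Phi> t p \<omega>) \<omega>"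
      using A_int rhs_integrable[OF \<xi> \<Phi> zero] rhs_integrable[OF \<xi> \<Phi> t]
      by (intro A.S.real_cond_exp_cong) auto
    moreover have "AE \<omega> in M. real_cond_exp M (F t) (\<lambda>\<omega>. ?A \<omega> + rhs \<xi> \<Phi> t p \<omega>) \<omega> =
      real_cond_exp M (F t) ?A \<omega> + real_cond_exp M (F t) (rhs \<xi> \<Phi> t p) \<omega>"
      by (rule A.S.real_cond_exp_add[OF A_int rhs_integrable[OF \<xi> \<Phi> t]])
    moreover have "AE \<omega> in M. real_cond_exp M (F t) ?A \<omega> = ?A \<omega>"
      by (rule A.S.real_cond_exp_F_meas[OF A_int A_meas])
    ultimately show ?thesis using N(2)[OF t, of p] by eventually_elim (simp add: y_def)
  qed
  define Y where "Y t \<omega> = set_of_supp (y t \<omega>)" for t \<omega>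
  have Y: "AE \<omega> in M. \<forall>p\<in>dirs. supp (Y t \<omega>) p = real_cond_exp M (F t) (rhs \<xi> \<Phi> t p) \<omega>" if t: "t \<in> {0..T}" for t
  proof -
    obtain I Z where I: "is_set_time_integral M F T t \<Phi> I" and Z: "is_set_cond_exp M (F t) (\<lambda>\<omega>. \<xi> \<omega> + I \<omega>) Z"
      by (rule step_exists[OF \<xi> \<Phi> t])
    have "AE \<omega> in M. \<forall>p\<in>dirs. real_cond_exp M (F t) (rhs \<xi> \<Phi> t p) \<omega> = y t \<omega> p"
      unfolding AE_ball_countable[OF countable_dirs] using y[OF t] by blast
    then show ?thesis using step_supp[OF \<xi> \<Phi> t I Z]
    proof eventually_elim
      case (elim \<omega>)
      have "Y t \<omega> = Z \<omega>" unfolding Y_def using elim by (intro set_of_supp_eq) auto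
      then show ?case using elim(3) by simp
    qed
  qed
  have "Y \<in> set_process_L2 M F T"
  proof (rule set_process_L2I)
    show "set_measurable prog (case_prod Y)"
      using set_of_supp_measurable[of "\<lambda>x. y (fst x) (snd x)", OF y_meas] by (simp add: Y_def case_prod_unfold)
    show "Y t \<omega> \<in> compact_convex_sets" for t \<omega> unfolding Y_def by (rule set_of_supp_ccs)
  qed (use step_norm_le[OF \<xi> \<Phi> _ Y] step_bound_finite[OF \<xi> \<Phi>] in auto)
  then show ?thesis using Y by (rule that)
qed

abbreviation mean_sq_hdist :: "(real \<Rightarrow> 'w \<Rightarrow> 'v::euclidean_space set) \<Rightarrow> (real \<Rightarrow> 'w \<Rightarrow> 'v set) \<Rightarrow> real \<Rightarrow> ennreal" where
  "mean_sq_hdist Y Z t \<equiv> \<integral>\<^sup>+\<omega>. ennreal (hdist (Y t \<omega>) (Z t \<omega>)) ^ 2 \<partial>M"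

lemma process_hdist_measurable:
  fixes Y Z :: "real \<Rightarrow> 'w \<Rightarrow> 'v::euclidean_space set"
  assumes Y: "Y \<in> set_process_L2 M F T" and Z: "Z \<in> set_process_L2 M F T" and t: "t \<in> {0..T}"
  shows "(\<lambda>\<omega>. hdist (Y t \<omega>) (Z t \<omega>)) \<in> borel_measurable M"
  using set_measurable_F_M[OF t set_prog_section[OF process_measurable[OF Y] t]] process_ccs[OF Y t]
    set_measurable_F_M[OF t set_prog_section[OF process_measurable[OF Z] t]] process_ccs[OF Z t]
  by (rule hdist_measurable)

lemma process_sq_hdist_measurable:
  fixes Y Z :: "real \<Rightarrow> 'w \<Rightarrow> 'v::euclidean_space set"
  assumes Y: "Y \<in> set_process_L2 M F T" and Z: "Z \<in> set_process_L2 M F T" and t: "t \<in> {0..T}"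
  shows "(\<lambda>\<omega>. ennreal (hdist (Y t \<omega>) (Z t \<omega>)) ^ 2) \<in> borel_measurable M"
  by (rule measurable_compose[OF process_hdist_measurable[OF assms], of "\<lambda>x. ennreal x ^ 2"]) simp

lemma sq_hdist_triangle:
  fixes Y Y' Z :: "real \<Rightarrow> 'w \<Rightarrow> 'v::euclidean_space set"
  assumes Y: "Y \<in> set_process_L2 M F T" and Y': "Y' \<in> set_process_L2 M F T" and Z: "Z \<in> set_process_L2 M F T" and t: "t \<in> {0..T}"
  shows "mean_sq_hdist Y Y' t \<le>
    4 * (mean_sq_hdist Y Z t + mean_sq_hdist Y' Z t)"
proof -
  have "mean_sq_hdist Y Y' t \<le>
    (\<integral>\<^sup>+\<omega>. 2 ^ 2 * (ennreal (hdist (Y t \<omega>) (Z t \<omega>)) ^ 2 + ennreal (hdist (Y' t \<omega>) (Z t \<omega>)) ^ 2) \<partial>M)"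
  proof (rule nn_integral_mono)
    fix \<omega> assume \<omega>: "\<omega> \<in> space M"
    note K = process_ccs[OF Y t \<omega>] process_ccs[OF Z t \<omega>] process_ccs[OF Y' t \<omega>]
    have "ennreal (hdist (Y t \<omega>) (Y' t \<omega>)) \<le> ennreal (hdist (Y t \<omega>) (Z t \<omega>) + hdist (Y' t \<omega>) (Z t \<omega>))"
      using hdist_triangle[OF K] by (intro ennreal_leI) (simp add: hdist_commute)
    also have "\<dots> = ennreal (hdist (Y t \<omega>) (Z t \<omega>)) + ennreal (hdist (Y' t \<omega>) (Z t \<omega>))"
      using K by (intro ennreal_plus hdist_nonneg)
    finally have "ennreal (hdist (Y t \<omega>) (Y' t \<omega>)) ^ 2 \<le> (ennreal (hdist (Y t \<omega>) (Z t \<omega>)) + ennreal (hdist (Y' t \<omega>) (Z t \<omega>))) ^ 2"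
      by (rule power_mono) simp
    also have "\<dots> \<le> 2 ^ 2 * (ennreal (hdist (Y t \<omega>) (Z t \<omega>)) ^ 2 + ennreal (hdist (Y' t \<omega>) (Z t \<omega>)) ^ 2)"
      by (rule ennreal_add_power_le)
    finally show "ennreal (hdist (Y t \<omega>) (Y' t \<omega>)) ^ 2 \<le> 2 ^ 2 * (ennreal (hdist (Y t \<omega>) (Z t \<omega>)) ^ 2 + ennreal (hdist (Y' t \<omega>) (Z t \<omega>)) ^ 2)" .
  qed
  also have "\<dots> = 2 ^ 2 * (mean_sq_hdist Y Z t + mean_sq_hdist Y' Z t)"
    unfolding nn_integral_add[OF process_sq_hdist_measurable[OF Y Z t] process_sq_hdist_measurable[OF Y' Z t], symmetric]
    by (intro nn_integral_cmult borel_measurable_add process_sq_hdist_measurable Y Y' Z t)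
  finally show ?thesis by simp
qed

lemma zero_process: "(\<lambda>t \<omega>. {0 :: 'v::euclidean_space}) \<in> set_process_L2 M F T"
proof (rule set_process_L2I)
  show "set_measurable prog (case_prod (\<lambda>t \<omega>. {0 :: 'v}))"
    unfolding case_prod_unfold by (intro set_measurable_const ccs_closed_sets zero_ccs)
  show "(\<integral>\<^sup>+\<omega>. ennreal (nrm {0 :: 'v}) ^ 2 \<partial>M) \<le> 0" for t :: real by simp
qed simp_all

end

section \<open>The equation with a Lipschitz driver\<close>

locale bsde = filtration M F T for M :: "'w measure" and F T +
  fixes \<xi> :: "'w \<Rightarrow> (real ^ 'd) set" and f :: "real \<Rightarrow> 'w \<Rightarrow> (real ^ 'd) set \<Rightarrow> (real ^ 'd) set" and K :: real
  assumes \<xi>: "\<xi> \<in> set_Lp 2 M (F T)"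
    and f_ccs: "\<And>t \<omega> A. t \<in> {0..T} \<Longrightarrow> \<omega> \<in> space M \<Longrightarrow> A \<in> compact_convex_sets \<Longrightarrow> f t \<omega> A \<in> compact_convex_sets"
    and f_prog: "\<And>A. A \<in> compact_convex_sets \<Longrightarrow> set_progressive F T (\<lambda>t \<omega>. f t \<omega> A)"
    and f_zero: "(\<integral>\<^sup>+\<omega>. (\<integral>\<^sup>+t\<in>{0..T}. set_norm (f t \<omega> {0}) ^ 2 \<partial>lborel) \<partial>M) < \<infinity>"
    and K_pos: "0 < K"
    and f_lip: "\<And>t \<omega> A A'. t \<in> {0..T} \<Longrightarrow> \<omega> \<in> space M \<Longrightarrow> A \<in> compact_convex_sets \<Longrightarrow> A' \<in> compact_convex_sets \<Longrightarrow>
      hausdorff_dist (f t \<omega> A) (f t \<omega> A') \<le> ennreal K * hausdorff_dist A A'"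
begin

abbreviation comp :: "(real \<Rightarrow> 'w \<Rightarrow> (real ^ 'd) set) \<Rightarrow> real \<Rightarrow> 'w \<Rightarrow> (real ^ 'd) set" where
  "comp Y \<equiv> \<lambda>s \<omega>. f s \<omega> (Y s \<omega>)"

lemma f_hdist:
  assumes "t \<in> {0..T}" "\<omega> \<in> space M" "A \<in> compact_convex_sets" "A' \<in> compact_convex_sets"
  shows "hdist (f t \<omega> A) (f t \<omega> A') \<le> K * hdist A A'"
proof -
  have "ennreal (hdist (f t \<omega> A) (f t \<omega> A')) \<le> ennreal (K * hdist A A')"
    using f_lip[OF assms] hausdorff_dist_eq[OF f_ccs f_ccs, of t \<omega> A t \<omega> A'] assms hausdorff_dist_eq[OF assms(3,4)] K_pos hdist_nonneg[OF assms(3,4)]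
    by (simp add: ennreal_mult)
  then show ?thesis using K_pos hdist_nonneg[OF assms(3,4)] by (subst (asm) ennreal_le_iff) auto
qed

text \<open>Joint measurability is the Caratheodory property of f; integrability follows from
  \<open>nrm (f t \<omega> A) \<le> nrm (f t \<omega> {0}) + K * nrm A\<close>.\<close>

lemma comp_L2:
  assumes Y: "Y \<in> set_process_L2 M F T"
  shows "comp Y \<in> set_process_L2 M F T"
proof -
  have f0: "(\<lambda>t \<omega>. f t \<omega> {0}) \<in> set_process_L2 M F T"
    unfolding set_process_L2_def using f_prog f_ccs f_zero zero_ccs by auto
  have m: "set_measurable prog (\<lambda>x. f (fst x) (snd x) (case_prod Y x))"
  proof (rule set_measurable_caratheodory[where f = "\<lambda>x. f (fst x) (snd x)" and K = K])
    show "set_measurable prog (\<lambda>x. f (fst x) (snd x) A)" if "A \<in> compact_convex_sets" for A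
      using f_prog[OF that] unfolding set_progressive_iff case_prod_unfold .
    show "f (fst x) (snd x) A \<in> compact_convex_sets" if "x \<in> space prog" "A \<in> compact_convex_sets" for x A
      using that by (intro f_ccs) (auto simp: space_prog)
    show "hdist (f (fst x) (snd x) A) (f (fst x) (snd x) B) \<le> K * hdist A B"
      if "x \<in> space prog" "A \<in> compact_convex_sets" "B \<in> compact_convex_sets" for x A B
      using that by (intro f_hdist) (auto simp: space_prog)
    show "set_measurable prog (case_prod Y)" by (rule process_measurable[OF Y])
    show "case_prod Y x \<in> compact_convex_sets" if "x \<in> space prog" for x by (rule process_ccs'[OF Y that])
  qed
  then have m: "set_measurable prog (case_prod (comp Y))" by (simp add: case_prod_unfold)
  have ccs: "comp Y t \<omega> \<in> compact_convex_sets" if "t \<in> {0..T}" "\<omega> \<in> space M" for t \<omega>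
    using that by (intro f_ccs process_ccs[OF Y])
  have "L2_process (\<lambda>t \<omega>. K * nrm (Y t \<omega>))"
  proof (rule L2_process_bound[OF _ process_nrm_L2[OF Y], of _ K])
    show "case_prod (\<lambda>t \<omega>. K * nrm (Y t \<omega>)) \<in> borel_measurable prog"
      using process_nrm_L2[OF Y] by (intro prog_compose[of "\<lambda>t \<omega>. nrm (Y t \<omega>)" borel "\<lambda>x. K * x"]) (auto simp: L2_process_def)
  qed (use K_pos in \<open>simp add: abs_mult\<close>)
  from L2_process_add[OF process_nrm_L2[OF f0] this]
  have "L2_process (\<lambda>t \<omega>. nrm (comp Y t \<omega>))"
  proof (rule L2_process_bound[rotated, where c = 1])
    show "case_prod (\<lambda>t \<omega>. nrm (comp Y t \<omega>)) \<in> borel_measurable prog"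
      using hdist_measurable[OF m _ set_measurable_const[OF ccs_closed_sets[OF zero_ccs]] zero_ccs] ccs
      by (auto simp: case_prod_unfold space_prog)
    fix t \<omega> assume t: "t \<in> {0..T}" and \<omega>: "\<omega> \<in> space M"
    note K0 = f_ccs[OF t \<omega> zero_ccs] and KY = process_ccs[OF Y t \<omega>]
    have "nrm (comp Y t \<omega>) \<le> hdist (comp Y t \<omega>) (f t \<omega> {0}) + nrm (f t \<omega> {0})"
      by (rule hdist_triangle[OF ccs[OF t \<omega>] K0 zero_ccs])
    also have "hdist (comp Y t \<omega>) (f t \<omega> {0}) \<le> K * nrm (Y t \<omega>)" by (rule f_hdist[OF t \<omega> KY zero_ccs])
    finally show "norm (nrm (comp Y t \<omega>)) \<le> 1 * norm (nrm (f t \<omega> {0}) + K * nrm (Y t \<omega>))"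
      using nrm_nonneg[OF ccs[OF t \<omega>]] by simp
  qed
  then show ?thesis unfolding set_process_L2_iff using m ccs by blast
qed

text \<open>T comes from Cauchy-Schwarz in time, \<open>K\<^sup>2\<close> from the Lipschitz bound
  on squared distances.\<close>

definition c :: real where "c = T * K\<^sup>2"

lemma c_pos: "0 < c"
  using T_pos K_pos by (simp add: c_def)

abbreviation solves_step :: "(real \<Rightarrow> 'w \<Rightarrow> (real ^ 'd) set) \<Rightarrow> (real \<Rightarrow> 'w \<Rightarrow> (real ^ 'd) set) \<Rightarrow> bool" where
  "solves_step Z Y \<equiv> \<forall>t\<in>{0..T}. AE \<omega> in M. \<forall>p\<in>dirs. supp (Y t \<omega>) p = real_cond_exp M (F t) (rhs \<xi> (comp Z) t p) \<omega>"

text \<open>\<open>step_hdist_le\<close> followed by the Lipschitz bound under the integral. The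
  result is a Volterra inequality; as c may be large, it contracts only against an exponential
  weight.\<close>

lemma contraction:
  assumes Z1: "Z1 \<in> set_process_L2 M F T" and Z2: "Z2 \<in> set_process_L2 M F T"
    and Y1: "solves_step Z1 Y1" and Y2: "solves_step Z2 Y2" and t: "t \<in> {0..T}"
  shows "mean_sq_hdist Y1 Y2 t \<le>
    ennreal c * (\<integral>\<^sup>+s\<in>{t..T}. mean_sq_hdist Z1 Z2 s \<partial>lborel)"
proof -
  have t': "{t..T} \<subseteq> {0..T}" using t by auto
  have d_meas: "case_prod (\<lambda>s \<omega>. ennreal (hdist (Z1 s \<omega>) (Z2 s \<omega>)) ^ 2) \<in> borel_measurable prog"
  proof -
    have "(\<lambda>x. hdist (case_prod Z1 x) (case_prod Z2 x)) \<in> borel_measurable prog"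
      by (rule hdist_measurable[OF process_measurable[OF Z1] process_ccs'[OF Z1] process_measurable[OF Z2] process_ccs'[OF Z2]])
    from measurable_compose[OF this, of "\<lambda>x. ennreal x ^ 2" borel] show ?thesis by (simp add: case_prod_unfold)
  qed
  have ind: "indicator {t..T} s * indicator {0..T} s = (indicator {t..T} s :: ennreal)" for s
    using t' by (auto simp: indicator_def)
  have "(\<lambda>s. mean_sq_hdist Z1 Z2 s * indicator {0..T} s * indicator {t..T} s) \<in> borel_measurable lborel"
    by (intro borel_measurable_times_ennreal nn_expectation_measurable[OF d_meas]) auto
  then have E_meas: "(\<lambda>s. mean_sq_hdist Z1 Z2 s * indicator {t..T} s) \<in> borel_measurable lborel"
    by (simp add: mult.assoc mult.commute[of "indicator {0..T} _"] ind)
  have "mean_sq_hdist Y1 Y2 t \<le>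
    ennreal T * (\<integral>\<^sup>+s\<in>{t..T}. mean_sq_hdist (comp Z1) (comp Z2) s \<partial>lborel)"
    using Y1 Y2 t by (intro step_hdist_le[OF \<xi> comp_L2[OF Z1] comp_L2[OF Z2] t]) auto
  also have "\<dots> \<le> ennreal T * (\<integral>\<^sup>+s. ennreal (K\<^sup>2) * (mean_sq_hdist Z1 Z2 s * indicator {t..T} s) \<partial>lborel)"
  proof (intro mult_left_mono nn_integral_mono)
    fix s
    show "mean_sq_hdist (comp Z1) (comp Z2) s * indicator {t..T} s \<le>
      ennreal (K\<^sup>2) * (mean_sq_hdist Z1 Z2 s * indicator {t..T} s)"
    proof (cases "s \<in> {t..T}")
      case True
      then have s: "s \<in> {0..T}" using t' by blast
      have "mean_sq_hdist (comp Z1) (comp Z2) s \<le> (\<integral>\<^sup>+\<omega>. ennreal (K\<^sup>2) * ennreal (hdist (Z1 s \<omega>) (Z2 s \<omega>)) ^ 2 \<partial>M)"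
      proof (rule nn_integral_mono)
        fix \<omega> assume \<omega>: "\<omega> \<in> space M"
        note K1 = process_ccs[OF Z1 s \<omega>] and K2 = process_ccs[OF Z2 s \<omega>]
        have "(hdist (comp Z1 s \<omega>) (comp Z2 s \<omega>))\<^sup>2 \<le> (K * hdist (Z1 s \<omega>) (Z2 s \<omega>))\<^sup>2"
          by (intro power_mono f_hdist[OF s \<omega> K1 K2] hdist_nonneg f_ccs s \<omega> K1 K2)
        then have "ennreal ((hdist (comp Z1 s \<omega>) (comp Z2 s \<omega>))\<^sup>2) \<le> ennreal (K\<^sup>2 * (hdist (Z1 s \<omega>) (Z2 s \<omega>))\<^sup>2)"
          by (intro ennreal_leI) (simp add: power_mult_distrib)
        then show "ennreal (hdist (comp Z1 s \<omega>) (comp Z2 s \<omega>)) ^ 2 \<le> ennreal (K\<^sup>2) * ennreal (hdist (Z1 s \<omega>) (Z2 s \<omega>)) ^ 2"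
          using hdist_nonneg[OF K1 K2] hdist_nonneg[OF f_ccs[OF s \<omega> K1] f_ccs[OF s \<omega> K2]] by (simp add: ennreal_mult ennreal_power)
      qed
      also have "\<dots> = ennreal (K\<^sup>2) * mean_sq_hdist Z1 Z2 s"
        by (rule nn_integral_cmult[OF process_sq_hdist_measurable[OF Z1 Z2 s]])
      finally show ?thesis using True by simp
    qed simp
  qed simp
  also have "\<dots> = ennreal T * (ennreal (K\<^sup>2) * (\<integral>\<^sup>+s\<in>{t..T}. mean_sq_hdist Z1 Z2 s \<partial>lborel))"
    by (simp add: nn_integral_cmult[OF E_meas])
  also have "\<dots> = ennreal c * (\<integral>\<^sup>+s\<in>{t..T}. mean_sq_hdist Z1 Z2 s \<partial>lborel)"
    using T_pos by (simp add: c_def ennreal_mult mult.assoc)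
  finally show ?thesis .
qed

text \<open>Membership in \<open>set_process_L2\<close> controls an average over t, while the
  weighted iteration starts from a bound valid at every t; one application of the equation provides
  it.\<close>

lemma solution_bound:
  assumes Z: "Z \<in> set_process_L2 M F T" and Y: "solves_step Z Y"
  obtains A where "0 \<le> A" "\<And>t. t \<in> {0..T} \<Longrightarrow> (\<integral>\<^sup>+\<omega>. ennreal (nrm (Y t \<omega>)) ^ 2 \<partial>M) \<le> ennreal A"
proof -
  let ?C = "4 * ((\<integral>\<^sup>+\<omega>. ennreal (nrm (\<xi> \<omega>)) ^ 2 \<partial>M) + ennreal T * (\<integral>\<^sup>+\<omega>. (\<integral>\<^sup>+s\<in>{0..T}. ennreal (nrm (comp Z s \<omega>)) ^ 2 \<partial>lborel) \<partial>M))"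
  obtain A where A: "?C = ennreal A" "0 \<le> A" using step_bound_finite[OF \<xi> comp_L2[OF Z]] by (cases ?C) auto
  show ?thesis using step_norm_le[OF \<xi> comp_L2[OF Z]] Y unfolding A(1) by (intro that[OF A(2)]) auto
qed

lemma AE_eq_if_sq_hdist_0:
  assumes Y: "Y \<in> set_process_L2 M F T" and Z: "Z \<in> set_process_L2 M F T" and t: "t \<in> {0..T}"
    and 0: "mean_sq_hdist Y Z t = 0"
  shows "AE \<omega> in M. Y t \<omega> = (Z t \<omega> :: (real ^ 'd) set)"
proof -
  have "AE \<omega> in M. ennreal (hdist (Y t \<omega>) (Z t \<omega>)) ^ 2 = 0"
    using 0 nn_integral_0_iff_AE[OF process_sq_hdist_measurable[OF Y Z t]] by blast
  then show ?thesis using AE_space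
  proof eventually_elim
    case (elim \<omega>)
    note K = process_ccs[OF Y t elim(2)] process_ccs[OF Z t elim(2)]
    have "hdist (Y t \<omega>) (Z t \<omega>) = 0" using elim(1) hdist_nonneg[OF K] by (simp add: ennreal_eq_0_iff)
    then show ?case by (rule hdist_0_imp_eq[OF K])
  qed
qed

lemma ennreal_geometric_le_imp_0:
  assumes "\<And>n. v \<le> ennreal (B * q ^ n)" "0 \<le> q" "q < 1"
  shows "v = 0"
proof -
  have "(\<lambda>n. B * q ^ n) \<longlonglongrightarrow> B * 0" using assms by (intro tendsto_intros LIMSEQ_power_zero) auto
  then have "(\<lambda>n. ennreal (B * q ^ n)) \<longlonglongrightarrow> ennreal 0" by (intro tendsto_ennrealI) simp
  then have "v \<le> ennreal 0" by (rule LIMSEQ_le_const) (use assms in auto)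
  then show ?thesis by simp
qed

text \<open>The mean square distance d of two solutions satisfies the Volterra inequality with d on
  both sides, so the iteration estimate applies to the constant sequence d and bounds it by
  arbitrarily small quantities. Any ratio in (0,1) would do in place of 1/2.\<close>

lemma solution_unique:
  assumes Y: "Y \<in> set_process_L2 M F T" "solves_step Y Y" and Y': "Y' \<in> set_process_L2 M F T" "solves_step Y' Y'"
    and t: "t \<in> {0..T}"
  shows "AE \<omega> in M. Y t \<omega> = Y' t \<omega>"
proof (rule AE_eq_if_sq_hdist_0[OF Y(1) Y'(1) t])
  define d where "d s = mean_sq_hdist Y Y' s" for s
  obtain A where A: "0 \<le> A" "\<And>t. t \<in> {0..T} \<Longrightarrow> (\<integral>\<^sup>+\<omega>. ennreal (nrm (Y t \<omega>)) ^ 2 \<partial>M) \<le> ennreal A"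
    by (rule solution_bound[OF Y]) blast
  obtain A' where A': "0 \<le> A'" "\<And>t. t \<in> {0..T} \<Longrightarrow> (\<integral>\<^sup>+\<omega>. ennreal (nrm (Y' t \<omega>)) ^ 2 \<partial>M) \<le> ennreal A'"
    by (rule solution_bound[OF Y']) blast
  have d0: "d s \<le> ennreal (4 * (A + A'))" if s: "s \<in> {0..T}" for s
  proof -
    have "d s \<le> 4 * ((\<integral>\<^sup>+\<omega>. ennreal (nrm (Y s \<omega>)) ^ 2 \<partial>M) + (\<integral>\<^sup>+\<omega>. ennreal (nrm (Y' s \<omega>)) ^ 2 \<partial>M))"
      unfolding d_def by (rule sq_hdist_triangle[OF Y(1) Y'(1) zero_process s])
    also have "\<dots> \<le> 4 * (ennreal A + ennreal A')" by (intro mult_left_mono add_mono A(2) A'(2) s) simp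
    also have "\<dots> = ennreal (4 * (A + A'))" using A(1) A'(1) by (simp add: ennreal_mult)
    finally show ?thesis .
  qed
  have "d t \<le> ennreal (4 * (A + A') * exp (c / (1/2) * T) * (1/2) ^ n)" for n
    using A(1) A'(1) d0 contraction[OF Y(1) Y'(1) Y(2) Y'(2)]
    by (intro exp_weight_iterate[OF c_pos, where e = "\<lambda>_. d"] t) (auto simp: d_def)
  then show "mean_sq_hdist Y Y' t = 0"
    unfolding d_def[symmetric] by (rule ennreal_geometric_le_imp_0) auto
qed

text \<open>The ratio 1/16 keeps the squared increments summable in mean even after multiplication
  by 4^n, so at each t the iterates converge in \<open>hdist\<close> almost surely. The limit taken
  pointwise through support functions, with a default where it fails to exist, is then progressive
  because the iterates are.\<close>

lemma solution_exists:
  obtains Y where "Y \<in> set_process_L2 M F T" "solves_step Y Y"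
proof -
  define \<Psi> where "\<Psi> Z = (SOME Y. Y \<in> set_process_L2 M F T \<and> solves_step Z Y)" for Z
  have \<Psi>: "\<Psi> Z \<in> set_process_L2 M F T" "solves_step Z (\<Psi> Z)" if Z: "Z \<in> set_process_L2 M F T" for Z
  proof -
    have "\<exists>Y. Y \<in> set_process_L2 M F T \<and> solves_step Z Y"
      by (rule step_process[OF \<xi> comp_L2[OF Z]]) blast
    from someI_ex[OF this] show "\<Psi> Z \<in> set_process_L2 M F T" "solves_step Z (\<Psi> Z)"
      unfolding \<Psi>_def by blast+
  qed
  define Y where "Y n = (\<Psi> ^^ n) (\<lambda>t \<omega>. {0})" for n
  have Y_Suc: "Y (Suc n) = \<Psi> (Y n)" for n by (simp add: Y_def)
  have Y_0: "Y 0 = (\<lambda>t \<omega>. {0})" by (simp add: Y_def)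
  have Y: "Y n \<in> set_process_L2 M F T" for n
  proof (induction n)
    case 0 show ?case unfolding Y_0 by (rule zero_process)
  next
    case (Suc n) then show ?case unfolding Y_Suc by (rule \<Psi>(1))
  qed
  have Y_step: "solves_step (Y n) (Y (Suc n))" for n unfolding Y_Suc by (rule \<Psi>(2)[OF Y])
  note Y_ccs = process_ccs[OF Y]
  define e where "e n t = mean_sq_hdist (Y (Suc n)) (Y n) t" for n t
  obtain A where A: "0 \<le> A" "\<And>t. t \<in> {0..T} \<Longrightarrow> (\<integral>\<^sup>+\<omega>. ennreal (nrm (Y (Suc 0) t \<omega>)) ^ 2 \<partial>M) \<le> ennreal A"
    by (rule solution_bound[OF Y Y_step]) blast
  \<comment> \<open>A bounds the first increment, since \<open>Y 0\<close> is constantly {0}; the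
    exponential is the price of the ratio 1/16.\<close>
  define B where "B = A * exp (c / (1/16) * T)"
  have B: "0 \<le> B" using A(1) by (simp add: B_def)
  have e_le: "e n t \<le> ennreal (B * (1/16) ^ n)" if t: "t \<in> {0..T}" for n t
    unfolding B_def
  proof (rule exp_weight_iterate[OF c_pos _ A(1) _ _ t])
    show "e 0 t \<le> ennreal A" if "t \<in> {0..T}" for t using A(2)[OF that] by (simp add: e_def Y_def)
    show "e (Suc n) t \<le> ennreal c * (\<integral>\<^sup>+s\<in>{t..T}. e n s \<partial>lborel)" if "t \<in> {0..T}" for n t
      unfolding e_def by (rule contraction[OF Y Y Y_step Y_step that])
  qed simp
  \<comment> \<open>Where this sum is finite, it serves as the constant s in
    \<open>iterates_converge\<close>.\<close>
  define S where "S t \<omega> = (\<Sum>n. 4 ^ n * ennreal (hdist (Y (Suc n) t \<omega>) (Y n t \<omega>)) ^ 2)" for t \<omega>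
  have S_meas: "S t \<in> borel_measurable M" if t: "t \<in> {0..T}" for t
    unfolding S_def by (intro borel_measurable_suminf_order borel_measurable_times_ennreal process_sq_hdist_measurable Y t) simp
  have S_le: "(\<integral>\<^sup>+\<omega>. S t \<omega> \<partial>M) \<le> ennreal (2 * B)" if t: "t \<in> {0..T}" for t
  proof -
    have "(\<integral>\<^sup>+\<omega>. S t \<omega> \<partial>M) = (\<Sum>n. \<integral>\<^sup>+\<omega>. 4 ^ n * ennreal (hdist (Y (Suc n) t \<omega>) (Y n t \<omega>)) ^ 2 \<partial>M)"
      unfolding S_def by (intro nn_integral_suminf borel_measurable_times_ennreal process_sq_hdist_measurable Y t) simp
    also have "\<dots> = (\<Sum>n. 4 ^ n * e n t)"
      unfolding e_def by (intro suminf_cong nn_integral_cmult process_sq_hdist_measurable Y t)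
    also have "\<dots> \<le> (\<Sum>n. ennreal (B * (1/2) ^ n))"
    proof (intro suminf_le allI)
      fix n
      have "4 ^ n * e n t \<le> 4 ^ n * ennreal (B * (1/16) ^ n)" by (intro mult_left_mono e_le[OF t]) simp
      also have "\<dots> = ennreal (4 ^ n * (B * (1/16) ^ n))"
      proof -
        have "(4 :: ennreal) ^ n = ennreal (4 ^ n)" by (metis ennreal_numeral ennreal_power zero_le_numeral)
        then show ?thesis using B by (simp add: ennreal_mult)
      qed
      also have "4 ^ n * (B * (1/16) ^ n) = B * (4 * (1/16)) ^ n"
        unfolding power_mult_distrib by (simp only: mult_ac)
      \<comment> \<open>The ratio is 4/16 = 1/4; the majorant 1/2 is convenient, with geometric sum
        2.\<close>
      also have "ennreal (B * (4 * (1/16)) ^ n) \<le> ennreal (B * (1/2) ^ n)"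
        using B by (intro ennreal_leI mult_left_mono power_mono) auto
      finally show "4 ^ n * e n t \<le> ennreal (B * (1/2) ^ n)" .
    qed auto
    also have "\<dots> = ennreal (\<Sum>n. B * (1/2) ^ n)"
      using B by (intro suminf_ennreal2 summable_mult summable_geometric) auto
    also have "(\<Sum>n. B * (1/2 :: real) ^ n) = 2 * B"
      by (simp add: suminf_mult suminf_geometric summable_geometric)
    finally show ?thesis .
  qed
  define L where "L t \<omega> = set_of_supp (\<lambda>p. lim (\<lambda>n. supp (Y n t \<omega>) p))" for t \<omega>
  have L_le: "mean_sq_hdist L (Y n) t \<le> ennreal (8 * B * (1/4) ^ n)" if t: "t \<in> {0..T}" for n t
  proof -
    have "AE \<omega> in M. S t \<omega> \<noteq> \<infinity>"
      using S_le[OF t] by (intro nn_integral_PInf_AE S_meas[OF t]) (auto simp: top_unique)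
    then have "AE \<omega> in M. ennreal (hdist (L t \<omega>) (Y n t \<omega>)) ^ 2 \<le> ennreal (4 * (1/4) ^ n) * S t \<omega>"
      using AE_space
    proof eventually_elim
      case (elim \<omega>)
      then obtain s where s: "S t \<omega> = ennreal s" "0 \<le> s" by (cases "S t \<omega>") auto
      note K = Y_ccs[OF t elim(2)]
      have "4 ^ n * (hdist (Y (Suc n) t \<omega>) (Y n t \<omega>))\<^sup>2 \<le> s" for n
      proof -
        have "4 ^ n * ennreal (hdist (Y (Suc n) t \<omega>) (Y n t \<omega>)) ^ 2 \<le> S t \<omega>"
          unfolding S_def using sum_le_suminf[of "\<lambda>n. 4 ^ n * ennreal (hdist (Y (Suc n) t \<omega>) (Y n t \<omega>)) ^ 2" "{n}"] by simp
        moreover have "4 ^ n * ennreal (hdist (Y (Suc n) t \<omega>) (Y n t \<omega>)) ^ 2 = ennreal (4 ^ n * (hdist (Y (Suc n) t \<omega>) (Y n t \<omega>))\<^sup>2)"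
        proof -
          have "(4 :: ennreal) ^ n = ennreal (4 ^ n)" by (metis ennreal_numeral ennreal_power zero_le_numeral)
          then show ?thesis using hdist_nonneg[OF K K] by (simp add: ennreal_mult ennreal_power)
        qed
        ultimately show ?thesis using s by simp
      qed
      from iterates_converge[OF K this]
      have "(hdist (L t \<omega>) (Y n t \<omega>))\<^sup>2 \<le> 4 * s * (1/4) ^ n" unfolding L_def .
      then have "ennreal ((hdist (L t \<omega>) (Y n t \<omega>))\<^sup>2) \<le> ennreal (4 * (1/4) ^ n * s)"
        by (intro ennreal_leI) (simp add: mult_ac)
      moreover have "0 \<le> hdist (L t \<omega>) (Y n t \<omega>)" unfolding L_def by (intro hdist_nonneg set_of_supp_ccs K)
      ultimately show ?case using s by (simp add: ennreal_power ennreal_mult[symmetric])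
    qed
    then have "mean_sq_hdist L (Y n) t \<le> (\<integral>\<^sup>+\<omega>. ennreal (4 * (1/4) ^ n) * S t \<omega> \<partial>M)"
      by (rule nn_integral_mono_AE)
    also have "\<dots> = ennreal (4 * (1/4) ^ n) * (\<integral>\<^sup>+\<omega>. S t \<omega> \<partial>M)" by (rule nn_integral_cmult[OF S_meas[OF t]])
    also have "\<dots> \<le> ennreal (4 * (1/4) ^ n) * ennreal (2 * B)" by (intro mult_left_mono S_le t) simp
    also have "\<dots> = ennreal (8 * B * (1/4) ^ n)" using B by (subst ennreal_mult[symmetric]) (auto simp: mult_ac)
    finally show ?thesis .
  qed
  have L: "L \<in> set_process_L2 M F T"
  proof (rule set_process_L2I)
    have "(\<lambda>x. lim (\<lambda>n. supp (case_prod (Y n) x) p)) \<in> borel_measurable prog" for p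
      by (intro borel_measurable_lim_metric supp_measurable process_measurable ccsD(2) process_ccs' Y)
    from set_of_supp_measurable[of "\<lambda>x p. lim (\<lambda>n. supp (case_prod (Y n) x) p)", OF this]
    show "set_measurable prog (case_prod L)" by (simp add: L_def case_prod_unfold)
    show "L t \<omega> \<in> compact_convex_sets" for t \<omega> unfolding L_def by (rule set_of_supp_ccs)
    show "(\<integral>\<^sup>+\<omega>. ennreal (nrm (L t \<omega>)) ^ 2 \<partial>M) \<le> ennreal (8 * B)" if "t \<in> {0..T}" for t
      using L_le[OF that, of 0] by (simp add: Y_def)
  qed simp
  have L_fix: "AE \<omega> in M. L t \<omega> = \<Psi> L t \<omega>" if t: "t \<in> {0..T}" for t
  proof (rule AE_eq_if_sq_hdist_0[OF L \<Psi>(1)[OF L] t])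
    \<comment> \<open>Both L and \<open>\<Psi> L\<close> are compared with \<open>Y (Suc n)\<close>:
      the former by convergence, the latter by the Volterra inequality applied to L and
      \<open>Y n\<close>.\<close>
    have "mean_sq_hdist L (\<Psi> L) t \<le> ennreal (4 * (8 * B + c * (8 * B * T)) * (1/4) ^ n)" for n
    proof -
      have t': "{t..T} \<subseteq> {0..T}" using t by auto
      have "(\<integral>\<^sup>+s\<in>{t..T}. mean_sq_hdist L (Y n) s \<partial>lborel) \<le> (\<integral>\<^sup>+s. ennreal (8 * B * (1/4) ^ n) * indicator {0..T} s \<partial>lborel)"
        using t' L_le by (intro nn_integral_mono) (auto simp: indicator_def)
      also have "\<dots> = ennreal (8 * B * (1/4) ^ n * T)"
        using B T_pos by (subst nn_integral_cmult_indicator) (auto simp: ennreal_mult)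
      finally have "mean_sq_hdist (\<Psi> L) (Y (Suc n)) t \<le> ennreal c * ennreal (8 * B * (1/4) ^ n * T)"
        by (intro order_trans[OF contraction[OF L Y \<Psi>(2)[OF L] Y_step t]] mult_left_mono) auto
      moreover have "mean_sq_hdist L (Y (Suc n)) t \<le> ennreal (8 * B * (1/4) ^ n)"
      proof (rule order_trans[OF L_le[OF t]])
        show "ennreal (8 * B * (1/4) ^ Suc n) \<le> ennreal (8 * B * (1/4) ^ n)"
          using B by (intro ennreal_leI mult_left_mono power_decreasing) auto
      qed
      ultimately have "mean_sq_hdist L (\<Psi> L) t \<le> 4 * (ennreal (8 * B * (1/4) ^ n) + ennreal c * ennreal (8 * B * (1/4) ^ n * T))"
        by (intro order_trans[OF sq_hdist_triangle[OF L \<Psi>(1)[OF L] Y t]] mult_left_mono add_mono) auto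
      also have "\<dots> = ennreal (4 * (8 * B * (1/4) ^ n + c * (8 * B * (1/4) ^ n * T)))"
      proof -
        have "4 * (ennreal x + ennreal c * ennreal y) = ennreal (4 * (x + c * y))" if "0 \<le> x" "0 \<le> y" for x y
          using that c_pos by (simp add: ennreal_mult)
        then show ?thesis using B T_pos by simp
      qed
      also have "4 * (8 * B * (1/4) ^ n + c * (8 * B * (1/4) ^ n * T)) = 4 * (8 * B + c * (8 * B * T)) * (1/4) ^ n"
        by (simp add: algebra_simps)
      finally show ?thesis .
    qed
    then show "mean_sq_hdist L (\<Psi> L) t = 0"
      by (rule ennreal_geometric_le_imp_0) auto
  qed
  \<comment> \<open>The right-hand side contains L as a process and is the one attained by
    \<open>\<Psi> L\<close>. On the left only the value at time t enters, where L and
    \<open>\<Psi> L\<close> agree almost surely.\<close>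
  have "solves_step L L"
  proof
    fix t assume t: "t \<in> {0..T}"
    from L_fix[OF t] bspec[OF \<Psi>(2)[OF L] t]
    show "AE \<omega> in M. \<forall>p\<in>dirs. supp (L t \<omega>) p = real_cond_exp M (F t) (rhs \<xi> (comp L) t p) \<omega>"
      by eventually_elim simp
  qed
  with L show ?thesis by (rule that)
qed

lemma bsde_solution_iff: "set_bsde_solution M F T \<xi> f Y \<longleftrightarrow> Y \<in> set_process_L2 M F T \<and> solves_step Y Y"
  unfolding set_bsde_solution_iff[OF \<xi>] using comp_L2 by blast

end

section \<open>The filtration of the Brownian motion and the conclusion\<close>

lemma natural_filtration_filtration:
  fixes B :: "real \<Rightarrow> 'w \<Rightarrow> real ^ 'm"
  assumes "prob_space M" "0 < T" "\<And>t. t \<in> {0..T} \<Longrightarrow> B t \<in> borel_measurable M"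
  shows "filtration M (natural_filtration M B) T"
proof -
  let ?G = "\<lambda>t. {B s -` A \<inter> space M | s A. s \<in> {0..t} \<and> A \<in> sets borel} \<union> null_sets M"
  have G_M: "?G t \<subseteq> sets M" if "t \<in> {0..T}" for t
    using measurable_sets[OF assms(3)] that by auto
  have Pow: "?G t \<subseteq> Pow (space M)" for t
    using sets.sets_into_space by (auto dest: null_setsD2)
  have sets: "sets (natural_filtration M B t) = sigma_sets (space M) (?G t)" for t
    unfolding natural_filtration_def by (rule sets_measure_of[OF Pow])
  have space: "space (natural_filtration M B t) = space M" for t
    unfolding natural_filtration_def by (rule space_measure_of[OF Pow])
  show ?thesis
  proof (intro filtration.intro filtration_axioms.intro assms(1,2))
    show "subalgebra M (natural_filtration M B t)" if "t \<in> {0..T}" for t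
      unfolding subalgebra_def sets space using sets.sigma_sets_subset[OF G_M[OF that]] by simp
    show "sets (natural_filtration M B s) \<subseteq> sets (natural_filtration M B t)" if "s \<le> t" for s t
      unfolding sets using that by (intro sigma_sets_mono') fastforce
  qed
qed

theorem theorem6p8:
  fixes M :: "'w measure"
    and B :: "real \<Rightarrow> 'w \<Rightarrow> real ^ 'm"
    and T :: real
    and \<xi> :: "'w \<Rightarrow> (real ^ 'd) set"
    and f :: "real \<Rightarrow> 'w \<Rightarrow> (real ^ 'd) set \<Rightarrow> (real ^ 'd) set"
  defines "F \<equiv> natural_filtration M B"
  assumes "prob_space M"
    and "complete_measure M"
    and "T > 0"
    and "standard_brownian_motion M T B"
    and "\<xi> \<in> set_Lp 2 M (F T)"
    and "\<forall>t\<in>{0..T}. \<forall>\<omega>\<in>space M. \<forall>A\<in>compact_convex_sets. f t \<omega> A \<in> compact_convex_sets"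
    and "\<forall>A\<in>compact_convex_sets. set_progressive F T (\<lambda>t \<omega>. f t \<omega> A)"
    and "(\<integral>\<^sup>+\<omega>. (\<integral>\<^sup>+t\<in>{0..T}. set_norm (f t \<omega> {0}) ^ 2 \<partial>lborel) \<partial>M) < \<infinity>"
    and "\<exists>K>0. \<forall>t\<in>{0..T}. \<forall>\<omega>\<in>space M. \<forall>A\<in>compact_convex_sets. \<forall>A'\<in>compact_convex_sets.
           hausdorff_dist (f t \<omega> A) (f t \<omega> A') \<le> ennreal K * hausdorff_dist A A'"
  shows "(\<exists>Y. set_bsde_solution M F T \<xi> f Y) \<and>
         (\<forall>Y Y'. set_bsde_solution M F T \<xi> f Y \<and> set_bsde_solution M F T \<xi> f Y' \<longrightarrow>
            (\<forall>t\<in>{0..T}. AE \<omega> in M. Y t \<omega> = Y' t \<omega>))"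
proof -
  obtain K where K: "0 < K" "\<forall>t\<in>{0..T}. \<forall>\<omega>\<in>space M. \<forall>A\<in>compact_convex_sets. \<forall>A'\<in>compact_convex_sets.
           hausdorff_dist (f t \<omega> A) (f t \<omega> A') \<le> ennreal K * hausdorff_dist A A'"
    using assms(10) by blast
  have "B t \<in> borel_measurable M" if "t \<in> {0..T}" for t
    using assms(5) that by (simp add: standard_brownian_motion_def)
  then have "filtration M F T" unfolding F_def using assms(2,4) by (intro natural_filtration_filtration)
  then interpret bsde M F T \<xi> f K
    by (intro bsde.intro bsde_axioms.intro) (use assms(6-9) K in auto)
  obtain Y where "Y \<in> set_process_L2 M F T" "solves_step Y Y" by (rule solution_exists)
  then show ?thesis unfolding bsde_solution_iff using solution_unique by blast
qed

end
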